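(* Let $0<p<q<\infty$ with $\frac1p-\frac1q\le1$, and let $g$ be an analytic function in $\mathbb{D}$. The following are equivalent: (i) $T_g:\mathcal{D}^p_{p-1}\to H^q$ is compact; (ii) $T_g:H^p\to H^q$ is compact; (iii) $g\in\lambda\left(\frac1p-\frac1q\right)$.
   Context: $\mathbb{D}=\{z\in\mathbb{C}:|z|<1\}$, $\mathbb{T}=\partial\mathbb{D}$, $\mathcal{H}(\mathbb{D})$ is the space of analytic functions in $\mathbb{D}$, and $dA(z)=\frac{dx\,dy}{\pi}$. For $0<p<\infty$, the Hardy space $H^p$ consists of $f\in\mathcal{H}(\mathbb{D})$ with $\|f\|_{H^p}=\lim_{r\to1^-}\left(\frac{1}{2\pi}\int_0^{2\pi}|f(re^{i\theta})|^p\,d\theta\right)^{1/p}<\infty$. The Dirichlet-type space $\mathcal{D}^p_{p-1}$ consists of $f\in\mathcal{H}(\mathbb{D})$ with $\|f\|_{\mathcal{D}^p_{p-1}}^p=\int_{\mathbb{D}}|f'(z)|^p(1-|z|^2)^{p-1}\,dA(z)+|f(0)|^p<\infty$. For $g\in\mathcal{H}(\mathbb{D})$, $T_g(f)(z)=\int_0^z f(\zeta)g'(\zeta)\,d\zeta$, $z\in\mathbb{D}$. The operator $T_g:X\to Y$ is compact if it maps bounded subsets of $X$ to relatively compact subsets of $Y$. For $0<\alpha\le1$, the little Lipschitz space $\lambda(\alpha)$ consists of those $g\in\mathcal{H}(\mathbb{D})$ that extend continuously to $\overline{\mathbb{D}}$ and whose boundary values satisfy $$\lim_{t\to0^+}\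 \sup_{\theta\in[0,2\pi]}\frac{|g(e^{i(\theta+t)})-g(e^{i\theta})|}{t^\alpha}=0.$$ *)

theory Defs
  imports "HOL-Complex_Analysis.Complex_Analysis"
begin

(* A function on the disc is represented by a total function that vanishes off the disc.
   Hence two members of a space below are equal as soon as they agree on the disc, which
   is needed for the quasi-norms to separate points. *)
definition disc_analytic :: "(complex \<Rightarrow> complex) set" where
  "disc_analytic = {f. f holomorphic_on ball 0 1 \<and> (\<forall>z. z \<notin> ball 0 1 \<longrightarrow> f z = 0)}"

definition integral_mean :: "real \<Rightarrow> (complex \<Rightarrow> complex) \<Rightarrow> real \<Rightarrow> real" where
  "integral_mean p f r =
     (1 / (2 * pi) * integral {0..2 * pi} (\<lambda>\<theta>. norm (f (of_real r * cis \<theta>)) powr p)) powr (1 / p)"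

definition hardy_norm :: "real \<Rightarrow> (complex \<Rightarrow> complex) \<Rightarrow> real" where
  "hardy_norm p f = Lim (at_left 1) (integral_mean p f)"

(* The limit is a real number here, so its existence includes its finiteness. *)
definition hardy_space :: "real \<Rightarrow> (complex \<Rightarrow> complex) set" where
  "hardy_space p = {f \<in> disc_analytic. \<exists>L::real. (integral_mean p f \<longlongrightarrow> L) (at_left 1)}"

(* For p < 1 the quasi-norm only satisfies the triangle inequality after raising it to the
   power p. The exponent min 1 p gives a metric for every p > 0; its balls are the
   quasi-norm balls, so it induces the usual topology. *)
definition hardy_dist :: "real \<Rightarrow> (complex \<Rightarrow> complex) \<Rightarrow> (complex \<Rightarrow> complex) \<Rightarrow> real" where
  "hardy_dist p f h = hardy_norm p (\<lambda>z. f z - h z) powr min 1 p"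

definition dirichlet_density :: "real \<Rightarrow> (complex \<Rightarrow> complex) \<Rightarrow> complex \<Rightarrow> real" where
  "dirichlet_density p f z = norm (deriv f z) powr p * (1 - (norm z)\<^sup>2) powr (p - 1)"

definition dirichlet_space :: "real \<Rightarrow> (complex \<Rightarrow> complex) set" where
  "dirichlet_space p = {f \<in> disc_analytic. set_integrable lborel (ball 0 1) (dirichlet_density p f)}"

(* The factor 1 / pi is the normalisation of area measure dA = dx dy / pi. *)
definition dirichlet_norm :: "real \<Rightarrow> (complex \<Rightarrow> complex) \<Rightarrow> real" where
  "dirichlet_norm p f =
     (1 / pi * (LINT z:ball 0 1|lborel. dirichlet_density p f z) + norm (f 0) powr p) powr (1 / p)"

definition T_op :: "(complex \<Rightarrow> complex) \<Rightarrow> (complex \<Rightarrow> complex) \<Rightarrow> complex \<Rightarrow> complex" where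
  "T_op g f z =
     (if z \<in> ball 0 1 then contour_integral (linepath 0 z) (\<lambda>\<zeta>. f \<zeta> * deriv g \<zeta>) else 0)"

(* X carries a (quasi-)norm N, which determines its bounded sets; Y carries a metric d,
   which determines its topology. *)
definition compact_operator ::
    "'a set \<Rightarrow> ('a \<Rightarrow> real) \<Rightarrow> 'b set \<Rightarrow> ('b \<Rightarrow> 'b \<Rightarrow> real) \<Rightarrow> ('a \<Rightarrow> 'b) \<Rightarrow> bool" where
  "compact_operator X N Y d T \<longleftrightarrow>
     (\<forall>B. B \<subseteq> X \<and> (\<exists>C. \<forall>f\<in>B. N f \<le> C) \<longrightarrow>
        T ` B \<subseteq> Y \<and>
        compactin (Metric_space.mtopology Y d) (Metric_space.mtopology Y d closure_of (T ` B)))"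

(* Only the values of g on the disc matter; G is its continuous extension to the closed disc. *)
definition little_lipschitz :: "real \<Rightarrow> (complex \<Rightarrow> complex) set" where
  "little_lipschitz \<alpha> = {g. g holomorphic_on ball 0 1 \<and>
     (\<exists>G. continuous_on (cball 0 1) G \<and> (\<forall>z\<in>ball 0 1. G z = g z) \<and>
        ((\<lambda>t. SUP \<theta>\<in>{0..2 * pi}. norm (G (cis (\<theta> + t)) - G (cis \<theta>)) / t powr \<alpha>) \<longlongrightarrow> 0)
          (at_right 0))}"

end

theory Submission
  imports Defs
begin

text \<open>
  Put \<alpha> = 1/p - 1/q. Each of the three conditions is shown to be equivalent to the growth
  condition |g'(z)| = o((1 - |z|)^(\<alpha> - 1)) as |z| tends to 1, called little_growth below.
  
  Growth implies compactness. Along the ray through a point \<zeta> of the circle, T_g f has derivative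
  of modulus |f(t \<zeta>) g'(t \<zeta>)|, so the growth of g' reduces the matter to the integral of
  |f(t \<zeta>)| (1 - t)^(\<alpha> - 1) over t. It is estimated by the method of Hedberg. Far from
  the circle one uses |f(z)| \<le> C N (1 - |z|)^(-1/p), where N is the norm of f; close to the circle one
  uses a function M(\<zeta>) with integral at most C N^p that controls |f|^p along the ray. Changing from
  one estimate to the other where they cross gives the bound C (N + N^(1 - p/q) M(\<zeta>)^(1/q))
  (radial_hedberg), and its q-th power integrates to a multiple of N^q (T_op_pmean_le). This works for all 0 < p < q alike and needs no square function.
  The domain space enters only through the pointwise growth and the majorant, so one proof serves
  both domain spaces (radially_controlled). Compactness follows with normal
  families: differences of a locally uniformly convergent subsequence are small on compact discs, and
  near the circle the factor o(1) in the growth of g' makes their images small in H^q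
  (compact_operator_if_little_growth).
  
  The majorants. For H^p it is the radial maximal function (radial_maximal). The sub-mean value property
  of |f|^s, for all s > 0, against the Poisson kernel (powr_sub_mean) reduces the maximal theorem to an
  estimate for Poisson integrals in L^2, where it follows from the semigroup law of the kernel by a
  T T^* argument (poisson_selection_L2). For the Dirichlet-type space the majorant is a Poisson integral
  of the density |f'|^p (1 - |z|^2)^(p-1), which bounds ((1 - |z|) |f'(z)|)^p along the ray
  (deriv_le_density_poisson).
  
  Compactness implies growth. The p-th roots of Poisson kernels (poisson_root) are bounded in both domain
  spaces and tend to zero locally uniformly as their pole approaches the circle. By compactness their
  images tend to zero in H^q; since (T_g f)' = f g', the growth of derivatives of functions in H^q,
  evaluated at the parameter of the test function, is the growth condition
  (little_growth_if_compact_operator).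
  
  Growth and smoothness. This is the theorem of Hardy and Littlewood on Lipschitz classes. In one direction
  one joins two boundary points at angular distance t through the circle of radius 1 - t; in the other one
  estimates the Cauchy integral of g'. For \<alpha> = 1 the Cauchy integral is too large by a
  logarithm, but then g is constant.
\<close>

section \<open>Arc length and the Poisson kernel\<close>

text \<open>
  Normalised arc length, parametrised by the angle. It is a measure on the whole real line, so that
  functions of the angle need not be restricted to an interval.
\<close>

definition circ :: "real measure" where
  "circ = density lborel (\<lambda>x. ennreal (indicator {0..2 * pi} x / (2 * pi)))"

lemma sets_circ [measurable_cong, simp]: "sets circ = sets borel"
  by (simp add: circ_def)

lemma space_circ [simp]: "space circ = UNIV"
  by (simp add: circ_def)

lemma emeasure_circ_UNIV: "emeasure circ UNIV = 1"
proof -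
  have "emeasure circ UNIV = (\<integral>\<^sup>+x. ennreal (1 / (2 * pi)) * indicator {0..2 * pi} x \<partial>lborel)"
    unfolding circ_def
    by (subst emeasure_density) (auto intro!: nn_integral_cong split: split_indicator)
  also have "\<dots> = ennreal (1 / (2 * pi)) * ennreal (2 * pi)"
    by (subst nn_integral_cmult_indicator) auto
  also have "\<dots> = 1"
    by (subst ennreal_mult[symmetric]) auto
  finally show ?thesis .
qed

interpretation circ: finite_measure circ
  by (rule finite_measureI) (simp add: emeasure_circ_UNIV)

interpretation circ2: pair_sigma_finite circ circ ..

lemma measure_circ_UNIV [simp]: "measure circ UNIV = 1"
  by (simp add: measure_def emeasure_circ_UNIV)

lemma integrable_circ_bounded:
  fixes f :: "real \<Rightarrow> 'a::{banach, second_countable_topology}"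
  assumes "f \<in> borel_measurable borel" "\<And>x. norm (f x) \<le> B"
  shows "integrable circ f"
  by (rule circ.integrable_const_bound[of _ B]) (use assms in \<open>auto simp: measurable_cong_sets[OF sets_circ refl]\<close>)

lemma integral_circ_const [simp]: "(LINT x|circ. c) = (c :: real)"
  by (simp add: measure_circ_UNIV)

lemma integral_circ_mono:
  fixes f g :: "real \<Rightarrow> real"
  assumes "integrable circ f" "integrable circ g" "\<And>x. f x \<le> g x"
  shows "(LINT x|circ. f x) \<le> (LINT x|circ. g x)"
  using assms by (intro integral_mono) auto

text \<open>
  Relates arc length to the gauge integrals by which the integral means are defined.
\<close>

lemma integral_circ_continuous:
  fixes f :: "real \<Rightarrow> 'a::euclidean_space"
  assumes "continuous_on UNIV f"
  shows "(LINT x|circ. f x) = (1 / (2 * pi)) *\<^sub>R integral {0..2 * pi} f"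
proof -
  have [measurable]: "f \<in> borel_measurable borel"
    using assms by (rule borel_measurable_continuous_onI)
  have cont: "continuous_on {0..2 * pi} f"
    using assms continuous_on_subset by blast
  have "(LINT x|circ. f x) = (LINT x|lborel. (indicator {0..2 * pi} x / (2 * pi)) *\<^sub>R f x)"
    unfolding circ_def by (subst integral_density) auto
  also have "\<dots> = (LINT x|lborel. (1 / (2 * pi)) *\<^sub>R (indicator {0..2 * pi} x *\<^sub>R f x))"
    by (intro Bochner_Integration.integral_cong) auto
  also have "\<dots> = (1 / (2 * pi)) *\<^sub>R (LINT x:{0..2 * pi}|lborel. f x)"
    unfolding set_lebesgue_integral_def by (rule integral_scaleR_right)
  also have "(LINT x:{0..2 * pi}|lborel. f x) = integral {0..2 * pi} f"
    by (intro set_borel_integral_eq_integral(2) borel_integrable_atLeastAtMost' cont)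
  finally show ?thesis .
qed

lemma continuous_on_bounded_circle:
  fixes f :: "complex \<Rightarrow> 'a::real_normed_vector"
  assumes "continuous_on (sphere 0 1) f"
  shows "\<exists>B. \<forall>x. norm (f (cis x)) \<le> B"
proof -
  have "compact (f ` sphere 0 1)"
    using assms by (intro compact_continuous_image) auto
  then obtain B where "\<forall>y\<in>f ` sphere 0 1. norm y \<le> B"
    using compact_imp_bounded bounded_iff by metis
  then show ?thesis by (intro exI[of _ B]) auto
qed

definition poisson :: "complex \<Rightarrow> real \<Rightarrow> real" where
  "poisson z \<phi> = (1 - (norm z)\<^sup>2) / (norm (cis \<phi> - z))\<^sup>2"

lemma cis_measurable [measurable]: "cis \<in> borel_measurable borel"
  by (intro borel_measurable_continuous_onI continuous_intros)

lemma poisson_measurable [measurable]: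
  assumes [measurable]: "f \<in> borel_measurable M" "g \<in> borel_measurable M"
  shows "(\<lambda>x. poisson (f x) (g x)) \<in> borel_measurable M"
proof -
  show ?thesis
    unfolding poisson_def by measurable
qed

lemma norm_cis_diff_ge: "1 - norm z \<le> norm (cis \<phi> - z)"
  using norm_triangle_ineq2[of "cis \<phi>" z] by simp

lemma poisson_pos: "norm z < 1 \<Longrightarrow> 0 < poisson z \<phi>"
  using norm_cis_diff_ge[of z \<phi>] unfolding poisson_def
  by (intro divide_pos_pos) (auto simp: abs_square_less_1)

lemma poisson_nonneg: "norm z < 1 \<Longrightarrow> 0 \<le> poisson z \<phi>"
  using poisson_pos[of z \<phi>] by simp

lemma poisson_le:
  assumes "norm z < 1"
  shows "poisson z \<phi> \<le> 2 / (1 - norm z)"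
proof -
  have "poisson z \<phi> \<le> (1 - (norm z)\<^sup>2) / (1 - norm z)\<^sup>2"
    unfolding poisson_def using assms norm_cis_diff_ge[of z \<phi>]
    by (intro divide_left_mono power_mono mult_pos_pos zero_less_power) (auto simp: abs_square_le_1)
  also have "\<dots> = (1 + norm z) / (1 - norm z)"
  proof -
    have "1 - (norm z)\<^sup>2 = (1 + norm z) * (1 - norm z)"
      by (simp add: power2_eq_square algebra_simps)
    then show ?thesis
      using assms by (simp add: power2_eq_square)
  qed
  also have "\<dots> \<le> 2 / (1 - norm z)"
    using assms by (intro divide_right_mono) auto
  finally show ?thesis .
qed

lemma continuous_on_poisson: "norm z < 1 \<Longrightarrow> continuous_on UNIV (poisson z)"
  unfolding poisson_def
  by (intro continuous_intros) (use norm_cis_diff_ge[of z] in \<open>auto simp: algebra_simps\<close>)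

text \<open>
  This is Cauchy's formula at z for the function F(w) (1 - |z|^2) / (1 - cnj z w): the factor equals 1 at
  w = z, and on the circle it turns the Cauchy kernel into the Poisson kernel.
\<close>

lemma poisson_formula:
  assumes F: "F holomorphic_on cball 0 1" and z: "norm z < 1"
  shows "(LINT \<phi>|circ. poisson z \<phi> *\<^sub>R F (cis \<phi>)) = F z"
proof -
  define H where "H w = F w * (1 - (norm z)\<^sup>2) / (1 - cnj z * w)" for w
  have nz: "1 - cnj z * w \<noteq> 0" if "norm w \<le> 1" for w
  proof
    assume "1 - cnj z * w = 0"
    then have "norm (cnj z * w) = 1" by simp
    moreover have "norm (cnj z * w) \<le> norm z * 1"
      unfolding norm_mult using that by (intro mult_mono) auto
    ultimately show False using z by simp
  qed
  have H: "H holomorphic_on cball 0 1"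
    unfolding H_def using F nz by (intro holomorphic_intros) (auto simp: dist_norm)
  have HF: "H z = F z"
  proof -
    have "1 - cnj z * z = of_real (1 - (norm z)\<^sup>2)"
      by (simp only: of_real_diff complex_norm_square) (simp add: mult.commute)
    then show ?thesis using nz[of z] z unfolding H_def by simp
  qed
  have "((\<lambda>u. H u / (u - z)) has_contour_integral (2 * of_real pi * \<i> * H z)) (circlepath 0 1)"
    using Cauchy_integral_circlepath_simple[OF H, of z] z by simp
  then have "((\<lambda>t. H (cis t) / (cis t - z) * \<i> * cis t) has_integral (2 * of_real pi * \<i> * H z)) {0..2*pi}"
    unfolding circlepath_def by (subst (asm) has_contour_integral_part_circlepath_iff) auto
  moreover have "H (cis t) / (cis t - z) * \<i> * cis t = \<i> * (poisson z t *\<^sub>R F (cis t))" for t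
  proof -
    have ne: "cis t - z \<noteq> 0" using norm_cis_diff_ge[of z t] z by auto
    have 1: "1 - cnj z * cis t = cis t * cnj (cis t - z)"
      by (simp add: algebra_simps cis_cnj cis_mult)
    have 2: "(cis t - z) * cnj (cis t - z) = of_real ((norm (cis t - z))\<^sup>2)"
      by (simp only: complex_norm_square)
    have "H (cis t) / (cis t - z) * \<i> * cis t = \<i> * (F (cis t) * (1 - (norm z)\<^sup>2)) / ((cis t - z) * cnj (cis t - z))"
    proof -
      have "a / (c * X) / d * \<i> * c = \<i> * a / (d * X)" if "c \<noteq> 0" for a c d X :: complex
        using that by (simp add: mult.commute)
      from this[of "cis t"] show ?thesis
        unfolding H_def 1 by simp
    qed
    also have "\<dots> = \<i> * (poisson z t *\<^sub>R F (cis t))"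
      unfolding 2 poisson_def by (simp add: scaleR_conv_of_real)
    finally show ?thesis .
  qed
  ultimately have "((\<lambda>t. \<i> * (poisson z t *\<^sub>R F (cis t))) has_integral (2 * of_real pi * \<i> * F z)) {0..2*pi}"
    by (simp add: HF)
  then have "((\<lambda>t. (-\<i>) * (\<i> * (poisson z t *\<^sub>R F (cis t)))) has_integral ((-\<i>) * (2 * of_real pi * \<i> * F z))) {0..2*pi}"
    by (rule has_integral_mult_right)
  then have I: "integral {0..2*pi} (\<lambda>t. poisson z t *\<^sub>R F (cis t)) = 2 * of_real pi * F z"
    by (simp add: mult.assoc[symmetric] integral_unique)
  have "continuous_on UNIV (\<lambda>t. poisson z t *\<^sub>R F (cis t))"
    using F z by (intro continuous_on_scaleR continuous_on_poisson
        continuous_on_compose2[OF holomorphic_on_imp_continuous_on[OF F]] continuous_intros) auto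
  from integral_circ_continuous[OF this] show ?thesis
    unfolding I by (simp add: scaleR_conv_of_real)
qed

lemma integral_poisson: "norm z < 1 \<Longrightarrow> (LINT \<phi>|circ. poisson z \<phi>) = 1"
proof -
  assume z: "norm z < 1"
  have int: "integrable circ (poisson z)"
    using poisson_le[OF z] poisson_nonneg[OF z]
    by (intro integrable_circ_bounded[where B="2 / (1 - norm z)"]) auto
  have "complex_of_real (LINT \<phi>|circ. poisson z \<phi>) = (LINT \<phi>|circ. poisson z \<phi> *\<^sub>R 1)"
    by (simp add: scaleR_conv_of_real)
  also have "\<dots> = 1" using poisson_formula[of "\<lambda>_. 1" z] z by simp
  finally show ?thesis by simp
qed

lemma poisson_sym: "poisson (of_real r * cis \<theta>) \<phi> = poisson (of_real r * cis \<phi>) \<theta>"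
proof -
  have "cis \<phi> - of_real r * cis \<theta> = cis (\<theta> + \<phi>) * cnj (cis \<theta> - of_real r * cis \<phi>)"
    by (simp add: algebra_simps cis_cnj cis_mult)
  then have "norm (cis \<phi> - of_real r * cis \<theta>) = norm (cis \<theta> - of_real r * cis \<phi>)"
    by (simp add: norm_mult del: complex_cnj_diff)
  then show ?thesis by (simp add: poisson_def norm_mult)
qed

text \<open>
  Displays the kernel as the real part of a function that is holomorphic in r cis \<theta>, so that the
  Poisson formula applies to the kernel itself.
\<close>

lemma poisson_eq_Re:
  assumes "0 \<le> r" "r < 1"
  shows "poisson (of_real r * cis \<theta>) \<phi> = Re ((1 + of_real r * cis \<theta> * cis (-\<phi>)) / (1 - of_real r * cis \<theta> * cis (-\<phi>)))"
proof -
  define w where "w = of_real r * cis \<theta> * cis (-\<phi>)"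
  have nw: "norm w = r" using assms by (simp add: w_def norm_mult)
  have "cis \<phi> - of_real r * cis \<theta> = cis \<phi> * (1 - w)"
    by (simp add: w_def algebra_simps cis_mult)
  then have eq: "norm (cis \<phi> - of_real r * cis \<theta>) = norm (1 - w)"
    by (simp add: norm_mult)
  have "Re ((1 + w) / (1 - w)) = (1 - (norm w)\<^sup>2) / (norm (1 - w))\<^sup>2"
    by (simp add: Re_divide cmod_power2) (simp add: algebra_simps power2_eq_square)
  then show ?thesis
    using assms by (simp add: poisson_def eq w_def[symmetric] nw norm_mult)
qed

lemma poisson_semigroup:
  assumes "0 \<le> r" "r < 1" "0 \<le> s" "s < 1"
  shows "(LINT \<phi>|circ. poisson (of_real r * cis \<theta>) \<phi> * poisson (of_real s * cis \<psi>) \<phi>)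
         = poisson (of_real (r * s) * cis \<theta>) \<psi>"
proof -
  define F where "F w = (1 + of_real s * w * cis (-\<psi>)) / (1 - of_real s * w * cis (-\<psi>))" for w
  have nz: "1 - of_real s * w * cis (-\<psi>) \<noteq> 0" if "norm w \<le> 1" for w
  proof
    assume "1 - of_real s * w * cis (-\<psi>) = 0"
    then have "norm (of_real s * w * cis (-\<psi>)) = 1" by simp
    moreover have "norm (of_real s * w * cis (-\<psi>)) \<le> s"
      using that assms mult_left_le[of "norm w" s] by (simp add: norm_mult)
    ultimately show False using assms by simp
  qed
  have F: "F holomorphic_on cball 0 1"
    unfolding F_def using nz by (intro holomorphic_intros) (auto simp: dist_norm)
  have P: "poisson (of_real s * cis \<psi>) \<phi> = Re (F (cis \<phi>))" for \<phi>
    using poisson_eq_Re[OF assms(3,4), of \<phi> \<psi>] by (subst poisson_sym) (simp add: F_def)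
  have n: "norm (of_real r * cis \<theta>) < 1" using assms by (simp add: norm_mult)
  have cont: "continuous_on (sphere 0 1) F"
    using F holomorphic_on_imp_continuous_on continuous_on_subset sphere_cball by blast
  obtain B where B: "\<And>x. norm (F (cis x)) \<le> B"
    using continuous_on_bounded_circle[OF cont] by blast
  have meas: "(\<lambda>\<phi>. F (cis \<phi>)) \<in> borel_measurable borel"
    using cont by (intro borel_measurable_continuous_onI continuous_on_compose2[OF cont] continuous_intros) auto
  have int: "integrable circ (\<lambda>\<phi>. poisson (of_real r * cis \<theta>) \<phi> *\<^sub>R F (cis \<phi>))"
  proof (rule integrable_circ_bounded)
    show "norm (poisson (of_real r * cis \<theta>) x *\<^sub>R F (cis x)) \<le> 2 / (1 - norm (of_real r * cis \<theta>)) * B" for x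
      using poisson_le[OF n, of x] poisson_nonneg[OF n, of x] B[of x] n
      by (simp only: norm_scaleR) (intro mult_mono, auto)
  qed (use meas in measurable)
  have "(LINT \<phi>|circ. poisson (of_real r * cis \<theta>) \<phi> * poisson (of_real s * cis \<psi>) \<phi>)
        = (LINT \<phi>|circ. Re (poisson (of_real r * cis \<theta>) \<phi> *\<^sub>R F (cis \<phi>)))"
    by (simp add: P)
  also have "\<dots> = Re (LINT \<phi>|circ. poisson (of_real r * cis \<theta>) \<phi> *\<^sub>R F (cis \<phi>))"
    by (rule integral_Re[OF int])
  also have "\<dots> = Re (F (of_real r * cis \<theta>))"
    using poisson_formula[OF F n] by simp
  also have "\<dots> = poisson (of_real (r * s) * cis \<theta>) \<psi>"
    using assms mult_le_one[of r s] mult_strict_mono[of r 1 s 1]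
    by (subst poisson_eq_Re) (auto simp: F_def mult_ac)
  finally show ?thesis .
qed

text \<open>
  The gaps satisfy max (1 - r) (1 - s) \<le> 1 - r s \<le> (1 - r) + (1 - s), so the kernel at radius r s is
  comparable with the kernel at the smaller radius. Adding the other kernel makes the bound symmetric
  in r and s, which is what the T T^* argument below needs.
\<close>

lemma poisson_product_le:
  assumes "0 \<le> r" "r < 1" "0 \<le> s" "s < 1"
  shows "poisson (of_real (r * s) * cis \<theta>) \<psi>
         \<le> 8 * (poisson (of_real r * cis \<theta>) \<psi> + poisson (of_real s * cis \<theta>) \<psi>)"
proof -
  have key: "poisson (of_real (r * s) * cis \<theta>) \<psi> \<le> 8 * poisson (of_real r * cis \<theta>) \<psi>"
    if rs: "r \<le> s" "0 \<le> r" "r < 1" "0 \<le> s" "s < 1" for r s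
  proof -
    define D where "D \<rho> = norm (cis \<psi> - of_real \<rho> * cis \<theta>)" for \<rho>
    have le: "r * s \<le> r" using rs by (simp add: mult_left_le)
    have nn: "0 \<le> r * s" using rs by simp
    have Dr: "1 - r \<le> D r" and Drs: "1 - r * s \<le> D (r * s)"
      using norm_cis_diff_ge[of "of_real r * cis \<theta>" \<psi>] norm_cis_diff_ge[of "of_real (r * s) * cis \<theta>" \<psi>] rs
      by (auto simp: D_def norm_mult)
    have "D r \<le> D (r * s) + norm (of_real (r * s) * cis \<theta> - of_real r * cis \<theta>)"
      unfolding D_def using norm_triangle_ineq[of "cis \<psi> - of_real (r * s) * cis \<theta>" "of_real (r * s) * cis \<theta> - of_real r * cis \<theta>"] by simp
    also have "norm (of_real (r * s) * cis \<theta> - of_real r * cis \<theta>) = r - r * s"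
    proof -
      have "of_real (r * s) * cis \<theta> - of_real r * cis \<theta> = of_real (r * s - r) * cis \<theta>"
        by (simp add: algebra_simps)
      then show ?thesis using le by (simp only: norm_mult norm_of_real) auto
    qed
    finally have D2: "D r \<le> 2 * D (r * s)" using Drs le rs by linarith
    have "r * r \<le> r * s" using rs by (intro mult_left_mono) auto
    then have "(r * r) * (r * r) \<le> (r * s) * (r * s)" using rs by (intro mult_mono) auto
    then have num: "1 - (r * s)\<^sup>2 \<le> 2 * (1 - r\<^sup>2)"
      using sum_squares_ge_zero[of "1 - r * r" 0] by (simp add: power2_eq_square algebra_simps)
    have "poisson (of_real (r * s) * cis \<theta>) \<psi> = (1 - (r * s)\<^sup>2) / (D (r * s))\<^sup>2"
      using rs by (simp add: poisson_def D_def norm_mult power_mult_distrib)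
    also have "\<dots> \<le> (2 * (1 - r\<^sup>2)) / (D r / 2)\<^sup>2"
      using num D2 Dr rs by (intro frac_le power_mono zero_less_power) (auto simp: abs_square_le_1)
    also have "\<dots> = 8 * poisson (of_real r * cis \<theta>) \<psi>"
      using rs by (simp add: poisson_def D_def norm_mult power_divide)
    finally show ?thesis .
  qed
  have nn: "0 \<le> poisson (of_real \<rho> * cis \<theta>) \<psi>" if "0 \<le> \<rho>" "\<rho> < 1" for \<rho>
    using that by (intro poisson_nonneg) (simp add: norm_mult)
  show ?thesis
  proof (cases "r \<le> s")
    case True
    show ?thesis using key[OF True] nn[of s] assms by (auto simp: algebra_simps)
  next
    case False
    then show ?thesis using key[of s r] nn[of r] assms by (auto simp: algebra_simps)
  qed
qed


section \<open>Subharmonicity of powers of the modulus\<close>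

lemma integrable_poisson_times:
  assumes "norm z < 1" "u \<in> borel_measurable borel" "\<And>\<phi>. \<bar>u \<phi>\<bar> \<le> (B::real)"
  shows "integrable circ (\<lambda>\<phi>. poisson z \<phi> * u \<phi>)"
proof (rule integrable_circ_bounded)
  show "norm (poisson z \<phi> * u \<phi>) \<le> 2 / (1 - norm z) * B" for \<phi>
    using poisson_le[OF assms(1), of \<phi>] poisson_nonneg[OF assms(1), of \<phi>] assms(1) assms(3)[of \<phi>]
    by (simp only: abs_mult real_norm_def) (intro mult_mono, auto)
qed (use assms(2) in measurable)

lemma circ_integral_bound:
  fixes f :: "real \<Rightarrow> real"
  assumes [measurable]: "f \<in> borel_measurable borel" and B: "\<And>x. \<bar>f x\<bar> \<le> B"
  shows "\<bar>LINT x|circ. f x\<bar> \<le> B"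
proof -
  have B0: "0 \<le> B" using B[of 0] by linarith
  have "\<bar>LINT x|circ. f x\<bar> \<le> (LINT x|circ. \<bar>f x\<bar>)"
    using integral_norm_bound[of circ f] by simp
  also have "\<dots> \<le> (LINT x|circ. B)"
    by (intro integral_circ_mono B integrable_circ_bounded[where B=B]) (use B B0 in auto)
  finally show ?thesis by simp
qed

lemma circ_fubini:
  fixes H :: "real \<Rightarrow> real \<Rightarrow> real"
  assumes [measurable]: "case_prod H \<in> borel_measurable (borel \<Otimes>\<^sub>M borel)" and "\<And>x y. \<bar>H x y\<bar> \<le> B"
  shows "(LINT y|circ. LINT x|circ. H x y) = (LINT x|circ. LINT y|circ. H x y)"
proof (rule circ2.Fubini_integral)
  interpret P: finite_measure "circ \<Otimes>\<^sub>M circ"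
    by (intro finite_measure_pair_measure circ.finite_measure_axioms)
  show "integrable (circ \<Otimes>\<^sub>M circ) (case_prod H)"
  proof (rule P.integrable_const_bound[of _ B])
    show "case_prod H \<in> borel_measurable (circ \<Otimes>\<^sub>M circ)"
      using assms(1) by (simp cong: measurable_cong_sets sets_pair_measure_cong)
  qed (use assms(2) in auto)
qed

lemma circ_powr_measurable:
  assumes "continuous_on (sphere 0 1) (f :: complex \<Rightarrow> complex)"
  shows "(\<lambda>\<phi>. norm (f (cis \<phi>)) powr p) \<in> borel_measurable borel"
proof -
  have "(\<lambda>\<phi>. f (cis \<phi>)) \<in> borel_measurable borel"
    by (intro borel_measurable_continuous_onI continuous_on_compose2[OF assms] continuous_intros) auto
  then show ?thesis by measurable
qed

text \<open>
  A zero-free f has a holomorphic power f^s = exp (s h), and the Poisson formula holds for it.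
\<close>

lemma powr_sub_mean_zero_free:
  assumes f: "f holomorphic_on ball 0 R" and R: "1 < R" and s: "0 < s" and z: "norm z < 1"
    and nz: "\<And>w. w \<in> ball 0 R \<Longrightarrow> f w \<noteq> 0"
  shows "norm (f z) powr s \<le> (LINT \<phi>|circ. poisson z \<phi> * norm (f (cis \<phi>)) powr s)"
proof -
  obtain h where h: "h holomorphic_on ball 0 R" "\<And>w. w \<in> ball 0 R \<Longrightarrow> f w = exp (h w)"
    using contractible_imp_holomorphic_log[OF f convex_imp_contractible[OF convex_ball] nz] by metis
  define F where "F w = exp (of_real s * h w)" for w
  have sub: "cball 0 1 \<subseteq> ball (0::complex) R" using R by auto
  have F: "F holomorphic_on cball 0 1"
    unfolding F_def using h(1) sub by (auto intro!: holomorphic_intros intro: holomorphic_on_subset)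
  have nF: "norm (F w) = norm (f w) powr s" if "norm w \<le> 1" for w
    using that R h(2)[of w] by (simp add: F_def norm_exp_eq_Re powr_def)
  have "norm (f z) powr s = norm (LINT \<phi>|circ. poisson z \<phi> *\<^sub>R F (cis \<phi>))"
    using z by (simp only: poisson_formula[OF F z] nF less_imp_le)
  also have "\<dots> \<le> (LINT \<phi>|circ. norm (poisson z \<phi> *\<^sub>R F (cis \<phi>)))"
    by (rule integral_norm_bound)
  also have "\<dots> = (LINT \<phi>|circ. poisson z \<phi> * norm (f (cis \<phi>)) powr s)"
    using nF poisson_nonneg[OF z] by (intro Bochner_Integration.integral_cong) auto
  finally show ?thesis .
qed

text \<open>
  Zeros on the circle itself are avoided by applying the previous lemma to f(\<rho> w) with \<rho> < 1 and
  letting \<rho> tend to 1.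
\<close>

lemma powr_sub_mean_zero_free_disc:
  assumes f: "f holomorphic_on ball 0 R" and R: "1 < R" and s: "0 < s" and z: "norm z < 1"
    and nz: "\<And>w. w \<in> ball 0 1 \<Longrightarrow> f w \<noteq> 0"
  shows "norm (f z) powr s \<le> (LINT \<phi>|circ. poisson z \<phi> * norm (f (cis \<phi>)) powr s)"
proof -
  define \<rho> where "\<rho> n = 1 - inverse (real (Suc (Suc n)))" for n
  have \<rho>: "0 < \<rho> n" "\<rho> n < 1" for n
    by (simp_all add: \<rho>_def field_simps)
  have \<rho>1: "\<rho> \<longlonglongrightarrow> 1"
    unfolding \<rho>_def by (rule tendsto_eq_intros LIMSEQ_Suc LIMSEQ_inverse_real_of_nat | simp)+
  have contf: "continuous_on (cball 0 1) f"
    using f R by (auto intro!: holomorphic_on_imp_continuous_on intro: holomorphic_on_subset)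
  have contf': "isCont f w" if "norm w \<le> 1" for w
    using f R that holomorphic_on_imp_continuous_on[OF f]
    by (intro continuous_on_interior[of "ball 0 R"]) auto
  obtain B where "\<forall>y\<in>f ` cball 0 1. norm y \<le> B"
    using compact_imp_bounded[OF compact_continuous_image[OF contf compact_cball]] bounded_iff by metis
  then have B: "norm (f w) \<le> B" if "norm w \<le> 1" for w
    using that by auto
  have le: "norm (f (\<rho> n * z)) powr s \<le> (LINT \<phi>|circ. poisson z \<phi> * norm (f (\<rho> n * cis \<phi>)) powr s)" for n
  proof -
    have "(\<lambda>w. f (\<rho> n * w)) holomorphic_on ball 0 (1 / \<rho> n)"
      by (rule holomorphic_on_compose_gen[OF _ f, of "\<lambda>w. \<rho> n * w", unfolded o_def])
         (use \<rho>[of n] R in \<open>auto intro!: holomorphic_intros simp: norm_mult field_simps\<close>)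
    moreover have "f (\<rho> n * w) \<noteq> 0" if "w \<in> ball 0 (1 / \<rho> n)" for w :: complex
      using that \<rho>[of n] by (intro nz) (auto simp: norm_mult field_simps)
    ultimately show ?thesis
      using \<rho>[of n] by (intro powr_sub_mean_zero_free[where R="1 / \<rho> n"] s z) auto
  qed
  have "(\<lambda>n. norm (f (\<rho> n * z)) powr s) \<longlonglongrightarrow> norm (f (1 * z)) powr s"
    using z s \<rho>1
    by (intro tendsto_powr' tendsto_norm isCont_tendsto_compose[OF contf'] tendsto_mult tendsto_const)
       (auto simp: tendsto_of_real_iff[of _ 1, simplified])
  moreover have "(\<lambda>n. LINT \<phi>|circ. poisson z \<phi> * norm (f (\<rho> n * cis \<phi>)) powr s)
      \<longlonglongrightarrow> (LINT \<phi>|circ. poisson z \<phi> * norm (f (cis \<phi>)) powr s)"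
  proof (rule integral_dominated_convergence[where w="\<lambda>\<phi>. poisson z \<phi> * B powr s"])
    have c: "continuous_on (sphere 0 1) (\<lambda>w. f (of_real (\<rho> n) * w))" for n
      using \<rho>[of n] by (intro continuous_on_compose2[OF contf] continuous_intros) (auto simp: norm_mult)
    have c': "continuous_on (sphere 0 1) f" using contf continuous_on_subset sphere_cball by blast
    show "(\<lambda>\<phi>. poisson z \<phi> * norm (f (cis \<phi>)) powr s) \<in> borel_measurable circ"
      using circ_powr_measurable[OF c', of s] by measurable
    show "(\<lambda>\<phi>. poisson z \<phi> * norm (f (\<rho> n * cis \<phi>)) powr s) \<in> borel_measurable circ" for n
      using circ_powr_measurable[OF c, of n s] by measurable
    show "integrable circ (\<lambda>\<phi>. poisson z \<phi> * B powr s)"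
      by (rule integrable_poisson_times[OF z]) auto
    show "AE \<phi> in circ. norm (poisson z \<phi> * norm (f (\<rho> n * cis \<phi>)) powr s) \<le> poisson z \<phi> * B powr s" for n
      using poisson_nonneg[OF z] B \<rho>[of n] s
      by (auto simp: norm_mult intro!: mult_left_mono powr_mono2)
    show "AE \<phi> in circ. (\<lambda>n. poisson z \<phi> * norm (f (\<rho> n * cis \<phi>)) powr s) \<longlonglongrightarrow> poisson z \<phi> * norm (f (cis \<phi>)) powr s"
    proof (rule AE_I2)
      fix \<phi>
      have "(\<lambda>n. norm (f (\<rho> n * cis \<phi>)) powr s) \<longlonglongrightarrow> norm (f (1 * cis \<phi>)) powr s"
        using s \<rho>1
        by (intro tendsto_powr' tendsto_norm isCont_tendsto_compose[OF contf'] tendsto_mult tendsto_const)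
           (auto simp: tendsto_of_real_iff[of _ 1, simplified])
      then show "(\<lambda>n. poisson z \<phi> * norm (f (\<rho> n * cis \<phi>)) powr s) \<longlonglongrightarrow> poisson z \<phi> * norm (f (cis \<phi>)) powr s"
        by (intro tendsto_mult tendsto_const) simp
    qed
  qed
  ultimately show ?thesis
    using le by (intro LIMSEQ_le[OF _ _ exI[of _ 0]]) auto
qed

lemma holomorphic_factor_zero_global:
  assumes f: "f holomorphic_on S" and S: "open S" "connected S" and a: "a \<in> S" "f a = 0"
    and nc: "\<not> f constant_on S"
  obtains h n where "h holomorphic_on S" "0 < n" "h a \<noteq> 0" "\<And>w. w \<in> S \<Longrightarrow> f w = (w - a) ^ n * h w"
proof -
  obtain g r n where g: "0 < n" "0 < r" "ball a r \<subseteq> S" "g holomorphic_on ball a r"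
      "\<And>w. w \<in> ball a r \<Longrightarrow> f w = (w - a)^n * g w" "\<And>w. w \<in> ball a r \<Longrightarrow> g w \<noteq> 0"
    using holomorphic_factor_zero_nonconstant[OF f S a nc] by metis
  define h where "h w = (if w \<in> ball a r then g w else f w / (w - a)^n)" for w
  have "h holomorphic_on (ball a r \<union> (S - {a}))"
    unfolding h_def
    by (rule holomorphic_on_If_Un[OF g(4)])
       (use f S g(5) in \<open>auto intro!: holomorphic_intros intro: holomorphic_on_subset\<close>)
  moreover have "ball a r \<union> (S - {a}) = S" using g a by auto
  ultimately have "h holomorphic_on S" by simp
  moreover have "f w = (w - a) ^ n * h w" if "w \<in> S" for w
    using that g(5)[of w] g(1,2) a(2) by (cases "w = a") (auto simp: h_def)
  moreover have "h a \<noteq> 0" using g by (simp add: h_def)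
  ultimately show ?thesis using that g(1) by blast
qed

text \<open>
  Hence exchanging a factor w - a, |a| < 1, for 1 - cnj a w does not change moduli on the circle and
  does not decrease them inside.
\<close>

lemma norm_blaschke_diff:
  "(norm (1 - cnj a * w))\<^sup>2 - (norm (w - a))\<^sup>2 = (1 - (norm a)\<^sup>2) * (1 - (norm w)\<^sup>2)"
proof -
  have "complex_of_real ((norm (1 - cnj a * w))\<^sup>2 - (norm (w - a))\<^sup>2) = of_real ((1 - (norm a)\<^sup>2) * (1 - (norm w)\<^sup>2))"
    by (simp only: of_real_diff of_real_mult complex_norm_square of_real_1) (simp add: algebra_simps)
  then show ?thesis by (simp only: of_real_eq_iff)
qed

text \<open>
  Zeros in the open disc are removed one at a time: at a zero a of order k the factor (w - a)^k is exchanged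
  for (1 - cnj a w)^k, which leaves the right-hand side unchanged and does not decrease the left-hand side.
  After finitely many steps f is zero-free in the disc.
\<close>

lemma powr_sub_mean:
  assumes f: "f holomorphic_on ball 0 R" and R: "1 < R" and s: "0 < s" and z: "norm z < 1"
  shows "norm (f z) powr s \<le> (LINT \<phi>|circ. poisson z \<phi> * norm (f (cis \<phi>)) powr s)"
proof -
  have const: "norm (f z) powr s \<le> (LINT \<phi>|circ. poisson z \<phi> * norm (f (cis \<phi>)) powr s)"
    if "f constant_on ball 0 R" for f
  proof -
    obtain c where c: "\<forall>w\<in>ball 0 R. f w = c" using \<open>f constant_on ball 0 R\<close> constant_on_def by metis
    then show ?thesis using z R integral_poisson[OF z] by simp
  qed
  have main: "norm (f z) powr s \<le> (LINT \<phi>|circ. poisson z \<phi> * norm (f (cis \<phi>)) powr s)"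
    if "finite {w\<in>ball 0 1. f w = 0}" "card {w\<in>ball 0 1. f w = 0} = n" "f holomorphic_on ball 0 R" for f n
    using that
  proof (induction n arbitrary: f)
    case 0
    then show ?case using powr_sub_mean_zero_free_disc[OF 0(3) R s z] by auto
  next
    case (Suc n)
    show ?case
    proof (cases "f constant_on ball 0 R")
      case True
      then show ?thesis using const Suc by blast
    next
      case False
      obtain a where a: "a \<in> ball 0 1" "f a = 0" using Suc(3) by (force dest!: card_eq_SucD)
      obtain h k where h: "h holomorphic_on ball 0 R" "0 < k" "h a \<noteq> 0"
          "\<And>w. w \<in> ball 0 R \<Longrightarrow> f w = (w - a) ^ k * h w"
        using holomorphic_factor_zero_global[OF Suc(4) open_ball connected_ball _ a(2) False] a R
        by (metis less_trans mem_ball)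
      define F where "F w = (1 - cnj a * w) ^ k * h w" for w
      have na: "norm a < 1" using a by simp
      have nz: "1 - cnj a * w \<noteq> 0" if "norm w < 1" for w
      proof
        assume "1 - cnj a * w = 0"
        then have "norm a * norm w = 1" by (metis complex_mod_cnj eq_iff_diff_eq_0 norm_mult norm_one)
        moreover have "norm a * norm w < 1 * 1" using na that by (intro mult_strict_mono') auto
        ultimately show False by simp
      qed
      have hF: "F holomorphic_on ball 0 R" unfolding F_def by (intro holomorphic_intros h)
      have zeros: "{w\<in>ball 0 1. F w = 0} = {w\<in>ball 0 1. f w = 0} - {a}"
        using nz h R by (auto simp: F_def)
      have "norm (F z) powr s \<le> (LINT \<phi>|circ. poisson z \<phi> * norm (F (cis \<phi>)) powr s)"
      proof (intro Suc.IH hF)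
        show "finite {w\<in>ball 0 1. F w = 0}" "card {w\<in>ball 0 1. F w = 0} = n"
          unfolding zeros using Suc(2,3) a by auto
      qed
      also have "\<dots> = (LINT \<phi>|circ. poisson z \<phi> * norm (f (cis \<phi>)) powr s)"
      proof -
        have "norm (F (cis \<phi>)) = norm (f (cis \<phi>))" for \<phi>
          using norm_blaschke_diff[of a "cis \<phi>"] h(4)[of "cis \<phi>"] R
          by (simp add: F_def norm_mult norm_power)
        then show ?thesis by simp
      qed
      finally have "norm (F z) powr s \<le> (LINT \<phi>|circ. poisson z \<phi> * norm (f (cis \<phi>)) powr s)" .
      moreover have "norm (f z) \<le> norm (F z)"
      proof -
        have "0 \<le> (1 - (norm a)\<^sup>2) * (1 - (norm z)\<^sup>2)"
          using na z by (intro mult_nonneg_nonneg) (auto simp: abs_square_le_1)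
        then have "(norm (z - a))\<^sup>2 \<le> (norm (1 - cnj a * z))\<^sup>2"
          using norm_blaschke_diff[of a z] by linarith
        then have "norm (z - a) \<le> norm (1 - cnj a * z)"
          by (simp add: abs_le_square_iff[symmetric])
        then show ?thesis
          using h(4)[of z] z R by (simp add: F_def norm_mult norm_power mult_right_mono power_mono)
      qed
      ultimately show ?thesis
        using powr_mono2[of s "norm (f z)" "norm (F z)"] s by simp
    qed
  qed
  show ?thesis
  proof (cases "f constant_on ball 0 R")
    case True then show ?thesis using const f by blast
  next
    case False
    have "finite {w \<in> cball 0 1. f w = 0}"
      using R False by (intro holomorphic_compact_finite_zeros[OF f]) auto
    then have "finite {w\<in>ball 0 1. f w = 0}" by (rule rev_finite_subset) auto
    then show ?thesis using main f by blast
  qed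
qed

lemma holomorphic_dilate:
  fixes \<rho> :: real
  assumes "f holomorphic_on ball 0 1" "0 < \<rho>"
  shows "(\<lambda>w. f (of_real \<rho> * w)) holomorphic_on ball 0 (1 / \<rho>)"
  by (rule holomorphic_on_compose_gen[OF _ assms(1), of "\<lambda>w. \<rho> * w", unfolded o_def])
     (use assms in \<open>auto intro!: holomorphic_intros simp: norm_mult field_simps\<close>)

lemma powr_sub_mean_dilate:
  fixes \<rho> :: real and z :: complex
  assumes f: "f holomorphic_on ball 0 1" and \<rho>: "0 < \<rho>" "\<rho> < 1" and s: "0 < s" and z: "norm z < 1"
  shows "norm (f (\<rho> * z)) powr s \<le> (LINT \<phi>|circ. poisson z \<phi> * norm (f (\<rho> * cis \<phi>)) powr s)"
  using powr_sub_mean[OF holomorphic_dilate[OF f \<rho>(1)] _ s z] \<rho> by simp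

text \<open>
  The integral mean before the p-th root is taken. Sums, limits and exchanges of integrals are handled at
  this level, where no distinction between p < 1 and p \<ge> 1 is needed.
\<close>

definition pmean :: "real \<Rightarrow> (complex \<Rightarrow> complex) \<Rightarrow> real \<Rightarrow> real" where
  "pmean p f r = (LINT \<phi>|circ. norm (f (of_real r * cis \<phi>)) powr p)"

lemma continuous_on_circle_powr:
  assumes f: "f holomorphic_on ball 0 1" and r: "0 \<le> r" "r < 1" and p: "0 < p"
  shows "continuous_on UNIV (\<lambda>\<phi>. norm (f (of_real r * cis \<phi>)) powr p)"
  using r p
  by (intro continuous_on_powr' continuous_on_norm continuous_on_const
       continuous_on_compose2[OF holomorphic_on_imp_continuous_on[OF f]] continuous_intros)
     (auto simp: norm_mult)

lemma circle_powr_bounded: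
  assumes f: "f holomorphic_on ball 0 1" and r: "0 \<le> r" "r < 1" and p: "0 < p"
  obtains B where "\<And>\<phi>. norm (f (of_real r * cis \<phi>)) powr p \<le> B"
proof -
  have "compact (f ` cball 0 r)"
    using f r by (intro compact_continuous_image holomorphic_on_imp_continuous_on) (auto intro: holomorphic_on_subset)
  then obtain B where "\<forall>y\<in>f ` cball 0 r. norm y \<le> B" using compact_imp_bounded bounded_iff by metis
  then have "norm (f (of_real r * cis \<phi>)) \<le> B" for \<phi> using r by (auto simp: norm_mult)
  then have "norm (f (of_real r * cis \<phi>)) powr p \<le> B powr p" for \<phi> using p by (intro powr_mono2) auto
  then show ?thesis using that by blast
qed

lemma circle_powr_measurable:
  assumes "f holomorphic_on ball 0 1" "0 \<le> r" "r < 1" "0 < p"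
  shows "(\<lambda>\<phi>. norm (f (of_real r * cis \<phi>)) powr p) \<in> borel_measurable borel"
  using continuous_on_circle_powr[OF assms] by (rule borel_measurable_continuous_onI)

lemma circle_powr_integrable:
  assumes "f holomorphic_on ball 0 1" "0 \<le> r" "r < 1" "0 < p"
  shows "integrable circ (\<lambda>\<phi>. norm (f (of_real r * cis \<phi>)) powr p)"
proof -
  obtain B where B: "\<And>\<phi>. norm (f (of_real r * cis \<phi>)) powr p \<le> B"
    using circle_powr_bounded[OF assms] by blast
  show ?thesis
    by (rule integrable_circ_bounded[where B=B]) (use B circle_powr_measurable[OF assms] in auto)
qed

lemma pmean_nonneg: "0 \<le> pmean p f r"
  unfolding pmean_def by (rule integral_nonneg_AE) simp

text \<open>
  Averaging the sub-mean value property over the circle of radius r leaves the larger mean, because the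
  kernel is symmetric in the two angles and has mass one.
\<close>

lemma pmean_mono:
  assumes f: "f holomorphic_on ball 0 1" and r: "0 \<le> r" "r \<le> \<rho>" "\<rho> < 1" and p: "0 < p"
  shows "pmean p f r \<le> pmean p f \<rho>"
proof (cases "r = \<rho>")
  case False
  define u where "u \<phi> = norm (f (of_real \<rho> * cis \<phi>)) powr p" for \<phi>
  have \<rho>0: "0 < \<rho>" "0 \<le> \<rho>" using False r by auto
  define t where "t = r / \<rho>"
  have t: "0 \<le> t" "t < 1" using False r by (auto simp: t_def)
  have nt: "norm (of_real t * cis \<theta>) < 1" for \<theta> using t by (simp add: norm_mult)
  note fr = f \<rho>0(2) r(3) p
  have [measurable]: "u \<in> borel_measurable borel"
    unfolding u_def by (rule circle_powr_measurable[OF fr])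
  obtain B where B: "\<And>\<phi>. u \<phi> \<le> B"
    using circle_powr_bounded[OF fr] unfolding u_def by blast
  have u0: "0 \<le> u \<phi>" for \<phi> by (simp add: u_def)
  have bd: "\<bar>poisson (of_real t * cis \<theta>) \<phi> * u \<phi>\<bar> \<le> 2 / (1 - t) * B" for \<theta> \<phi>
    using poisson_le[OF nt, of \<theta> \<phi>] poisson_nonneg[OF nt, of \<theta> \<phi>] B[of \<phi>] u0[of \<phi>] t
    by (simp only: abs_mult) (intro mult_mono, auto simp: norm_mult)
  have m: "(\<lambda>(\<theta>, \<phi>). poisson (of_real t * cis \<theta>) \<phi> * u \<phi>) \<in> borel_measurable (borel \<Otimes>\<^sub>M borel)"
    by measurable
  have le: "norm (f (of_real r * cis \<theta>)) powr p \<le> (LINT \<phi>|circ. poisson (of_real t * cis \<theta>) \<phi> * u \<phi>)" for \<theta>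
    using powr_sub_mean_dilate[OF f \<rho>0(1) r(3) p nt[of \<theta>]] \<rho>0 
    by (simp add: u_def t_def mult.assoc[symmetric])
  have "pmean p f r \<le> (LINT \<theta>|circ. LINT \<phi>|circ. poisson (of_real t * cis \<theta>) \<phi> * u \<phi>)"
    unfolding pmean_def
  proof (rule integral_circ_mono[OF circle_powr_integrable[OF f r(1) _ p] _ le])
    show "integrable circ (\<lambda>\<theta>. LINT \<phi>|circ. poisson (of_real t * cis \<theta>) \<phi> * u \<phi>)"
    proof (rule integrable_circ_bounded)
      show "(\<lambda>\<theta>. LINT \<phi>|circ. poisson (of_real t * cis \<theta>) \<phi> * u \<phi>) \<in> borel_measurable borel"
        by measurable
      show "norm (LINT \<phi>|circ. poisson (of_real t * cis \<theta>) \<phi> * u \<phi>) \<le> 2 / (1 - t) * B" for \<theta>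
        unfolding real_norm_def by (rule circ_integral_bound) (use bd in auto)
    qed
  qed (use r in auto)
  also have "\<dots> = (LINT \<phi>|circ. LINT \<theta>|circ. poisson (of_real t * cis \<theta>) \<phi> * u \<phi>)"
    by (rule circ_fubini[OF m bd, symmetric])
  also have "\<dots> = (LINT \<phi>|circ. LINT \<theta>|circ. poisson (of_real t * cis \<phi>) \<theta> * u \<phi>)"
    by (simp add: poisson_sym)
  also have "\<dots> = pmean p f \<rho>"
    using integral_poisson[OF nt] by (simp add: pmean_def u_def)
  finally show ?thesis .
qed simp

lemma norm_powr_le_pmean:
  fixes \<rho> :: real and z :: complex
  assumes f: "f holomorphic_on ball 0 1" and \<rho>: "0 < \<rho>" "\<rho> < 1" and p: "0 < p" and z: "norm z < 1"
  shows "norm (f (\<rho> * z)) powr p \<le> 2 / (1 - norm z) * pmean p f \<rho>"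
proof -
  have \<rho>0: "0 \<le> \<rho>" using \<rho> by simp
  note fr = f \<rho>0 \<rho>(2) p
  obtain B where B: "\<And>\<phi>. norm (f (of_real \<rho> * cis \<phi>)) powr p \<le> B"
    using circle_powr_bounded[OF fr] by blast
  have "norm (f (\<rho> * z)) powr p \<le> (LINT \<phi>|circ. poisson z \<phi> * norm (f (\<rho> * cis \<phi>)) powr p)"
    by (rule powr_sub_mean_dilate[OF f \<rho> p z])
  also have "\<dots> \<le> (LINT \<phi>|circ. 2 / (1 - norm z) * norm (f (\<rho> * cis \<phi>)) powr p)"
    by (intro integral_circ_mono integrable_poisson_times[OF z circle_powr_measurable[OF fr], where B=B]
          integrable_mult_right circle_powr_integrable[OF fr] mult_right_mono poisson_le[OF z])
       (use B in auto)
  also have "\<dots> = 2 / (1 - norm z) * pmean p f \<rho>"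
    by (simp add: pmean_def)
  finally show ?thesis .
qed


section \<open>The radial maximal theorem\<close>

text \<open>
  Let s be any measurable choice of radii and let T take u to its Poisson integral at the points
  s(\<theta>) cis \<theta>. By the semigroup law T T^* has the kernel of radius s(\<theta>) s(\<psi>), which is at
  most 8 times the sum of the kernels of T and of T^*. For v \<ge> 0 this gives
  |T^* v|^2 = (T T^* v, v) \<le> 16 (T^* v, v) \<le> 16 |T^* v| |v| in L^2, so the norm of T has a bound that does
  not depend on s. In the proof W stands for T u and V for T^* W.
\<close>

lemma poisson_selection_L2:
  fixes s u :: "real \<Rightarrow> real"
  assumes s [measurable]: "s \<in> borel_measurable borel" and s0: "\<And>\<theta>. 0 \<le> s \<theta>" and sc: "\<And>\<theta>. s \<theta> \<le> c" and c: "c < 1"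
    and u [measurable]: "u \<in> borel_measurable borel" and u0: "\<And>\<theta>. 0 \<le> u \<theta>" and uB: "\<And>\<theta>. u \<theta> \<le> B"
  shows "(LINT \<theta>|circ. (LINT \<phi>|circ. poisson (of_real (s \<theta>) * cis \<theta>) \<phi> * u \<phi>)\<^sup>2) \<le> 256 * (LINT \<phi>|circ. (u \<phi>)\<^sup>2)"
proof -
  define k where "k \<theta> \<phi> = poisson (of_real (s \<theta>) * cis \<theta>) \<phi>" for \<theta> \<phi>
  define W where "W \<theta> = (LINT \<phi>|circ. k \<theta> \<phi> * u \<phi>)" for \<theta>
  define V where "V \<phi> = (LINT \<theta>|circ. k \<theta> \<phi> * W \<theta>)" for \<phi>
  define K where "K = 2 / (1 - c)"
  have s1: "s \<theta> < 1" for \<theta> using sc[of \<theta>] c by linarith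
  have ns: "norm (of_real (s \<theta>) * cis \<theta>) < 1" for \<theta> using s0[of \<theta>] s1[of \<theta>] by (simp add: norm_mult)
  have K0: "0 \<le> K" using c by (simp add: K_def)
  have B0: "0 \<le> B" using u0[of 0] uB[of 0] by linarith
  have k0: "0 \<le> k \<theta> \<phi>" for \<theta> \<phi> unfolding k_def by (rule poisson_nonneg[OF ns])
  have kK: "k \<theta> \<phi> \<le> K" for \<theta> \<phi>
  proof -
    have "k \<theta> \<phi> \<le> 2 / (1 - s \<theta>)" using poisson_le[OF ns[of \<theta>], of \<phi>] s0[of \<theta>] by (simp add: k_def norm_mult)
    also have "\<dots> \<le> K" unfolding K_def using sc[of \<theta>] c by (intro divide_left_mono) auto
    finally show ?thesis .
  qed
  have km [measurable]: "(\<lambda>x. k (f x) (g x)) \<in> borel_measurable M"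
    if [measurable]: "f \<in> borel_measurable M" "g \<in> borel_measurable M" for f g and M :: "'x measure"
    unfolding k_def by measurable
  have prod: "\<bar>a * b\<bar> \<le> A * C" if "\<bar>a\<bar> \<le> A" "\<bar>b\<bar> \<le> C" for a b A C :: real
    unfolding abs_mult using that by (intro mult_mono) auto
  have ka: "\<bar>k \<theta> \<phi>\<bar> \<le> K" for \<theta> \<phi> using k0 kK by simp
  have ua: "\<bar>u \<phi>\<bar> \<le> B" for \<phi> using u0 uB by simp
  have W0: "0 \<le> W \<theta>" for \<theta> unfolding W_def by (intro integral_nonneg_AE) (simp add: k0 u0)
  have Wm [measurable]: "W \<in> borel_measurable borel" unfolding W_def by measurable
  have Wb: "\<bar>W \<theta>\<bar> \<le> K * B" for \<theta>
    unfolding W_def by (rule circ_integral_bound) (auto intro!: prod ka ua)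
  have Vm [measurable]: "V \<in> borel_measurable borel" unfolding V_def by measurable
  have V0: "0 \<le> V \<theta>" for \<theta> unfolding V_def by (intro integral_nonneg_AE) (simp add: k0 W0)
  have Vb: "\<bar>V \<theta>\<bar> \<le> K * (K * B)" for \<theta>
    unfolding V_def by (rule circ_integral_bound) (auto intro!: prod ka Wb)
  \<comment> \<open>moving the kernel from one factor to the other\<close>
  have adj: "(LINT \<theta>|circ. f \<theta> * (LINT \<phi>|circ. k \<theta> \<phi> * g \<phi>)) = (LINT \<phi>|circ. (LINT \<theta>|circ. k \<theta> \<phi> * f \<theta>) * g \<phi>)"
    if [measurable]: "f \<in> borel_measurable borel" "g \<in> borel_measurable borel"
      and b: "\<And>x. \<bar>f x\<bar> \<le> F" "\<And>x. \<bar>g x\<bar> \<le> G" for f g and F G :: real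
  proof -
    have "(LINT \<theta>|circ. f \<theta> * (LINT \<phi>|circ. k \<theta> \<phi> * g \<phi>)) = (LINT \<theta>|circ. LINT \<phi>|circ. f \<theta> * (k \<theta> \<phi> * g \<phi>))"
      by simp
    also have "\<dots> = (LINT \<phi>|circ. LINT \<theta>|circ. f \<theta> * (k \<theta> \<phi> * g \<phi>))"
    proof (rule circ_fubini[symmetric])
      show "\<bar>f \<theta> * (k \<theta> \<phi> * g \<phi>)\<bar> \<le> F * (K * G)" for \<theta> \<phi> by (intro prod b ka)
    qed measurable
    also have "\<dots> = (LINT \<phi>|circ. LINT \<theta>|circ. (k \<theta> \<phi> * f \<theta>) * g \<phi>)"
      by (simp add: mult_ac)
    finally show ?thesis by simp
  qed
  have int: "integrable circ (\<lambda>\<theta>. f \<theta> * g \<theta>)"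
    if [measurable]: "f \<in> borel_measurable borel" "g \<in> borel_measurable borel"
      and b: "\<And>x. \<bar>f x\<bar> \<le> F" "\<And>x. \<bar>g x\<bar> \<le> G" for f g and F G :: real
    by (rule integrable_circ_bounded[where B="F * G"]) (auto intro!: prod b)
  have WW: "(LINT \<theta>|circ. W \<theta> * W \<theta>) = (LINT \<theta>|circ. V \<theta> * u \<theta>)"
    using adj[OF Wm u Wb ua] unfolding V_def W_def[symmetric] by simp
  define P where "P \<theta> \<psi> = poisson (of_real (s \<theta> * s \<psi>) * cis \<theta>) \<psi>" for \<theta> \<psi>
  have kk: "(LINT \<phi>|circ. k \<theta> \<phi> * k \<psi> \<phi>) = P \<theta> \<psi>" for \<theta> \<psi>
    unfolding k_def P_def by (rule poisson_semigroup) (use s0 s1 in auto)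
  have Ple: "P \<theta> \<psi> \<le> 8 * (k \<theta> \<psi> + k \<psi> \<theta>)" for \<theta> \<psi>
    using poisson_product_le[OF s0 s1 s0 s1, of \<theta> \<psi> \<theta> \<psi>] poisson_sym[of "s \<psi>" \<theta> \<psi>]
    by (simp add: P_def k_def)
  have P0: "0 \<le> P \<theta> \<psi>" for \<theta> \<psi>
    unfolding kk[symmetric] by (intro integral_nonneg_AE) (simp add: k0)
  have TV: "(LINT \<phi>|circ. k \<theta> \<phi> * V \<phi>) = (LINT \<psi>|circ. P \<theta> \<psi> * W \<psi>)" for \<theta>
  proof -
    have "(LINT \<phi>|circ. k \<theta> \<phi> * V \<phi>) = (LINT \<phi>|circ. LINT \<psi>|circ. k \<theta> \<phi> * (k \<psi> \<phi> * W \<psi>))"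
      unfolding V_def by simp
    also have "\<dots> = (LINT \<psi>|circ. LINT \<phi>|circ. k \<theta> \<phi> * (k \<psi> \<phi> * W \<psi>))"
    proof (rule circ_fubini)
      show "\<bar>k \<theta> \<phi> * (k \<psi> \<phi> * W \<psi>)\<bar> \<le> K * (K * (K * B))" for \<psi> \<phi> by (intro prod ka Wb)
    qed measurable
    also have "\<dots> = (LINT \<psi>|circ. (LINT \<phi>|circ. k \<theta> \<phi> * k \<psi> \<phi>) * W \<psi>)"
      by (simp add: mult.assoc[symmetric])
    finally show ?thesis by (simp add: kk)
  qed
  have VV: "(LINT \<theta>|circ. V \<theta> * V \<theta>) = (LINT \<theta>|circ. W \<theta> * (LINT \<phi>|circ. k \<theta> \<phi> * V \<phi>))"
    using adj[OF Wm Vm Wb Vb] unfolding V_def[symmetric] by simp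
  have le1: "W \<theta> * (LINT \<phi>|circ. k \<theta> \<phi> * V \<phi>) \<le> 8 * (W \<theta> * (LINT \<psi>|circ. k \<theta> \<psi> * W \<psi>)) + 8 * (W \<theta> * V \<theta>)" for \<theta>
  proof -
    have Pb: "\<bar>P \<theta> \<psi>\<bar> \<le> K * K" for \<psi>
      unfolding kk[symmetric] by (rule circ_integral_bound) (auto intro!: prod ka)
    have Pm: "P \<theta> \<in> borel_measurable borel" unfolding P_def by measurable
    have i1: "integrable circ (\<lambda>\<psi>. k \<theta> \<psi> * W \<psi>)" by (rule int[OF _ Wm ka Wb]) measurable
    have i2: "integrable circ (\<lambda>\<psi>. k \<psi> \<theta> * W \<psi>)" by (rule int[OF _ Wm ka Wb]) measurable
    have "(LINT \<phi>|circ. k \<theta> \<phi> * V \<phi>) \<le> (LINT \<psi>|circ. 8 * (k \<theta> \<psi> * W \<psi>) + 8 * (k \<psi> \<theta> * W \<psi>))"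
      unfolding TV
    proof (rule integral_circ_mono)
      show "P \<theta> \<psi> * W \<psi> \<le> 8 * (k \<theta> \<psi> * W \<psi>) + 8 * (k \<psi> \<theta> * W \<psi>)" for \<psi>
        using mult_right_mono[OF Ple[of \<theta> \<psi>] W0[of \<psi>]] by (simp add: algebra_simps)
      show "integrable circ (\<lambda>\<psi>. P \<theta> \<psi> * W \<psi>)" by (rule int[OF Pm Wm Pb Wb])
    qed (use i1 i2 in auto)
    also have "\<dots> = 8 * (LINT \<psi>|circ. k \<theta> \<psi> * W \<psi>) + 8 * V \<theta>"
      using i1 i2 by (simp add: V_def)
    finally show ?thesis using mult_left_mono[OF _ W0[of \<theta>]] by (fastforce simp: algebra_simps)
  qed
  have TWb: "\<bar>LINT \<psi>|circ. k \<theta> \<psi> * W \<psi>\<bar> \<le> K * (K * B)" for \<theta>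
    by (rule circ_integral_bound) (auto intro!: prod ka Wb)
  have TVb: "\<bar>LINT \<psi>|circ. k \<theta> \<psi> * V \<psi>\<bar> \<le> K * (K * (K * B))" for \<theta>
    by (rule circ_integral_bound) (auto intro!: prod ka Vb)
  have TWm: "(\<lambda>\<theta>. LINT \<psi>|circ. k \<theta> \<psi> * W \<psi>) \<in> borel_measurable borel"
    and TVm: "(\<lambda>\<theta>. LINT \<psi>|circ. k \<theta> \<psi> * V \<psi>) \<in> borel_measurable borel" by measurable
  note i3 = int[OF Wm TWm Wb TWb] and i4 = int[OF Wm Vm Wb Vb] and i5 = int[OF Wm TVm Wb TVb]
  have "(LINT \<theta>|circ. V \<theta> * V \<theta>) \<le> (LINT \<theta>|circ. 8 * (W \<theta> * (LINT \<psi>|circ. k \<theta> \<psi> * W \<psi>)) + 8 * (W \<theta> * V \<theta>))"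
    unfolding VV by (intro integral_circ_mono i5 le1) (use i3 i4 in auto)
  also have "\<dots> = 8 * (LINT \<theta>|circ. W \<theta> * (LINT \<psi>|circ. k \<theta> \<psi> * W \<psi>)) + 8 * (LINT \<theta>|circ. W \<theta> * V \<theta>)"
    using i3 i4 by simp
  also have "(LINT \<theta>|circ. W \<theta> * (LINT \<psi>|circ. k \<theta> \<psi> * W \<psi>)) = (LINT \<theta>|circ. W \<theta> * V \<theta>)"
    using adj[OF Wm Wm Wb Wb] unfolding V_def[symmetric] by (simp add: mult.commute)
  finally have VVle: "(LINT \<theta>|circ. V \<theta> * V \<theta>) \<le> 16 * (LINT \<theta>|circ. W \<theta> * V \<theta>)" by simp
  \<comment> \<open>two applications of the inequality between the means, with absorption\<close>
  note iW = int[OF Wm Wm Wb Wb] and iV = int[OF Vm Vm Vb Vb] and iu = int[OF u u ua ua] and iVu = int[OF Vm u Vb ua]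
  have "(LINT \<theta>|circ. W \<theta> * V \<theta>) \<le> (LINT \<theta>|circ. 8 * (W \<theta> * W \<theta>) + (1/32) * (V \<theta> * V \<theta>))"
  proof (rule integral_circ_mono)
    show "W \<theta> * V \<theta> \<le> 8 * (W \<theta> * W \<theta>) + (1/32) * (V \<theta> * V \<theta>)" for \<theta>
      using zero_le_square[of "16 * W \<theta> - V \<theta>"] by (simp add: algebra_simps)
  qed (use i4 iW iV in auto)
  also have "\<dots> = 8 * (LINT \<theta>|circ. W \<theta> * W \<theta>) + (1/32) * (LINT \<theta>|circ. V \<theta> * V \<theta>)"
    using iW iV by simp
  finally have 1: "(LINT \<theta>|circ. V \<theta> * V \<theta>) \<le> 256 * (LINT \<theta>|circ. W \<theta> * W \<theta>)"
    using VVle by simp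
  have "(LINT \<theta>|circ. V \<theta> * u \<theta>) \<le> (LINT \<theta>|circ. (1/512) * (V \<theta> * V \<theta>) + 128 * (u \<theta> * u \<theta>))"
  proof (rule integral_circ_mono)
    show "V \<theta> * u \<theta> \<le> (1/512) * (V \<theta> * V \<theta>) + 128 * (u \<theta> * u \<theta>)" for \<theta>
      using zero_le_square[of "256 * u \<theta> - V \<theta>"] by (simp add: algebra_simps)
  qed (use iVu iu iV in auto)
  also have "\<dots> = (1/512) * (LINT \<theta>|circ. V \<theta> * V \<theta>) + 128 * (LINT \<theta>|circ. u \<theta> * u \<theta>)"
    using iu iV by simp
  finally have "(LINT \<theta>|circ. W \<theta> * W \<theta>) \<le> 256 * (LINT \<theta>|circ. u \<theta> * u \<theta>)"
    using 1 WW by simp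
  then show ?thesis by (simp add: W_def k_def power2_eq_square)
qed

text \<open>
  A measurable choice of the maximising radius turns a maximal function into an operator to which the
  preceding estimate applies.
\<close>

lemma finite_argmax_measurable:
  fixes U :: "real \<Rightarrow> real \<Rightarrow> real"
  assumes "finite R" "R \<noteq> {}" and [measurable]: "case_prod U \<in> borel_measurable (borel \<Otimes>\<^sub>M borel)"
  shows "\<exists>s\<in>borel_measurable borel. \<forall>\<theta>. s \<theta> \<in> R \<and> (\<forall>r\<in>R. U r \<theta> \<le> U (s \<theta>) \<theta>)"
  using assms(1,2)
proof (induction R rule: finite_ne_induct)
  case (singleton r)
  then show ?case by (intro bexI[of _ "\<lambda>_. r"]) auto
next
  case (insert r R)
  then obtain s where s [measurable]: "s \<in> borel_measurable borel"
    and s': "\<And>\<theta>. s \<theta> \<in> R" "\<And>\<theta> r. r \<in> R \<Longrightarrow> U r \<theta> \<le> U (s \<theta>) \<theta>" by blast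
  define s1 where "s1 \<theta> = (if U (s \<theta>) \<theta> < U r \<theta> then r else s \<theta>)" for \<theta>
  have "s1 \<in> borel_measurable borel" unfolding s1_def by measurable
  moreover have "s1 \<theta> \<in> insert r R" for \<theta> using s'(1) by (simp add: s1_def)
  moreover have "U t \<theta> \<le> U (s1 \<theta>) \<theta>" if "t \<in> insert r R" for t \<theta>
    using that s'(2)[of t \<theta>] by (auto simp: s1_def)
  ultimately show ?case by blast
qed

text \<open>
  The power |f|^(p/2) is at most the Poisson integral of its values on a slightly larger circle, and these
  have a square integral of at most B. This is how the estimate in L^2 covers every exponent p.
\<close>

lemma radial_maximal_finite:
  assumes f: "f holomorphic_on ball 0 1" and p: "0 < p" and R: "finite R" "R \<noteq> {}" "R \<subseteq> {0..<1}"
    and B: "\<And>r. 0 \<le> r \<Longrightarrow> r < 1 \<Longrightarrow> pmean p f r \<le> B"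
  shows "(\<integral>\<^sup>+\<theta>. (SUP r\<in>R. ennreal (norm (f (of_real r * cis \<theta>)) powr p)) \<partial>circ) \<le> ennreal (256 * B)"
proof -
  define \<rho> where "\<rho> = (1 + Max R) / 2"
  have MR: "Max R \<in> R" using R by (intro Max_in)
  then have "0 \<le> Max R" "Max R < 1" using R(3) by auto
  then have \<rho>: "0 < \<rho>" "\<rho> < 1" "Max R < \<rho>" by (simp_all add: \<rho>_def)
  have Rle: "r \<le> Max R" if "r \<in> R" for r using that R by simp
  have \<rho>0: "0 \<le> \<rho>" using \<rho> by simp
  define u where "u \<phi> = norm (f (of_real \<rho> * cis \<phi>)) powr (p / 2)" for \<phi>
  have p2: "0 < p / 2" using p by simp
  note fr = f \<rho>0 \<rho>(2) p2
  have um [measurable]: "u \<in> borel_measurable borel" unfolding u_def by (rule circle_powr_measurable[OF fr])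
  obtain C where C: "\<And>\<phi>. u \<phi> \<le> C" using circle_powr_bounded[OF fr] unfolding u_def by blast
  have u0: "0 \<le> u \<phi>" for \<phi> by (simp add: u_def)
  define U where "U r \<theta> = (LINT \<phi>|circ. poisson (of_real (r / \<rho>) * cis \<theta>) \<phi> * u \<phi>)" for r \<theta>
  have "case_prod U \<in> borel_measurable (borel \<Otimes>\<^sub>M borel)" unfolding U_def by measurable
  from finite_argmax_measurable[OF R(1,2) this] obtain s where s [measurable]: "s \<in> borel_measurable borel"
    and s': "\<And>\<theta>. s \<theta> \<in> R" "\<And>\<theta> r. r \<in> R \<Longrightarrow> U r \<theta> \<le> U (s \<theta>) \<theta>" by blast
  have s01: "0 \<le> s \<theta> / \<rho>" "s \<theta> / \<rho> \<le> Max R / \<rho>" for \<theta>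
    using s'(1)[of \<theta>] Rle[of "s \<theta>"] R \<rho> by (auto intro: divide_right_mono)
  have c1: "Max R / \<rho> < 1" using \<rho> by simp
  have fU: "norm (f (of_real r * cis \<theta>)) powr p \<le> (U (s \<theta>) \<theta>)\<^sup>2" if "r \<in> R" for r \<theta>
  proof -
    have r: "0 \<le> r" "r < \<rho>" using that R Rle[of r] \<rho> by auto
    have n: "norm (of_real (r / \<rho>) * cis \<theta>) < 1" using r \<rho> by (simp add: norm_mult norm_divide)
    have "norm (f (\<rho> * (of_real (r / \<rho>) * cis \<theta>))) powr (p / 2) \<le> U r \<theta>"
      using powr_sub_mean_dilate[OF f \<rho>(1,2) p2 n] unfolding U_def u_def .
    also have "\<rho> * (of_real (r / \<rho>) * cis \<theta>) = of_real r * cis \<theta>" using \<rho> by simp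
    finally have "norm (f (of_real r * cis \<theta>)) powr (p / 2) \<le> U (s \<theta>) \<theta>" using s'(2)[OF that, of \<theta>] by simp
    then have "(norm (f (of_real r * cis \<theta>)) powr (p / 2))\<^sup>2 \<le> (U (s \<theta>) \<theta>)\<^sup>2" by (intro power_mono) auto
    moreover have "(norm (f (of_real r * cis \<theta>)) powr (p / 2))\<^sup>2 = norm (f (of_real r * cis \<theta>)) powr p"
      by (simp add: power2_eq_square powr_add[symmetric])
    ultimately show ?thesis by simp
  qed
  have Um: "(\<lambda>\<theta>. (U (s \<theta>) \<theta>)\<^sup>2) \<in> borel_measurable borel" unfolding U_def by measurable
  have Ub: "\<bar>U (s \<theta>) \<theta>\<bar> \<le> 2 / (1 - Max R / \<rho>) * C" for \<theta>
    unfolding U_def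
  proof (rule circ_integral_bound)
    fix \<phi>
    have n: "norm (of_real (s \<theta> / \<rho>) * cis \<theta>) = s \<theta> / \<rho>" using s01(1)[of \<theta>] by (simp only: norm_mult norm_of_real norm_cis abs_of_nonneg mult_1_right)
    have n1: "norm (of_real (s \<theta> / \<rho>) * cis \<theta>) < 1" unfolding n using s01[of \<theta>] c1 by linarith
    have "poisson (of_real (s \<theta> / \<rho>) * cis \<theta>) \<phi> \<le> 2 / (1 - s \<theta> / \<rho>)"
      using poisson_le[OF n1] unfolding n .
    also have "\<dots> \<le> 2 / (1 - Max R / \<rho>)" using s01(2)[of \<theta>] c1 by (intro divide_left_mono mult_pos_pos) auto
    finally show "\<bar>poisson (of_real (s \<theta> / \<rho>) * cis \<theta>) \<phi> * u \<phi>\<bar> \<le> 2 / (1 - Max R / \<rho>) * C"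
      unfolding abs_mult using poisson_nonneg[OF n1, of \<phi>] C[of \<phi>] u0[of \<phi>] c1 by (intro mult_mono) auto
  qed measurable
  have Ui: "integrable circ (\<lambda>\<theta>. (U (s \<theta>) \<theta>)\<^sup>2)"
    by (rule integrable_circ_bounded[where B="(2 / (1 - Max R / \<rho>) * C)\<^sup>2", OF Um])
       (metis Ub abs_ge_zero norm_power power_mono real_norm_def)
  have "(\<integral>\<^sup>+\<theta>. (SUP r\<in>R. ennreal (norm (f (of_real r * cis \<theta>)) powr p)) \<partial>circ) \<le> (\<integral>\<^sup>+\<theta>. ennreal ((U (s \<theta>) \<theta>)\<^sup>2) \<partial>circ)"
    by (intro nn_integral_mono SUP_least ennreal_leI fU)
  also have "\<dots> = ennreal (LINT \<theta>|circ. (U (s \<theta>) \<theta>)\<^sup>2)"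
    by (rule nn_integral_eq_integral[OF Ui]) simp
  also have "(LINT \<theta>|circ. (U (s \<theta>) \<theta>)\<^sup>2) \<le> 256 * (LINT \<phi>|circ. (u \<phi>)\<^sup>2)"
    unfolding U_def
    by (rule poisson_selection_L2[where s="\<lambda>\<theta>. s \<theta> / \<rho>", OF _ s01 c1 um u0 C]) measurable
  also have "(LINT \<phi>|circ. (u \<phi>)\<^sup>2) = pmean p f \<rho>"
    unfolding pmean_def u_def by (intro Bochner_Integration.integral_cong) (auto simp: power2_eq_square powr_add[symmetric])
  also have "256 * pmean p f \<rho> \<le> 256 * B" using B[of \<rho>] \<rho> by simp
  finally show ?thesis by (simp add: ennreal_leI)
qed

lemma ennreal_dominant:
  assumes [measurable]: "M0 \<in> borel_measurable circ" and B: "(\<integral>\<^sup>+\<theta>. M0 \<theta> \<partial>circ) \<le> ennreal B" "0 \<le> B"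
  shows "integrable circ (\<lambda>\<theta>. enn2real (M0 \<theta>))" "(LINT \<theta>|circ. enn2real (M0 \<theta>)) \<le> B"
    "AE \<theta> in circ. ennreal (enn2real (M0 \<theta>)) = M0 \<theta>"
proof -
  have "AE \<theta> in circ. M0 \<theta> \<noteq> \<infinity>"
    using B by (intro nn_integral_PInf_AE) (auto simp: top_unique)
  then show eq: "AE \<theta> in circ. ennreal (enn2real (M0 \<theta>)) = M0 \<theta>"
    by eventually_elim (simp add: less_top)
  have nM: "(\<integral>\<^sup>+\<theta>. ennreal (enn2real (M0 \<theta>)) \<partial>circ) \<le> ennreal B"
    using B nn_integral_cong_AE[OF eq] by simp
  have "(\<lambda>\<theta>. enn2real (M0 \<theta>)) \<in> borel_measurable circ" by measurable
  then show i: "integrable circ (\<lambda>\<theta>. enn2real (M0 \<theta>))"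
    by (rule integrableI_nonneg) (use nM in \<open>auto simp: order_le_less_trans\<close>)
  have "ennreal (LINT \<theta>|circ. enn2real (M0 \<theta>)) \<le> ennreal B"
    using nM by (subst nn_integral_eq_integral[symmetric, OF i]) auto
  then show "(LINT \<theta>|circ. enn2real (M0 \<theta>)) \<le> B" using B(2) by (simp add: ennreal_le_iff)
qed

text \<open>
  By continuity the rational radii suffice, and they are exhausted by finite sets.
\<close>

lemma radial_maximal:
  assumes f: "f holomorphic_on ball 0 1" and p: "0 < p"
    and B: "\<And>r. 0 \<le> r \<Longrightarrow> r < 1 \<Longrightarrow> pmean p f r \<le> B"
  obtains M where "integrable circ M" "\<And>\<theta>. 0 \<le> M \<theta>" "(LINT \<theta>|circ. M \<theta>) \<le> 256 * B"
    "AE \<theta> in circ. \<forall>t\<in>{0..<1}. norm (f (of_real t * cis \<theta>)) powr p \<le> M \<theta>"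
proof -
  define F where "F r \<theta> = norm (f (of_real r * cis \<theta>)) powr p" for r \<theta>
  define Q where "Q = \<rat> \<inter> {0..<1::real}"
  have Q: "countable Q" "0 \<in> Q" by (auto simp: Q_def countable_rat)
  then obtain e :: "nat \<Rightarrow> real" where e: "range e = Q" by (metis empty_iff range_from_nat_into)
  have eQ: "e n \<in> {0..<1}" for n using e by (auto simp: Q_def)
  define N where "N \<theta> = (SUP n. ennreal (F (e n) \<theta>))" for \<theta>
  have Fm [measurable]: "F (e n) \<in> borel_measurable borel" for n
    unfolding F_def using eQ[of n] by (intro circle_powr_measurable f p) auto
  have Nm [measurable]: "N \<in> borel_measurable borel" unfolding N_def by measurable
  have N_eq: "N \<theta> = (SUP n. SUP r\<in>e ` {..n}. ennreal (F r \<theta>))" for \<theta>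
    unfolding N_def by (intro antisym SUP_least) (auto intro: SUP_upper2)
  have "(\<integral>\<^sup>+\<theta>. N \<theta> \<partial>circ) = (SUP n. \<integral>\<^sup>+\<theta>. (SUP r\<in>e ` {..n}. ennreal (F r \<theta>)) \<partial>circ)"
    unfolding N_eq
  proof (rule nn_integral_monotone_convergence_SUP)
    show "incseq (\<lambda>n \<theta>. SUP r\<in>e ` {..n}. ennreal (F r \<theta>))"
      by (auto simp: incseq_def le_fun_def intro!: SUP_subset_mono)
    show "(\<lambda>\<theta>. SUP r\<in>e ` {..n}. ennreal (F r \<theta>)) \<in> borel_measurable circ" for n
      by (intro borel_measurable_SUP) auto
  qed
  also have "\<dots> \<le> ennreal (256 * B)"
    unfolding F_def by (intro SUP_least radial_maximal_finite f p B) (use eQ in auto)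
  finally have NB: "(\<integral>\<^sup>+\<theta>. N \<theta> \<partial>circ) \<le> ennreal (256 * B)" .
  have B0: "0 \<le> B" using B[of 0] pmean_nonneg[of p f 0] by simp
  define M where "M \<theta> = enn2real (N \<theta>)" for \<theta>
  have Nc: "N \<in> borel_measurable circ" by measurable
  have B1: "0 \<le> 256 * B" using B0 by simp
  note dominant = ennreal_dominant[OF Nc NB B1, folded M_def]
  have dom: "AE \<theta> in circ. \<forall>t\<in>{0..<1}. norm (f (of_real t * cis \<theta>)) powr p \<le> M \<theta>"
    using dominant(3)
  proof eventually_elim
    fix \<theta> assume eq: "ennreal (M \<theta>) = N \<theta>"
    have q: "F r \<theta> \<le> M \<theta>" if "r \<in> Q" for r
    proof -
      have "ennreal (F r \<theta>) \<le> N \<theta>" unfolding N_def using that unfolding e[symmetric] by (auto intro: SUP_upper)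
      then show ?thesis unfolding eq[symmetric] by (simp add: ennreal_le_iff M_def)
    qed
    show "\<forall>t\<in>{0..<1}. norm (f (of_real t * cis \<theta>)) powr p \<le> M \<theta>"
    proof
      fix t :: real assume t: "t \<in> {0..<1}"
      have cont: "continuous_on {0..<1} (\<lambda>t. F t \<theta>)"
        unfolding F_def using p
        by (intro continuous_on_powr' continuous_on_norm continuous_on_const
             continuous_on_compose2[OF holomorphic_on_imp_continuous_on[OF f]] continuous_intros)
           (auto simp: norm_mult)
      have sub: "{0..<1} \<subseteq> closure Q"
      proof
        fix x :: real assume x: "x \<in> {0..<1}"
        show "x \<in> closure Q"
          unfolding closure_approachable
        proof (intro allI impI)
          fix e :: real assume "0 < e"
          with x have "x < min 1 (x + e)" by auto
          then obtain y where y: "y \<in> \<rat>" "x < y" "y < min 1 (x + e)" using Rats_dense_in_real by blast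
          then show "\<exists>y\<in>Q. dist y x < e" using x by (intro bexI[of _ y]) (auto simp: Q_def dist_real_def)
        qed
      qed
      obtain X where X: "\<And>n. X n \<in> Q" "X \<longlonglongrightarrow> t" using sub t by (meson closure_sequential subsetD)
      have "(\<lambda>n. F (X n) \<theta>) \<longlonglongrightarrow> F t \<theta>"
        using continuous_on_tendsto_compose[OF cont X(2) t] X(1) by (auto simp: Q_def)
      then have "F t \<theta> \<le> M \<theta>" using q[OF X(1)] by (intro LIMSEQ_le_const2) auto
      then show "norm (f (of_real t * cis \<theta>)) powr p \<le> M \<theta>" by (simp add: F_def)
    qed
  qed
  show ?thesis by (rule that[OF dominant(1) _ dominant(2) dom]) (simp add: M_def)
qed


section \<open>Hardy spaces as metric spaces\<close>

lemma powr_add_le_subadditive: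
  fixes x y p :: real
  assumes "0 < p" "p \<le> 1" "0 \<le> x" "0 \<le> y"
  shows "(x + y) powr p \<le> x powr p + y powr p"
proof (cases "x + y = 0")
  case False
  define S where "S = x + y"
  have S: "0 < S" using False assms by (simp add: S_def)
  have le: "t / S * S powr p \<le> t powr p" if "0 \<le> t" "t \<le> S" for t
  proof -
    have "t / S \<le> (t / S) powr p"
      using that S assms powr_mono'[of p 1 "t / S"] by simp
    then have "t / S * S powr p \<le> (t / S) powr p * S powr p" by (intro mult_right_mono) auto
    also have "\<dots> = t powr p" using that S by (simp add: powr_divide)
    finally show ?thesis .
  qed
  have "S powr p = x / S * S powr p + y / S * S powr p"
    using S by (simp add: S_def add_divide_distrib[symmetric] distrib_right[symmetric])
  also have "\<dots> \<le> x powr p + y powr p" using assms by (intro add_mono le) (auto simp: S_def)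
  finally show ?thesis by (simp add: S_def)
qed (use assms in auto)

lemma powr_convex_nonneg:
  fixes u v l p :: real
  assumes "1 \<le> p" "0 \<le> u" "0 \<le> v" "0 \<le> l" "l \<le> 1"
  shows "(l * u + (1 - l) * v) powr p \<le> l * u powr p + (1 - l) * v powr p"
proof -
  have one: "(l * v) powr p \<le> l * v powr p" if "0 \<le> l" "l \<le> 1" "0 \<le> v" for l v
  proof (cases "l = 0")
    case False
    have "l powr p \<le> l powr 1" using that assms False by (intro powr_mono') auto
    then show ?thesis using that False by (simp add: powr_mult mult_right_mono)
  qed simp
  show ?thesis
  proof (cases "u = 0 \<or> v = 0")
    case True
    then show ?thesis using one[of l u] one[of "1 - l" v] assms by auto
  next
    case False
    then have "u \<in> {0<..}" "v \<in> {0<..}" using assms by auto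
    from convex_onD[OF powr_convex[OF assms(1)], of "1 - l" u v] this show ?thesis using assms by simp
  qed
qed

text \<open>
  Convexity of the p-th power with weights A / (A + B) and B / (A + B). When x and y run through functions
  with p-norms at most A and B, the right-hand side integrates to at most (A + B)^p, which is
  Minkowski's inequality.
\<close>

lemma powr_add_le_minkowski:
  fixes x y A B p :: real
  assumes "1 \<le> p" "0 \<le> x" "0 \<le> y" "0 < A" "0 < B"
  shows "(x + y) powr p \<le> (A + B) powr p * (A / (A + B) * (x powr p / A powr p) + B / (A + B) * (y powr p / B powr p))"
proof -
  define l where "l = A / (A + B)"
  have l: "0 \<le> l" "l \<le> 1" "1 - l = B / (A + B)" using assms by (auto simp: l_def field_simps)
  have "x + y = (A + B) * (l * (x / A) + (1 - l) * (y / B))"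
    unfolding l(3) unfolding l_def using assms by (simp add: distrib_left)
  then have "(x + y) powr p = (A + B) powr p * (l * (x / A) + (1 - l) * (y / B)) powr p"
    using assms l by (simp add: powr_mult)
  also have "\<dots> \<le> (A + B) powr p * (l * (x / A) powr p + (1 - l) * (y / B) powr p)"
    using assms l by (intro mult_left_mono powr_convex_nonneg) auto
  finally show ?thesis using assms unfolding l(3) by (simp add: l_def powr_divide)
qed

lemma powr_add_le_quasi:
  fixes x y p :: real
  assumes "0 < p" "0 \<le> x" "0 \<le> y"
  shows "(x + y) powr p \<le> 2 powr p * (x powr p + y powr p)"
proof -
  have "(x + y) powr p \<le> (2 * max x y) powr p" using assms by (intro powr_mono2) auto
  also have "\<dots> = 2 powr p * max x y powr p" using assms by (simp add: powr_mult)
  also have "\<dots> \<le> 2 powr p * (x powr p + y powr p)" by (intro mult_left_mono) (auto simp: max_def)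
  finally show ?thesis .
qed

lemma disc_analyticD: "f \<in> disc_analytic \<Longrightarrow> f holomorphic_on ball 0 1"
  by (simp add: disc_analytic_def)

lemma disc_analytic_diff: "f \<in> disc_analytic \<Longrightarrow> h \<in> disc_analytic \<Longrightarrow> (\<lambda>z. f z - h z) \<in> disc_analytic"
  by (auto simp: disc_analytic_def intro!: holomorphic_intros)

lemma integral_mean_eq_pmean:
  assumes "f holomorphic_on ball 0 1" "0 \<le> r" "r < 1" "0 < p"
  shows "integral_mean p f r = pmean p f r powr (1 / p)"
  unfolding integral_mean_def pmean_def integral_circ_continuous[OF continuous_on_circle_powr[OF assms]]
  by simp

lemma mono_tendsto_at_left_SUP:
  fixes h :: "real \<Rightarrow> real"
  assumes mono: "\<And>r s. 0 \<le> r \<Longrightarrow> r \<le> s \<Longrightarrow> s < 1 \<Longrightarrow> h r \<le> h s" and B: "\<And>r. 0 \<le> r \<Longrightarrow> r < 1 \<Longrightarrow> h r \<le> B"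
  shows "(h \<longlongrightarrow> (SUP r\<in>{0..<1}. h r)) (at_left 1)"
proof -
  have bdd: "bdd_above (h ` {0..<1})" using B by (intro bdd_aboveI2) auto
  show ?thesis
  proof (rule order_tendstoI)
    fix a assume "a < (SUP r\<in>{0..<1}. h r)"
    then obtain r where r: "r \<in> {0..<1}" "a < h r" using less_cSUP_iff[OF _ bdd] by auto
    have "eventually (\<lambda>s. s \<in> {r<..<1}) (at_left 1)" using r by (intro eventually_at_left_real) auto
    then show "eventually (\<lambda>s. a < h s) (at_left 1)"
    proof eventually_elim
      case (elim s)
      then show ?case using r mono[of r s] by auto
    qed
  next
    fix a assume a: "(SUP r\<in>{0..<1}. h r) < a"
    have "eventually (\<lambda>s::real. s \<in> {0<..<1}) (at_left 1)" by (intro eventually_at_left_real) auto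
    then show "eventually (\<lambda>s. h s < a) (at_left 1)"
    proof eventually_elim
      case (elim s)
      then show ?case using a cSUP_upper[OF _ bdd, of s] by auto
    qed
  qed
qed

lemma eventually_at_left_1_Icc: "eventually (\<lambda>s::real. 0 \<le> s \<and> s < 1) (at_left 1)"
proof -
  have "eventually (\<lambda>s::real. s \<in> {0<..<1}) (at_left 1)" by (intro eventually_at_left_real) auto
  then show ?thesis by eventually_elim auto
qed

text \<open>
  The means increase with the radius, so a bound already yields the limit that defines the Hardy space.
\<close>

lemma bounded_pmean_hardy:
  assumes f: "f \<in> disc_analytic" and p: "0 < p" and B: "\<And>r. 0 \<le> r \<Longrightarrow> r < 1 \<Longrightarrow> pmean p f r \<le> B"
  shows "f \<in> hardy_space p"
    and "(pmean p f \<longlongrightarrow> hardy_norm p f powr p) (at_left 1)"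
    and "0 \<le> hardy_norm p f"
proof -
  define L where "L = (SUP r\<in>{0..<1}. pmean p f r)"
  note hol = disc_analyticD[OF f]
  have lim: "(pmean p f \<longlongrightarrow> L) (at_left 1)"
    unfolding L_def by (rule mono_tendsto_at_left_SUP[OF pmean_mono[OF hol _ _ _ p] B])
  have L0: "0 \<le> L"
    using tendsto_lowerbound[OF lim always_eventually] pmean_nonneg by auto
  have "((\<lambda>r. pmean p f r powr (1 / p)) \<longlongrightarrow> L powr (1 / p)) (at_left 1)"
    using p by (intro tendsto_powr' lim tendsto_const) (auto simp: pmean_nonneg)
  then have lim': "(integral_mean p f \<longlongrightarrow> L powr (1 / p)) (at_left 1)"
    by (rule Lim_transform_eventually)
       (use eventually_at_left_1_Icc in \<open>eventually_elim, simp add: integral_mean_eq_pmean[OF hol _ _ p]\<close>)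
  then show "f \<in> hardy_space p" using f by (auto simp: hardy_space_def)
  have N: "hardy_norm p f = L powr (1 / p)"
    unfolding hardy_norm_def by (rule tendsto_Lim[OF _ lim']) simp
  then show "0 \<le> hardy_norm p f" by simp
  have "hardy_norm p f powr p = L" unfolding N using p L0 by (simp add: powr_powr)
  then show "(pmean p f \<longlongrightarrow> hardy_norm p f powr p) (at_left 1)" using lim by simp
qed

lemma hardy_space_bounded:
  assumes "f \<in> hardy_space p" "0 < p"
  obtains B where "\<And>r. 0 \<le> r \<Longrightarrow> r < 1 \<Longrightarrow> pmean p f r \<le> B"
proof -
  obtain L where f: "f \<in> disc_analytic" and L: "(integral_mean p f \<longlongrightarrow> L) (at_left 1)"
    using assms by (auto simp: hardy_space_def)
  note hol = disc_analyticD[OF f]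
  have "pmean p f r \<le> L powr p" if r: "0 \<le> r" "r < 1" for r
  proof -
    have "eventually (\<lambda>s. s \<in> {r<..<1}) (at_left 1)" using r by (intro eventually_at_left_real) auto
    then have "eventually (\<lambda>s. pmean p f r powr (1/p) \<le> integral_mean p f s) (at_left 1)"
    proof eventually_elim
      case (elim s)
      then show ?case
        using r pmean_mono[OF hol r(1) _ _ assms(2), of s] pmean_nonneg[of p f r] assms(2)
        by (subst integral_mean_eq_pmean[OF hol]) (auto intro!: powr_mono2)
    qed
    then have "pmean p f r powr (1/p) \<le> L" using tendsto_lowerbound[OF L] by simp
    then have "(pmean p f r powr (1/p)) powr p \<le> L powr p" using assms by (intro powr_mono2) auto
    then show ?thesis using assms pmean_nonneg[of p f r] by (simp add: powr_powr)
  qed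
  then show ?thesis using that by blast
qed

lemma hardy_space_disc: "f \<in> hardy_space p \<Longrightarrow> f \<in> disc_analytic"
  by (simp add: hardy_space_def)

lemma hardy_norm_nonneg: "f \<in> hardy_space p \<Longrightarrow> 0 < p \<Longrightarrow> 0 \<le> hardy_norm p f"
  by (metis hardy_space_bounded bounded_pmean_hardy(3) hardy_space_disc)

lemma pmean_le_hardy_norm:
  assumes f: "f \<in> hardy_space p" and p: "0 < p" and r: "0 \<le> r" "r < 1"
  shows "pmean p f r \<le> hardy_norm p f powr p"
proof -
  obtain B where B: "\<And>r. 0 \<le> r \<Longrightarrow> r < 1 \<Longrightarrow> pmean p f r \<le> B" using hardy_space_bounded[OF f p] by metis
  have hol: "f holomorphic_on ball 0 1" using f hardy_space_disc disc_analyticD by blast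
  have "eventually (\<lambda>s. s \<in> {r<..<1}) (at_left 1)" using r by (intro eventually_at_left_real) auto
  then have "eventually (\<lambda>s. pmean p f r \<le> pmean p f s) (at_left 1)"
    by eventually_elim (use r pmean_mono[OF hol r(1) _ _ p] in auto)
  moreover have "(pmean p f \<longlongrightarrow> hardy_norm p f powr p) (at_left 1)"
    by (rule bounded_pmean_hardy(2)[OF hardy_space_disc[OF f] p B])
  ultimately show ?thesis
    using tendsto_lowerbound[of "pmean p f"] by simp
qed

lemma hardy_norm_le:
  assumes f: "f \<in> disc_analytic" and p: "0 < p" and B: "\<And>r. 0 \<le> r \<Longrightarrow> r < 1 \<Longrightarrow> pmean p f r \<le> B powr p" and B0: "0 \<le> B"
  shows "f \<in> hardy_space p" "hardy_norm p f \<le> B"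
proof -
  show "f \<in> hardy_space p" by (rule bounded_pmean_hardy(1)[OF f p B])
  have lim: "(pmean p f \<longlongrightarrow> hardy_norm p f powr p) (at_left 1)" by (rule bounded_pmean_hardy(2)[OF f p B])
  have N0: "0 \<le> hardy_norm p f" by (rule bounded_pmean_hardy(3)[OF f p B])
  have "eventually (\<lambda>r. pmean p f r \<le> B powr p) (at_left 1)"
    using eventually_at_left_1_Icc by eventually_elim (simp add: B)
  then have "hardy_norm p f powr p \<le> B powr p" using tendsto_upperbound[OF lim] by simp
  then show "hardy_norm p f \<le> B" using p B0 N0 powr_less_mono2[of p B "hardy_norm p f"] by linarith
qed

lemma pmean_diff_le:
  assumes f: "f holomorphic_on ball 0 1" and h: "h holomorphic_on ball 0 1" and p: "0 < p" and r: "0 \<le> r" "r < 1"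
    and le: "\<And>x y. 0 \<le> x \<Longrightarrow> 0 \<le> y \<Longrightarrow> (x + y) powr p \<le> a * x powr p + b * y powr p"
  shows "pmean p (\<lambda>z. f z - h z) r \<le> a * pmean p f r + b * pmean p h r"
proof -
  note i = circle_powr_integrable[OF f r p] circle_powr_integrable[OF h r p]
  have fh: "(\<lambda>z. f z - h z) holomorphic_on ball 0 1" using f h by (intro holomorphic_intros)
  have "pmean p (\<lambda>z. f z - h z) r
      \<le> (LINT \<phi>|circ. a * norm (f (of_real r * cis \<phi>)) powr p + b * norm (h (of_real r * cis \<phi>)) powr p)"
    unfolding pmean_def
  proof (rule integral_circ_mono[OF circle_powr_integrable[OF fh r p]])
    fix \<phi>
    have "norm (f (of_real r * cis \<phi>) - h (of_real r * cis \<phi>)) powr p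
        \<le> (norm (f (of_real r * cis \<phi>)) + norm (h (of_real r * cis \<phi>))) powr p"
      using p by (intro powr_mono2 norm_triangle_ineq4) auto
    also have "\<dots> \<le> a * norm (f (of_real r * cis \<phi>)) powr p + b * norm (h (of_real r * cis \<phi>)) powr p"
      by (rule le) auto
    finally show "norm (f (of_real r * cis \<phi>) - h (of_real r * cis \<phi>)) powr p
        \<le> a * norm (f (of_real r * cis \<phi>)) powr p + b * norm (h (of_real r * cis \<phi>)) powr p" .
  qed (use i in auto)
  also have "\<dots> = a * pmean p f r + b * pmean p h r"
    using i by (simp add: pmean_def)
  finally show ?thesis .
qed

lemma hardy_norm_diff_quasi:
  assumes f: "f \<in> hardy_space p" and h: "h \<in> hardy_space p" and p: "0 < p"
  shows "(\<lambda>z. f z - h z) \<in> hardy_space p"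
    and "hardy_norm p (\<lambda>z. f z - h z) \<le> 2 * 2 powr (1 / p) * (hardy_norm p f + hardy_norm p h)"
proof -
  define N where "N = hardy_norm p f + hardy_norm p h"
  note nn = hardy_norm_nonneg[OF f p] hardy_norm_nonneg[OF h p]
  have N0: "0 \<le> N" using nn by (simp add: N_def)
  have B: "pmean p (\<lambda>z. f z - h z) r \<le> (2 * 2 powr (1 / p) * N) powr p" if r: "0 \<le> r" "r < 1" for r
  proof -
    have "pmean p (\<lambda>z. f z - h z) r \<le> 2 powr p * pmean p f r + 2 powr p * pmean p h r"
      by (intro pmean_diff_le disc_analyticD hardy_space_disc[OF f] hardy_space_disc[OF h] p r)
         (use powr_add_le_quasi[OF p] in \<open>simp add: distrib_left\<close>)
    also have "\<dots> \<le> 2 powr p * hardy_norm p f powr p + 2 powr p * hardy_norm p h powr p"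
      by (intro add_mono mult_left_mono pmean_le_hardy_norm f h p r) auto
    also have "\<dots> \<le> 2 powr p * N powr p + 2 powr p * N powr p"
      using nn p by (intro add_mono mult_left_mono powr_mono2) (auto simp: N_def)
    also have "\<dots> = (2 * 2 powr (1 / p) * N) powr p"
      using N0 p by (simp add: powr_mult powr_powr)
    finally show ?thesis .
  qed
  note * = hardy_norm_le[OF disc_analytic_diff[OF hardy_space_disc[OF f] hardy_space_disc[OF h]] p B]
  show "(\<lambda>z. f z - h z) \<in> hardy_space p" by (rule *(1)) (use N0 in auto)
  show "hardy_norm p (\<lambda>z. f z - h z) \<le> 2 * 2 powr (1 / p) * (hardy_norm p f + hardy_norm p h)"
    unfolding N_def[symmetric] by (rule *(2)) (use N0 in auto)
qed

lemma hardy_norm_diff_triangle: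
  assumes f: "f \<in> hardy_space p" and h: "h \<in> hardy_space p" and p: "0 < p"
  shows "hardy_norm p (\<lambda>z. f z - h z) powr min 1 p \<le> hardy_norm p f powr min 1 p + hardy_norm p h powr min 1 p"
proof -
  note nn = hardy_norm_nonneg[OF f p] hardy_norm_nonneg[OF h p] hardy_norm_nonneg[OF hardy_norm_diff_quasi(1)[OF f h p] p]
  note hol = disc_analyticD[OF hardy_space_disc[OF f]] disc_analyticD[OF hardy_space_disc[OF h]]
  note d = disc_analytic_diff[OF hardy_space_disc[OF f] hardy_space_disc[OF h]]
  show ?thesis
  proof (cases "p \<le> 1")
    case True
    define B where "B = (hardy_norm p f powr p + hardy_norm p h powr p) powr (1 / p)"
    have Bp: "B powr p = hardy_norm p f powr p + hardy_norm p h powr p"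
      using p by (simp add: B_def powr_powr)
    have "hardy_norm p (\<lambda>z. f z - h z) \<le> B"
    proof (rule hardy_norm_le(2)[OF d p])
      fix r :: real assume r: "0 \<le> r" "r < 1"
      have "pmean p (\<lambda>z. f z - h z) r \<le> 1 * pmean p f r + 1 * pmean p h r"
        by (intro pmean_diff_le hol p r) (use powr_add_le_subadditive[OF p True] in simp)
      also have "\<dots> \<le> B powr p"
        unfolding Bp using pmean_le_hardy_norm[OF f p r] pmean_le_hardy_norm[OF h p r] by simp
      finally show "pmean p (\<lambda>z. f z - h z) r \<le> B powr p" .
    qed (simp add: B_def)
    then have "hardy_norm p (\<lambda>z. f z - h z) powr p \<le> B powr p" using nn p by (intro powr_mono2) auto
    then show ?thesis using True by (simp add: Bp min_absorb2)
  next
    case False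
    then have p1: "1 \<le> p" by simp
    \<comment> \<open>the slack e keeps both weights of the convex combination positive when a norm vanishes\<close>
    have "hardy_norm p (\<lambda>z. f z - h z) \<le> hardy_norm p f + hardy_norm p h + e" if e: "0 < e" for e
    proof -
      define A B where "A = hardy_norm p f + e / 2" and "B = hardy_norm p h + e / 2"
      have AB: "0 < A" "0 < B" using nn e by (auto simp: A_def B_def)
      define a b where "a = (A + B) powr p * (A / (A + B)) / A powr p" and "b = (A + B) powr p * (B / (A + B)) / B powr p"
      have ab: "0 \<le> a" "0 \<le> b" using AB by (auto simp: a_def b_def)
      have "hardy_norm p (\<lambda>z. f z - h z) \<le> A + B"
      proof (rule hardy_norm_le(2)[OF d p])
        fix r :: real assume r: "0 \<le> r" "r < 1"
        have le: "(x + y) powr p \<le> a * x powr p + b * y powr p" if "0 \<le> x" "0 \<le> y" for x y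
          using powr_add_le_minkowski[OF p1 that AB] by (simp add: a_def b_def distrib_left)
        have "pmean p (\<lambda>z. f z - h z) r \<le> a * pmean p f r + b * pmean p h r"
          by (intro pmean_diff_le hol p r le)
        also have "\<dots> \<le> a * A powr p + b * B powr p"
        proof (intro add_mono mult_left_mono ab)
          have "hardy_norm p f powr p \<le> A powr p" "hardy_norm p h powr p \<le> B powr p"
            using nn e p by (auto intro!: powr_mono2 simp: A_def B_def)
          then show "pmean p f r \<le> A powr p" "pmean p h r \<le> B powr p"
            using pmean_le_hardy_norm[OF f p r] pmean_le_hardy_norm[OF h p r] by simp_all
        qed
        also have "\<dots> = (A + B) powr p * (A / (A + B) + B / (A + B))"
          using AB by (simp add: a_def b_def distrib_left)
        also have "\<dots> = (A + B) powr p" using AB by (simp add: add_divide_distrib[symmetric])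
        finally show "pmean p (\<lambda>z. f z - h z) r \<le> (A + B) powr p" .
      qed (use AB in simp)
      then show ?thesis by (simp add: A_def B_def)
    qed
    then have "hardy_norm p (\<lambda>z. f z - h z) \<le> hardy_norm p f + hardy_norm p h" by (rule field_le_epsilon)
    then show ?thesis using p1 nn by (simp add: min_absorb1)
  qed
qed

text \<open>
  The sub-mean value property on the circle of radius (1 + |z|) / 2, from which z keeps a distance comparable
  with 1 - |z|.
\<close>

lemma hardy_growth:
  assumes f: "f \<in> hardy_space p" and p: "0 < p" and z: "norm z < 1"
  shows "norm (f z) powr p \<le> 4 / (1 - norm z) * hardy_norm p f powr p"
proof -
  define \<rho> where "\<rho> = (1 + norm z) / 2"
  have "0 < 1 + norm z" by (rule add_pos_nonneg) auto
  then have \<rho>: "0 < \<rho>" "\<rho> < 1" "norm z < \<rho>" using z by (auto simp: \<rho>_def)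
  define w where "w = z / of_real \<rho>"
  have nw: "norm w = norm z / \<rho>" using \<rho> by (simp add: w_def norm_divide)
  have w1: "norm w < 1" unfolding nw using \<rho> by simp
  have fac: "2 / (1 - norm w) \<le> 4 / (1 - norm z)"
  proof -
    have "(1 - norm z) / 2 = \<rho> - norm z" by (simp add: \<rho>_def field_simps)
    also have "\<dots> \<le> (\<rho> - norm z) / \<rho>" using mult_left_le[of \<rho> "\<rho> - norm z"] \<rho> by (simp add: pos_le_divide_eq)
    also have "\<dots> = 1 - norm w" using \<rho> by (simp add: nw diff_divide_distrib)
    finally show ?thesis using z w1 by (simp add: field_simps)
  qed
  have "norm (f (\<rho> * w)) powr p \<le> 2 / (1 - norm w) * pmean p f \<rho>"
    by (rule norm_powr_le_pmean[OF disc_analyticD[OF hardy_space_disc[OF f]] \<rho>(1,2) p w1])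
  also have "\<dots> \<le> 4 / (1 - norm z) * hardy_norm p f powr p"
    using fac z \<rho> pmean_nonneg by (intro mult_mono pmean_le_hardy_norm f p) auto
  finally show ?thesis using \<rho> by (simp add: w_def)
qed

lemma hardy_norm_eq_0:
  assumes f: "f \<in> hardy_space p" and p: "0 < p" and N: "hardy_norm p f = 0"
  shows "f z = 0"
proof (cases "norm z < 1")
  case True
  from hardy_growth[OF f p True] N have "norm (f z) powr p \<le> 0" by simp
  then show ?thesis by simp
next
  case False
  then show ?thesis using hardy_space_disc[OF f] by (auto simp: disc_analytic_def)
qed

lemma hardy_norm_zero: "0 < p \<Longrightarrow> hardy_norm p (\<lambda>z. 0) = 0"
proof -
  assume p: "0 < p"
  have d: "(\<lambda>z. 0) \<in> disc_analytic" by (simp add: disc_analytic_def)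
  have "hardy_norm p (\<lambda>z. 0) \<le> 0" by (rule hardy_norm_le(2)[OF d p]) (auto simp: pmean_def)
  moreover have "0 \<le> hardy_norm p (\<lambda>z. 0)"
    by (rule bounded_pmean_hardy(3)[OF d p, of 0]) (auto simp: pmean_def)
  ultimately show ?thesis by simp
qed

lemma hardy_norm_commute: "hardy_norm p (\<lambda>z. f z - h z) = hardy_norm p (\<lambda>z. h z - f z)"
  unfolding hardy_norm_def integral_mean_def by (simp add: norm_minus_commute)

lemma Metric_space_hardy:
  assumes p: "0 < p"
  shows "Metric_space (hardy_space p) (hardy_dist p)"
proof
  show "0 \<le> hardy_dist p f h" for f h by (simp add: hardy_dist_def)
  show "hardy_dist p f h = hardy_dist p h f" for f h
    unfolding hardy_dist_def by (subst hardy_norm_commute) simp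
  show "hardy_dist p f h = 0 \<longleftrightarrow> f = h" if f: "f \<in> hardy_space p" and h: "h \<in> hardy_space p" for f h
  proof
    assume "hardy_dist p f h = 0"
    then have "hardy_norm p (\<lambda>z. f z - h z) = 0" by (simp add: hardy_dist_def)
    from hardy_norm_eq_0[OF hardy_norm_diff_quasi(1)[OF f h p] p this] show "f = h" by (auto simp: fun_eq_iff)
  qed (simp add: hardy_dist_def hardy_norm_zero[OF p])
  show "hardy_dist p f k \<le> hardy_dist p f h + hardy_dist p h k"
    if f: "f \<in> hardy_space p" and h: "h \<in> hardy_space p" and k: "k \<in> hardy_space p" for f h k
  proof -
    have "hardy_dist p f k = hardy_norm p (\<lambda>z. (f z - h z) - (k z - h z)) powr min 1 p"
      by (simp add: hardy_dist_def)
    also have "\<dots> \<le> hardy_dist p f h + hardy_dist p k h"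
      unfolding hardy_dist_def
      by (intro hardy_norm_diff_triangle hardy_norm_diff_quasi(1) f h k p)
    also have "hardy_dist p k h = hardy_dist p h k"
      unfolding hardy_dist_def by (subst hardy_norm_commute) simp
    finally show ?thesis .
  qed
qed

lemma integral_fatou_le:
  fixes \<phi> :: "real \<Rightarrow> real"
  assumes i: "\<And>k. integrable circ (\<psi> k)" and j: "integrable circ \<phi>" and nn: "\<And>k x. 0 \<le> \<psi> k x" "\<And>x. 0 \<le> \<phi> x"
    and lim: "\<And>x. (\<lambda>k. \<psi> k x) \<longlonglongrightarrow> \<phi> x" and le: "eventually (\<lambda>k. (LINT x|circ. \<psi> k x) \<le> C) sequentially"
  shows "(LINT x|circ. \<phi> x) \<le> C"
proof -
  have C: "0 \<le> C"
  proof -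
    obtain k where "(LINT x|circ. \<psi> k x) \<le> C" using le by (auto simp: eventually_sequentially)
    moreover have "0 \<le> (LINT x|circ. \<psi> k x)" using nn by (intro integral_nonneg_AE) auto
    ultimately show ?thesis by simp
  qed
  have m: "(\<lambda>x. ennreal (\<psi> k x)) \<in> borel_measurable circ" for k
    using borel_measurable_integrable[OF i[of k]] by measurable
  have "ennreal (LINT x|circ. \<phi> x) = (\<integral>\<^sup>+x. ennreal (\<phi> x) \<partial>circ)"
    by (rule nn_integral_eq_integral[symmetric, OF j]) (simp add: nn)
  also have "\<dots> = (\<integral>\<^sup>+x. liminf (\<lambda>k. ennreal (\<psi> k x)) \<partial>circ)"
  proof (rule nn_integral_cong)
    fix x
    have "(\<lambda>k. ennreal (\<psi> k x)) \<longlonglongrightarrow> ennreal (\<phi> x)" by (intro tendsto_ennrealI lim)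
    then show "ennreal (\<phi> x) = liminf (\<lambda>k. ennreal (\<psi> k x))" by (simp add: lim_imp_Liminf)
  qed
  also have "\<dots> \<le> liminf (\<lambda>k. \<integral>\<^sup>+x. ennreal (\<psi> k x) \<partial>circ)"
    by (rule nn_integral_liminf[OF m])
  also have "\<dots> = liminf (\<lambda>k. ennreal (LINT x|circ. \<psi> k x))"
    by (subst nn_integral_eq_integral[OF i]) (auto simp: nn)
  also have "\<dots> \<le> ennreal C"
  proof (rule Liminf_le)
    show "eventually (\<lambda>k. ennreal (LINT x|circ. \<psi> k x) \<le> ennreal C) sequentially"
      using le by eventually_elim (rule ennreal_leI)
  qed simp
  finally show ?thesis using C by (simp add: ennreal_le_iff)
qed

text \<open>
  Fatou's lemma on each circle passes the Cauchy estimate to the limit, so that convergence at the points of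
  the disc is enough to identify the limit in the norm.
\<close>

lemma hardy_limit:
  assumes u: "\<And>k. u k \<in> hardy_space q" and q: "0 < q" and h: "h \<in> disc_analytic"
    and lim: "\<And>z. norm z < 1 \<Longrightarrow> (\<lambda>k. u k z) \<longlonglongrightarrow> h z"
    and cauchy: "\<And>e. 0 < e \<Longrightarrow> \<exists>J. \<forall>j\<ge>J. \<forall>k\<ge>J. hardy_norm q (\<lambda>z. u j z - u k z) \<le> e"
  shows "h \<in> hardy_space q" and "(\<lambda>j. hardy_norm q (\<lambda>z. u j z - h z)) \<longlonglongrightarrow> 0"
proof -
  have holu: "u k holomorphic_on ball 0 1" for k using u hardy_space_disc disc_analyticD by blast
  have est: "(\<lambda>z. u j z - h z) \<in> hardy_space q \<and> hardy_norm q (\<lambda>z. u j z - h z) \<le> e"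
    if e: "0 < e" and J: "\<forall>k\<ge>J. hardy_norm q (\<lambda>z. u j z - u k z) \<le> e" for e j J
  proof -
    have d: "(\<lambda>z. u j z - h z) \<in> disc_analytic" using u h hardy_space_disc disc_analytic_diff by blast
    have "pmean q (\<lambda>z. u j z - h z) r \<le> e powr q" if r: "0 \<le> r" "r < 1" for r
      unfolding pmean_def
    proof (rule integral_fatou_le[where \<psi>="\<lambda>k x. norm (u j (of_real r * cis x) - u k (of_real r * cis x)) powr q"])
      show "integrable circ (\<lambda>x. norm (u j (of_real r * cis x) - u k (of_real r * cis x)) powr q)" for k
        by (rule circle_powr_integrable[OF _ r q, of "\<lambda>z. u j z - u k z"]) (intro holomorphic_intros holu)
      show "integrable circ (\<lambda>x. norm (u j (of_real r * cis x) - h (of_real r * cis x)) powr q)"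
        by (rule circle_powr_integrable[OF disc_analyticD[OF d] r q])
      show "(\<lambda>k. norm (u j (of_real r * cis x) - u k (of_real r * cis x)) powr q)
          \<longlonglongrightarrow> norm (u j (of_real r * cis x) - h (of_real r * cis x)) powr q" for x
        using r q by (intro tendsto_powr' tendsto_norm tendsto_diff tendsto_const lim) (auto simp: norm_mult)
      show "eventually (\<lambda>k. (LINT x|circ. norm (u j (of_real r * cis x) - u k (of_real r * cis x)) powr q) \<le> e powr q) sequentially"
        unfolding eventually_sequentially
      proof (intro exI allI impI)
        fix k assume k: "J \<le> k"
        have H: "(\<lambda>z. u j z - u k z) \<in> hardy_space q" by (intro hardy_norm_diff_quasi(1) u q)
        have "(LINT x|circ. norm (u j (of_real r * cis x) - u k (of_real r * cis x)) powr q) \<le> hardy_norm q (\<lambda>z. u j z - u k z) powr q"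
          using pmean_le_hardy_norm[OF H q r] by (simp add: pmean_def)
        also have "\<dots> \<le> e powr q" using J k q hardy_norm_nonneg[OF H q] by (intro powr_mono2) auto
        finally show "(LINT x|circ. norm (u j (of_real r * cis x) - u k (of_real r * cis x)) powr q) \<le> e powr q" .
      qed
    qed auto
    then show ?thesis using hardy_norm_le[OF d q _, of e] e by auto
  qed
  obtain J where "\<forall>j\<ge>J. \<forall>k\<ge>J. hardy_norm q (\<lambda>z. u j z - u k z) \<le> 1" using cauchy[of 1] by auto
  then have "(\<lambda>z. u J z - h z) \<in> hardy_space q" using est[of 1 J J] by auto
  from hardy_norm_diff_quasi(1)[OF u[of J] this q] show "h \<in> hardy_space q" by simp
  show "(\<lambda>j. hardy_norm q (\<lambda>z. u j z - h z)) \<longlonglongrightarrow> 0"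
  proof (rule LIMSEQ_I)
    fix e :: real assume e: "0 < e"
    obtain J where J: "\<forall>j\<ge>J. \<forall>k\<ge>J. hardy_norm q (\<lambda>z. u j z - u k z) \<le> e / 2" using cauchy[of "e / 2"] e by auto
    show "\<exists>N. \<forall>n\<ge>N. norm (hardy_norm q (\<lambda>z. u n z - h z) - 0) < e"
    proof (intro exI allI impI)
      fix n assume n: "J \<le> n"
      have "(\<lambda>z. u n z - h z) \<in> hardy_space q" "hardy_norm q (\<lambda>z. u n z - h z) \<le> e / 2"
        using est[of "e / 2" J n] J n e by auto
      then show "norm (hardy_norm q (\<lambda>z. u n z - h z) - 0) < e"
        using hardy_norm_nonneg[of _ q] q e by fastforce
    qed
  qed
qed


section \<open>The integration operator along radii\<close>

lemma T_op_properties: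
  assumes f: "f holomorphic_on ball 0 1" and g: "g holomorphic_on ball 0 1"
  shows T_op_has_contour_integral:
      "norm z < 1 \<Longrightarrow> ((\<lambda>\<zeta>. f \<zeta> * deriv g \<zeta>) has_contour_integral T_op g f z) (linepath 0 z)"
    and T_op_has_field_derivative: "norm z < 1 \<Longrightarrow> (T_op g f has_field_derivative f z * deriv g z) (at z)"
    and T_op_disc_analytic: "T_op g f \<in> disc_analytic"
    and T_op_0: "T_op g f 0 = 0"
proof -
  have hol: "(\<lambda>\<zeta>. f \<zeta> * deriv g \<zeta>) holomorphic_on ball 0 1"
    using f g by (intro holomorphic_intros holomorphic_deriv) auto
  obtain F where F: "\<And>x. x \<in> ball 0 1 \<Longrightarrow> (F has_field_derivative f x * deriv g x) (at x within ball 0 1)"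
    using holomorphic_convex_primitive'[OF convex_ball open_ball hol] by metis
  have ci: "((\<lambda>\<zeta>. f \<zeta> * deriv g \<zeta>) has_contour_integral (F z - F 0)) (linepath 0 z)" if "norm z < 1" for z
  proof -
    have "closed_segment 0 z \<subseteq> ball 0 1" using that by (intro closed_segment_subset) auto
    from contour_integral_primitive[OF F _ this[folded path_image_linepath]] show ?thesis by simp
  qed
  have T: "T_op g f z = F z - F 0" if "norm z < 1" for z
    using contour_integral_unique[OF ci[OF that]] that by (simp add: T_op_def)
  show "((\<lambda>\<zeta>. f \<zeta> * deriv g \<zeta>) has_contour_integral T_op g f z) (linepath 0 z)" if "norm z < 1" for z
    using ci[OF that] T[OF that] by simp
  have der: "(T_op g f has_field_derivative f z * deriv g z) (at z)" if z: "norm z < 1" for z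
  proof -
    have "((\<lambda>z. F z - F 0) has_field_derivative f z * deriv g z) (at z)"
    proof -
      have "(F has_field_derivative f z * deriv g z) (at z)"
        using F[of z] at_within_open[of z "ball 0 1"] z by simp
      from DERIV_diff[OF this DERIV_const] show ?thesis by simp
    qed
    then show ?thesis
      by (rule has_field_derivative_transform_within_open[OF _ open_ball[of 0 1]]) (use z T in auto)
  qed
  then show "(T_op g f has_field_derivative f z * deriv g z) (at z)" if "norm z < 1" for z using that by blast
  show "T_op g f \<in> disc_analytic"
  proof -
    have "T_op g f holomorphic_on ball 0 1"
      unfolding holomorphic_on_def field_differentiable_def
    proof
      fix x :: complex assume "x \<in> ball 0 1"
      then show "\<exists>f'. (T_op g f has_field_derivative f') (at x within ball 0 1)"
        using has_field_derivative_at_within[OF der[of x]] by auto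
    qed
    moreover have "T_op g f z = 0" if "z \<notin> ball 0 1" for z using that by (simp add: T_op_def)
    ultimately show ?thesis by (simp add: disc_analytic_def)
  qed
  show "T_op g f 0 = 0" by (simp add: T_op_def)
qed

lemma T_op_diff:
  assumes "f holomorphic_on ball 0 1" "h holomorphic_on ball 0 1" "g holomorphic_on ball 0 1"
  shows "T_op g (\<lambda>z. f z - h z) = (\<lambda>z. T_op g f z - T_op g h z)"
proof
  fix z
  have fh: "(\<lambda>z. f z - h z) holomorphic_on ball 0 1" using assms by (intro holomorphic_intros)
  show "T_op g (\<lambda>z. f z - h z) z = T_op g f z - T_op g h z"
  proof (cases "norm z < 1")
    case True
    have "((\<lambda>\<zeta>. (f \<zeta> - h \<zeta>) * deriv g \<zeta>) has_contour_integral (T_op g f z - T_op g h z)) (linepath 0 z)"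
      using has_contour_integral_diff[OF T_op_has_contour_integral[OF assms(1,3) True] T_op_has_contour_integral[OF assms(2,3) True]]
      by (simp add: left_diff_distrib)
    then show ?thesis
      using T_op_has_contour_integral[OF fh assms(3) True] has_contour_integral_unique by blast
  qed (simp add: T_op_def)
qed

lemma T_op_norm_le:
  assumes f: "f holomorphic_on ball 0 1" and g: "g holomorphic_on ball 0 1" and z: "norm z < 1"
    and le: "\<And>w. norm w \<le> norm z \<Longrightarrow> norm (f w) \<le> e" and G: "\<And>w. norm w \<le> norm z \<Longrightarrow> norm (deriv g w) \<le> G"
  shows "norm (T_op g f z) \<le> e * G"
proof -
  have e0: "0 \<le> e" using order_trans[OF norm_ge_zero le[of 0]] by simp
  have G0: "0 \<le> G" using order_trans[OF norm_ge_zero G[of 0]] by simp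
  have "norm (T_op g f z) \<le> e * G * norm (z - 0)"
  proof (rule has_contour_integral_bound_linepath[OF T_op_has_contour_integral[OF f g z]])
    fix w assume "w \<in> closed_segment 0 z"
    then have "norm w \<le> norm z" using segment_bound(1)[of w 0 z] by simp
    then show "norm (f w * deriv g w) \<le> e * G"
      unfolding norm_mult using le[of w] G[of w] e0 by (intro mult_mono) auto
  qed (use e0 G0 in auto)
  also have "\<dots> \<le> e * G * 1" using z e0 G0 by (intro mult_left_mono) auto
  finally show ?thesis by simp
qed

text \<open>
  Compares u with an antiderivative of the bound on its derivative. The exponent \<gamma> may be negative, in
  which case the bound is not integrable up to 1.
\<close>

lemma radial_increment_le:
  fixes u :: "real \<Rightarrow> complex"
  assumes ab: "0 \<le> a" "a \<le> b" "b < 1" and g: "\<gamma> \<noteq> 0"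
    and u: "\<And>t. 0 \<le> t \<Longrightarrow> t < 1 \<Longrightarrow> (u has_vector_derivative u' t) (at t)"
    and le: "\<And>t. a < t \<Longrightarrow> t < b \<Longrightarrow> norm (u' t) \<le> c * (1 - t) powr (\<gamma> - 1)"
  shows "norm (u b - u a) \<le> c * ((1 - a) powr \<gamma> - (1 - b) powr \<gamma>) / \<gamma>"
proof (cases "a = b")
  case False
  define \<Phi> where "\<Phi> t = - c * (1 - t) powr \<gamma> / \<gamma>" for t
  have "norm (u b - u a) \<le> \<Phi> b - \<Phi> a"
  proof (rule differentiable_bound_general)
    show "a < b" using False ab by simp
    show "continuous_on {a..b} u"
    proof (rule continuous_at_imp_continuous_on, rule ballI)
      fix x assume "x \<in> {a..b}"
      then show "isCont u x" using has_vector_derivative_continuous[OF u[of x]] ab by auto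
    qed
    show "continuous_on {a..b} \<Phi>"
      unfolding \<Phi>_def using ab g by (intro continuous_intros) auto
    fix t assume t: "a < t" "t < b"
    show "(u has_vector_derivative u' t) (at t)" using u t ab by auto
    show "(\<Phi> has_vector_derivative (c * (1 - t) powr (\<gamma> - 1))) (at t)"
      unfolding \<Phi>_def has_real_derivative_iff_has_vector_derivative[symmetric]
      using t ab g by (auto intro!: derivative_eq_intros)
    show "norm (u' t) \<le> c * (1 - t) powr (\<gamma> - 1)" by (rule le[OF t])
  qed
  then show ?thesis by (simp add: \<Phi>_def algebra_simps diff_divide_distrib)
qed simp

text \<open>
  This pointwise estimate carries the sufficiency of the growth condition. Think of \<phi> as |f| along a ray.
  Put \<delta> = (A / m)^p, the depth at which the growth bound A \<delta>^(-1/p) reaches m. Up to the point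
  1 - \<delta> the growth bound contributes q A \<delta>^(-1/q), because \<alpha> - 1/p = -1/q; beyond it the bound by m
  contributes a multiple of m \<delta>^\<alpha>. Both equal A^(1 - p/q) m^(p/q) up to constants. If m \<le> A, the
  second argument is used on the whole ray with A in place of m, which accounts for the summand A.
\<close>

lemma radial_hedberg:
  fixes u :: "real \<Rightarrow> complex" and \<phi> :: "real \<Rightarrow> real"
  assumes p: "0 < p" "p < q" and \<alpha>: "\<alpha> = 1 / p - 1 / q" and A: "0 < A" and m: "0 \<le> m"
    and growth: "\<And>t. 0 \<le> t \<Longrightarrow> t < 1 \<Longrightarrow> \<phi> t \<le> A * (1 - t) powr (- 1 / p)"
    and max: "\<And>s t. 0 \<le> s \<Longrightarrow> s \<le> t \<Longrightarrow> t < 1 \<Longrightarrow> \<phi> t \<le> \<phi> s + m * ((1 - s) / (1 - t)) powr (\<alpha> / 2)"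
    and u: "\<And>t. 0 \<le> t \<Longrightarrow> t < 1 \<Longrightarrow> (u has_vector_derivative u' t) (at t)"
    and u': "\<And>t. 0 \<le> t \<Longrightarrow> t < 1 \<Longrightarrow> norm (u' t) \<le> \<phi> t * (1 - t) powr (\<alpha> - 1)"
    and u0: "u 0 = 0" and t: "0 \<le> t" "t < 1"
  shows "norm (u t) \<le> (q + 4 / \<alpha>) * (A + A powr (1 - p / q) * m powr (p / q))"
proof -
  have q: "0 < q" using p by simp
  have \<alpha>0: "0 < \<alpha>" unfolding \<alpha> using p by (simp add: field_simps)
  have tail: "norm (u b - u a) \<le> 4 * c / \<alpha> * (1 - a) powr (\<alpha>)"
    if ab: "0 \<le> a" "a \<le> b" "b < 1" and "0 \<le> c"
      and c: "\<phi> a \<le> c" "m \<le> c" for a b c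
  proof -
    define c' where "c' = 2 * c * (1 - a) powr (\<alpha> / 2)"
    have "norm (u b - u a) \<le> c' * ((1 - a) powr (\<alpha> / 2) - (1 - b) powr (\<alpha> / 2)) / (\<alpha> / 2)"
    proof (rule radial_increment_le[OF ab _ u])
      fix s assume s: "a < s" "s < b"
      have s1: "0 \<le> s" "s < 1" using s ab by auto
      have "\<phi> s \<le> c + c * ((1 - a) / (1 - s)) powr (\<alpha> / 2)"
      proof -
        have "\<phi> s \<le> \<phi> a + m * ((1 - a) / (1 - s)) powr (\<alpha> / 2)" using max[of a s] s ab by auto
        also have "\<dots> \<le> c + c * ((1 - a) / (1 - s)) powr (\<alpha> / 2)"
          by (intro add_mono mult_right_mono c) simp
        finally show ?thesis .
      qed
      also have "\<dots> \<le> 2 * c * ((1 - a) / (1 - s)) powr (\<alpha> / 2)"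
      proof -
        have "1 \<le> (1 - a) / (1 - s)" using s s1 by simp
        then have "1 \<le> ((1 - a) / (1 - s)) powr (\<alpha> / 2)" using \<alpha>0 by (intro ge_one_powr_ge_zero) auto
        from mult_left_mono[OF this \<open>0 \<le> c\<close>] show ?thesis by simp
      qed
      finally have "\<phi> s * (1 - s) powr (\<alpha> - 1) \<le> 2 * c * ((1 - a) / (1 - s)) powr (\<alpha> / 2) * (1 - s) powr (\<alpha> - 1)"
        by (intro mult_right_mono) auto
      also have "\<dots> = c' * (1 - s) powr (\<alpha> / 2 - 1)"
        using s s1 by (simp add: c'_def powr_divide powr_diff) (simp add: field_simps powr_add[symmetric])
      finally show "norm (u' s) \<le> c' * (1 - s) powr (\<alpha> / 2 - 1)" using u'[OF s1] by linarith
    qed (use \<alpha>0 in auto)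
    also have "\<dots> \<le> c' * (1 - a) powr (\<alpha> / 2) / (\<alpha> / 2)"
      using \<open>0 \<le> c\<close> \<alpha>0 by (intro divide_right_mono mult_left_mono) (auto simp: c'_def)
    also have "\<dots> = 4 * c / \<alpha> * ((1 - a) powr (\<alpha> / 2) * (1 - a) powr (\<alpha> / 2))"
      by (simp add: c'_def)
    also have "\<dots> = 4 * c / \<alpha> * (1 - a) powr \<alpha>"
      by (simp add: powr_add[symmetric])
    finally show ?thesis .
  qed
  have Am: "0 \<le> A powr (1 - p / q) * m powr (p / q)" by simp
  show ?thesis
  proof (cases "m \<le> A")
    case True
    have "norm (u t - u 0) \<le> 4 * A / \<alpha> * (1 - 0) powr \<alpha>"
      using tail[of 0 t A] growth[of 0] True A t by auto
    also have "\<dots> = (4 / \<alpha>) * A" by simp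
    also have "\<dots> \<le> (q + 4 / \<alpha>) * (A + A powr (1 - p / q) * m powr (p / q))"
      using Am A \<alpha>0 q by (intro mult_mono) auto
    finally show ?thesis by (simp add: u0)
  next
    case False
    \<comment> \<open>the depth at which the bound by growth and the bound by the majorant coincide\<close>
    define \<delta> where "\<delta> = (A / m) powr p"
    have m0: "0 < m" using False A by simp
    have \<delta>: "0 < \<delta>" "\<delta> < 1"
      using False A m0 p powr_less_mono2[of p "A / m" 1] by (auto simp: \<delta>_def)
    define X where "X = A powr (1 - p / q) * m powr (p / q)"
    have X0: "0 \<le> X" by (simp add: X_def)
    have Xq: "A * \<delta> powr (- (1 / q)) = X"
    proof -
      have "\<delta> powr (- (1 / q)) = (A / m) powr (- (p / q))" by (simp add: \<delta>_def powr_powr)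
      also have "\<dots> = m powr (p / q) / A powr (p / q)"
        using A m0 by (simp add: powr_divide powr_minus_divide)
      finally show ?thesis using A by (simp add: X_def powr_diff)
    qed
    have X\<alpha>: "m * \<delta> powr \<alpha> = X"
    proof -
      have e: "p * \<alpha> = 1 - p / q" using p by (simp add: \<alpha> field_simps)
      have "\<delta> powr \<alpha> = (A / m) powr (1 - p / q)" by (simp add: \<delta>_def powr_powr e)
      also have "\<dots> = A powr (1 - p / q) * (m powr (p / q) / m)"
        using A m0 by (simp add: powr_divide powr_diff)
      finally show ?thesis using m0 by (simp add: X_def)
    qed
    have head: "norm (u b - u 0) \<le> q * X" if b: "0 \<le> b" "b \<le> 1 - \<delta>" for b
    proof -
      have "norm (u b - u 0) \<le> A * ((1 - 0) powr (- (1 / q)) - (1 - b) powr (- (1 / q))) / (- (1 / q))"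
      proof (rule radial_increment_le[OF _ _ _ _ u])
        fix s assume s: "0 < s" "s < b"
        have "\<phi> s * (1 - s) powr (\<alpha> - 1) \<le> A * (1 - s) powr (- 1 / p) * (1 - s) powr (\<alpha> - 1)"
          using growth[of s] s b \<delta> by (intro mult_right_mono) auto
        also have "\<dots> = A * (1 - s) powr (- (1 / q) - 1)"
          by (simp add: mult.assoc powr_add[symmetric] \<alpha>)
        finally show "norm (u' s) \<le> A * (1 - s) powr (- (1 / q) - 1)" using u'[of s] s b \<delta> by auto
      qed (use b \<delta> q in auto)
      also have "\<dots> = q * (A * (1 - b) powr (- (1 / q)) - A)"
        using q by (simp add: algebra_simps)
      also have "\<dots> \<le> q * (A * \<delta> powr (- (1 / q)))"
      proof -
        have "(1 - b) powr (- (1 / q)) \<le> \<delta> powr (- (1 / q))"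
          using b \<delta> q by (intro powr_mono2') auto
        from mult_left_mono[OF this less_imp_le[OF A]]
        have "A * (1 - b) powr (- (1 / q)) - A \<le> A * \<delta> powr (- (1 / q))" using A by linarith
        then show ?thesis by (rule mult_left_mono) (use q in simp)
      qed
      finally show ?thesis by (simp add: Xq)
    qed
    have XA: "X \<le> A + X" using A by simp
    show ?thesis
    proof (cases "t \<le> 1 - \<delta>")
      case True
      have "norm (u t - u 0) \<le> q * X" by (rule head) (use t True in auto)
      also have "\<dots> \<le> (q + 4 / \<alpha>) * (A + X)" using q \<alpha>0 A X0 by (intro mult_mono) auto
      finally show ?thesis by (simp add: u0 X_def)
    next
      case F: False
      have "\<phi> (1 - \<delta>) \<le> A * \<delta> powr (- 1 / p)" using growth[of "1 - \<delta>"] \<delta> by simp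
      also have "\<delta> powr (- 1 / p) = m / A"
        using p A m0 by (simp add: \<delta>_def powr_powr powr_minus_divide)
      finally have "\<phi> (1 - \<delta>) \<le> m" using A by simp
      then have "norm (u t - u (1 - \<delta>)) \<le> 4 * m / \<alpha> * (1 - (1 - \<delta>)) powr \<alpha>"
        using tail[of "1 - \<delta>" t m] \<delta> F t m by auto
      also have "\<dots> = 4 / \<alpha> * (m * \<delta> powr \<alpha>)" by simp
      finally have 1: "norm (u t - u (1 - \<delta>)) \<le> 4 / \<alpha> * X" by (simp add: X\<alpha>)
      have "norm (u t) \<le> norm (u t - u (1 - \<delta>)) + norm (u (1 - \<delta>) - u 0)"
        using norm_triangle_ineq[of "u t - u (1 - \<delta>)" "u (1 - \<delta>) - u 0"] by (simp add: u0)
      also have "\<dots> \<le> 4 / \<alpha> * X + q * X"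
        using 1 head[of "1 - \<delta>"] \<delta> by auto
      also have "\<dots> = (q + 4 / \<alpha>) * X" by (simp add: algebra_simps)
      also have "\<dots> \<le> (q + 4 / \<alpha>) * (A + X)" using q \<alpha>0 A by (intro mult_left_mono) auto
      finally show ?thesis by (simp add: X_def)
    qed
  qed
qed

text \<open>
  M takes the place of the p-th power of a maximal function. Slow growth towards the circle, with a small
  exponent \<beta>, is admitted because in the Dirichlet-type spaces only the increments of f along the ray are
  under control; radial_hedberg absorbs it for \<beta> = \<alpha> / 2.
\<close>

definition radial_majorant :: "real \<Rightarrow> real \<Rightarrow> (complex \<Rightarrow> complex) \<Rightarrow> (real \<Rightarrow> real) \<Rightarrow> bool" where
  "radial_majorant p \<beta> f M \<longleftrightarrow> integrable circ M \<and> (\<forall>\<theta>. 0 \<le> M \<theta>) \<and>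
     (AE \<theta> in circ. \<forall>s t. 0 \<le> s \<and> s \<le> t \<and> t < 1 \<longrightarrow>
        norm (f (of_real t * cis \<theta>)) \<le> norm (f (of_real s * cis \<theta>)) + M \<theta> powr (1 / p) * ((1 - s) / (1 - t)) powr \<beta>)"

text \<open>
  In the hypothesis on f g' the number \<epsilon> measures g' near the circle, and \<eta> takes care of the
  compact part of the disc, where f itself will be small.
\<close>

lemma T_op_pmean_le:
  assumes p: "0 < p" "p < q" and \<alpha>: "\<alpha> = 1 / p - 1 / q" and \<alpha>1: "\<alpha> \<le> 1"
    and f: "f holomorphic_on ball 0 1" and g: "g holomorphic_on ball 0 1"
    and \<eta>: "0 < \<eta>" and \<epsilon>: "0 \<le> \<epsilon>" and A: "0 \<le> A"
    and fg: "\<And>z. norm z < 1 \<Longrightarrow> norm (f z * deriv g z) \<le> (\<eta> + \<epsilon> * norm (f z)) * (1 - norm z) powr (\<alpha> - 1)"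
    and growth: "\<And>z. norm z < 1 \<Longrightarrow> norm (f z) \<le> A * (1 - norm z) powr (- 1 / p)"
    and majorant: "radial_majorant p (\<alpha> / 2) f M"
    and r: "0 \<le> r" "r < 1"
  shows "pmean q (T_op g f) r
     \<le> (2 * (q + 4 / \<alpha>)) powr q * ((\<eta> + \<epsilon> * A) powr q + (\<eta> + \<epsilon> * A) powr (q - p) * \<epsilon> powr p * (LINT \<theta>|circ. M \<theta>))"
proof -
  have M: "integrable circ M" "\<And>\<theta>. 0 \<le> M \<theta>"
    and max: "AE \<theta> in circ. \<forall>s t. 0 \<le> s \<and> s \<le> t \<and> t < 1 \<longrightarrow>
        norm (f (of_real t * cis \<theta>)) \<le> norm (f (of_real s * cis \<theta>)) + M \<theta> powr (1 / p) * ((1 - s) / (1 - t)) powr (\<alpha> / 2)"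
    using majorant by (simp_all add: radial_majorant_def)
  define C where "C = q + 4 / \<alpha>"
  define A1 where "A1 = \<eta> + \<epsilon> * A"
  have q: "0 < q" using p by simp
  have \<alpha>0: "0 < \<alpha>" unfolding \<alpha> using p by (simp add: field_simps)
  have C0: "0 < C" using q \<alpha>0 by (simp add: C_def add_pos_pos)
  have A1: "0 < A1" using \<eta> \<epsilon> A by (simp add: A1_def add_pos_nonneg)
  have hT: "T_op g f holomorphic_on ball 0 1" by (rule disc_analyticD[OF T_op_disc_analytic[OF f g]])
  have pw: "norm (T_op g f (of_real r * cis \<theta>)) powr q
      \<le> (2 * C) powr q * A1 powr q + (2 * C) powr q * (A1 powr (q - p) * \<epsilon> powr p) * M \<theta>"
    if mx: "\<forall>s t. 0 \<le> s \<and> s \<le> t \<and> t < 1 \<longrightarrow>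
        norm (f (of_real t * cis \<theta>)) \<le> norm (f (of_real s * cis \<theta>)) + M \<theta> powr (1 / p) * ((1 - s) / (1 - t)) powr (\<alpha> / 2)"
    for \<theta>
  proof -
    define u where "u t = T_op g f (of_real t * cis \<theta>)" for t
    define u' where "u' t = cis \<theta> * (f (of_real t * cis \<theta>) * deriv g (of_real t * cis \<theta>))" for t
    define \<phi> where "\<phi> t = \<eta> + \<epsilon> * norm (f (of_real t * cis \<theta>))" for t
    define m where "m = \<epsilon> * M \<theta> powr (1 / p)"
    have m0: "0 \<le> m" using \<epsilon> by (simp add: m_def)
    have "norm (u r) \<le> C * (A1 + A1 powr (1 - p / q) * m powr (p / q))"
      unfolding C_def
    proof (rule radial_hedberg[OF p \<alpha> A1 m0 _ _ _ _ _ r, of \<phi> u u'])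
      fix t :: real assume t: "0 \<le> t" "t < 1"
      have n: "norm (of_real t * cis \<theta>) = t" using t by (simp add: norm_mult)
      have "1 \<le> (1 - t) powr (- 1 / p)"
        using t p powr_mono2'[of "-1 / p" "1 - t" 1] by simp
      then have "\<eta> * 1 \<le> \<eta> * (1 - t) powr (- 1 / p)" using \<eta> by (intro mult_left_mono) auto
      moreover have "\<epsilon> * norm (f (of_real t * cis \<theta>)) \<le> \<epsilon> * (A * (1 - t) powr (- 1 / p))"
        using growth[of "of_real t * cis \<theta>"] n t \<epsilon> by (intro mult_left_mono) auto
      ultimately show "\<phi> t \<le> A1 * (1 - t) powr (- 1 / p)"
        unfolding \<phi>_def A1_def by (simp add: algebra_simps)
      have "((\<lambda>t. of_real t * cis \<theta>) has_vector_derivative cis \<theta>) (at t)"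
        by (auto intro!: derivative_eq_intros simp: has_vector_derivative_def scaleR_conv_of_real)
      from field_vector_diff_chain_at[OF this T_op_has_field_derivative[OF f g]] n t
      show "(u has_vector_derivative u' t) (at t)" by (simp add: u_def[abs_def] u'_def o_def)
      show "norm (u' t) \<le> \<phi> t * (1 - t) powr (\<alpha> - 1)"
        using fg[of "of_real t * cis \<theta>"] n t by (simp add: u'_def \<phi>_def norm_mult)
    next
      fix s t :: real assume st: "0 \<le> s" "s \<le> t" "t < 1"
      have "\<epsilon> * norm (f (of_real t * cis \<theta>)) \<le> \<epsilon> * (norm (f (of_real s * cis \<theta>)) + M \<theta> powr (1 / p) * ((1 - s) / (1 - t)) powr (\<alpha> / 2))"
        using mx st \<epsilon> by (intro mult_left_mono) auto
      then show "\<phi> t \<le> \<phi> s + m * ((1 - s) / (1 - t)) powr (\<alpha> / 2)"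
        unfolding \<phi>_def m_def by (simp add: algebra_simps)
    next
      show "u 0 = 0" by (simp add: u_def T_op_0[OF f g])
    qed
    then have "norm (u r) powr q \<le> (C * (A1 + A1 powr (1 - p / q) * m powr (p / q))) powr q"
      using q by (intro powr_mono2) auto
    also have "\<dots> = C powr q * (A1 + A1 powr (1 - p / q) * m powr (p / q)) powr q"
      using C0 A1 by (simp add: powr_mult)
    also have "\<dots> \<le> C powr q * (2 powr q * (A1 powr q + (A1 powr (1 - p / q) * m powr (p / q)) powr q))"
      using A1 q by (intro mult_left_mono powr_add_le_quasi) auto
    also have "(A1 powr (1 - p / q) * m powr (p / q)) powr q = A1 powr (q - p) * m powr p"
      using q by (simp add: powr_mult powr_powr left_diff_distrib)
    also have "m powr p = \<epsilon> powr p * M \<theta>"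
      using \<epsilon> M(2)[of \<theta>] p by (simp add: m_def powr_mult powr_powr)
    also have "C powr q * (2 powr q * (A1 powr q + A1 powr (q - p) * (\<epsilon> powr p * M \<theta>)))
        = (2 * C) powr q * A1 powr q + (2 * C) powr q * (A1 powr (q - p) * \<epsilon> powr p) * M \<theta>"
      using C0 by (simp add: powr_mult algebra_simps)
    finally show ?thesis by (simp add: u_def)
  qed
  have "pmean q (T_op g f) r \<le> (LINT \<theta>|circ. (2 * C) powr q * A1 powr q + (2 * C) powr q * (A1 powr (q - p) * \<epsilon> powr p) * M \<theta>)"
    unfolding pmean_def
  proof (rule integral_mono_AE[OF circle_powr_integrable[OF hT r q]])
    show "AE \<theta> in circ. norm (T_op g f (of_real r * cis \<theta>)) powr q
      \<le> (2 * C) powr q * A1 powr q + (2 * C) powr q * (A1 powr (q - p) * \<epsilon> powr p) * M \<theta>"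
      using max by eventually_elim (rule pw)
  qed (use M in auto)
  also have "\<dots> = (2 * C) powr q * A1 powr q + (2 * C) powr q * (A1 powr (q - p) * \<epsilon> powr p) * (LINT \<theta>|circ. M \<theta>)"
    using M by simp
  finally show ?thesis by (simp add: C_def A1_def algebra_simps)
qed


section \<open>Compactness from the growth condition\<close>

definition little_growth :: "real \<Rightarrow> (complex \<Rightarrow> complex) \<Rightarrow> bool" where
  "little_growth \<alpha> g \<longleftrightarrow>
     (\<forall>\<epsilon>>0. \<exists>r\<in>{0..<1}. \<forall>z. r \<le> norm z \<and> norm z < 1 \<longrightarrow> norm (deriv g z) \<le> \<epsilon> * (1 - norm z) powr (\<alpha> - 1))"

text \<open>
  Everything that the sufficiency proof uses about a domain space X with quasi-norm N, with a single
  constant K.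
\<close>

definition radially_controlled ::
    "real \<Rightarrow> real \<Rightarrow> (complex \<Rightarrow> complex) set \<Rightarrow> ((complex \<Rightarrow> complex) \<Rightarrow> real) \<Rightarrow> real \<Rightarrow> bool" where
  "radially_controlled p \<beta> X N K \<longleftrightarrow>
     0 < K \<and> X \<subseteq> disc_analytic \<and>
     (\<forall>f\<in>X. \<forall>h\<in>X. (\<lambda>z. f z - h z) \<in> X \<and> N (\<lambda>z. f z - h z) \<le> K * (N f + N h)) \<and>
     (\<forall>f\<in>X. 0 \<le> N f \<and>
        (\<forall>z. norm z < 1 \<longrightarrow> norm (f z) \<le> K * N f * (1 - norm z) powr (- 1 / p)) \<and>
        (\<exists>M. radial_majorant p \<beta> f M \<and> (LINT \<theta>|circ. M \<theta>) \<le> K * N f powr p))"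

lemma radially_controlledD:
  assumes "radially_controlled p \<beta> X N K"
  shows "0 < K"
    and "f \<in> X \<Longrightarrow> f \<in> disc_analytic"
    and "f \<in> X \<Longrightarrow> h \<in> X \<Longrightarrow> (\<lambda>z. f z - h z) \<in> X"
    and "f \<in> X \<Longrightarrow> h \<in> X \<Longrightarrow> N (\<lambda>z. f z - h z) \<le> K * (N f + N h)"
    and "f \<in> X \<Longrightarrow> 0 \<le> N f"
    and "f \<in> X \<Longrightarrow> norm z < 1 \<Longrightarrow> norm (f z) \<le> K * N f * (1 - norm z) powr (- 1 / p)"
    and "f \<in> X \<Longrightarrow> \<exists>M. radial_majorant p \<beta> f M \<and> (LINT \<theta>|circ. M \<theta>) \<le> K * N f powr p"
  using assms unfolding radially_controlled_def by (blast, blast, blast, blast, blast, blast, blast)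

lemma one_le_powr_nonpos: "0 < x \<Longrightarrow> x \<le> 1 \<Longrightarrow> a \<le> 0 \<Longrightarrow> 1 \<le> (x::real) powr a"
  using powr_mono2'[of a x 1] by simp

lemma disc_compact_bound:
  assumes "f holomorphic_on ball 0 1" "r < 1"
  obtains B where "0 \<le> B" "\<And>z. norm z \<le> r \<Longrightarrow> norm (f z :: complex) \<le> B"
proof -
  have "compact (f ` cball 0 r)"
    using assms by (intro compact_continuous_image holomorphic_on_imp_continuous_on) (auto intro: holomorphic_on_subset)
  then obtain B where "\<forall>y\<in>f ` cball 0 r. norm y \<le> B" using compact_imp_bounded bounded_iff by metis
  then have "norm (f z) \<le> max 0 B" if "norm z \<le> r" for z using that by force
  then show ?thesis using that[of "max 0 B"] by simp
qed

lemma T_op_bound: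
  assumes p: "0 < p" "p < q" and \<alpha>: "\<alpha> = 1 / p - 1 / q" and \<alpha>1: "\<alpha> \<le> 1"
    and X: "radially_controlled p (\<alpha> / 2) X N K" and f: "f \<in> X" and N0: "N f \<le> N0"
    and g: "g holomorphic_on ball 0 1" and \<epsilon>: "0 < \<epsilon>"
    and fg: "\<And>z. norm z < 1 \<Longrightarrow> norm (f z * deriv g z) \<le> (\<epsilon> + \<epsilon> * norm (f z)) * (1 - norm z) powr (\<alpha> - 1)"
  defines "D \<equiv> 2 * (q + 4 / \<alpha>) * ((1 + K * N0) powr q + (1 + K * N0) powr (q - p) * (K * N0 powr p)) powr (1 / q)"
  shows "T_op g f \<in> hardy_space q" "hardy_norm q (T_op g f) \<le> \<epsilon> * D"
proof -
  have q: "0 < q" using p by simp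
  have \<alpha>0: "0 < \<alpha>" unfolding \<alpha> using p by (simp add: field_simps)
  note K = radially_controlledD(1)[OF X] and fd = radially_controlledD(2)[OF X f]
    and Nf = radially_controlledD(5)[OF X f] and growth = radially_controlledD(6)[OF X f]
  obtain M where M: "radial_majorant p (\<alpha> / 2) f M" and MN: "(LINT \<theta>|circ. M \<theta>) \<le> K * N f powr p"
    using radially_controlledD(7)[OF X f] by blast
  note hf = disc_analyticD[OF fd]
  have N0': "0 \<le> N0" using Nf N0 by simp
  define S where "S = 1 + K * N0"
  have S: "1 + K * N f \<le> S" "1 \<le> 1 + K * N f" using K N0 Nf by (auto simp: S_def)
  define E where "E = S powr q + S powr (q - p) * (K * N0 powr p)"
  have E0: "0 \<le> E" using K by (simp add: E_def)
  have C0: "0 < 2 * (q + 4 / \<alpha>)" using q \<alpha>0 by (simp add: add_pos_pos)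
  have D: "D = 2 * (q + 4 / \<alpha>) * E powr (1 / q)" by (simp add: D_def E_def S_def)
  have D0: "0 \<le> \<epsilon> * D" using \<epsilon> C0 by (simp add: D)
  have B: "pmean q (T_op g f) r \<le> (\<epsilon> * D) powr q" if r: "0 \<le> r" "r < 1" for r
  proof -
    have "pmean q (T_op g f) r \<le> (2 * (q + 4 / \<alpha>)) powr q * ((\<epsilon> + \<epsilon> * (K * N f)) powr q
        + (\<epsilon> + \<epsilon> * (K * N f)) powr (q - p) * \<epsilon> powr p * (LINT \<theta>|circ. M \<theta>))"
      by (rule T_op_pmean_le[OF p \<alpha> \<alpha>1 hf g \<epsilon> _ _ fg growth M r]) (use \<epsilon> K Nf in auto)
    also have "\<dots> \<le> (2 * (q + 4 / \<alpha>)) powr q * (\<epsilon> powr q * E)"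
    proof (rule mult_left_mono)
      have e: "\<epsilon> + \<epsilon> * (K * N f) = \<epsilon> * (1 + K * N f)" by (simp add: distrib_left)
      have 1: "(\<epsilon> + \<epsilon> * (K * N f)) powr q \<le> \<epsilon> powr q * S powr q"
        unfolding e using S \<epsilon> q by (simp add: powr_mult powr_mono2)
      have 2: "(\<epsilon> + \<epsilon> * (K * N f)) powr (q - p) \<le> \<epsilon> powr (q - p) * S powr (q - p)"
        unfolding e using S \<epsilon> p by (simp add: powr_mult powr_mono2)
      have 3: "(LINT \<theta>|circ. M \<theta>) \<le> K * N0 powr p"
      proof -
        have "N f powr p \<le> N0 powr p" using Nf N0 p by (intro powr_mono2) auto
        from mult_left_mono[OF this less_imp_le[OF K]] MN show ?thesis by linarith
      qed
      have L0: "0 \<le> (LINT \<theta>|circ. M \<theta>)" using M by (intro integral_nonneg_AE) (auto simp: radial_majorant_def)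
      have "(\<epsilon> + \<epsilon> * (K * N f)) powr (q - p) * \<epsilon> powr p * (LINT \<theta>|circ. M \<theta>)
          \<le> (\<epsilon> powr (q - p) * S powr (q - p)) * \<epsilon> powr p * (K * N0 powr p)"
        using L0 by (intro mult_mono 2 3) auto
      also have "\<dots> = \<epsilon> powr q * (S powr (q - p) * (K * N0 powr p))"
        by (simp add: mult_ac powr_add[symmetric])
      finally show "(\<epsilon> + \<epsilon> * (K * N f)) powr q + (\<epsilon> + \<epsilon> * (K * N f)) powr (q - p) * \<epsilon> powr p * (LINT \<theta>|circ. M \<theta>) \<le> \<epsilon> powr q * E"
        using 1 by (simp add: E_def distrib_left)
    qed simp
    also have "\<dots> = (\<epsilon> * D) powr q"
      using C0 \<epsilon> E0 q by (simp add: D powr_mult powr_powr)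
    finally show ?thesis .
  qed
  note * = hardy_norm_le[OF T_op_disc_analytic[OF hf g] q B D0]
  show "T_op g f \<in> hardy_space q" by (rule *(1))
  show "hardy_norm q (T_op g f) \<le> \<epsilon> * D" by (rule *(2))
qed

text \<open>
  A bounded sequence in X has a locally uniformly convergent subsequence by Montel's theorem. The differences
  of its members are bounded in X and small on compact discs, so their images are small in H^q: the
  images form a Cauchy sequence. Their pointwise limit is the image of the limit function, and
  hardy_limit shows that it lies in H^q and is the limit in norm.
\<close>

lemma compact_operator_if_little_growth:
  assumes p: "0 < p" "p < q" and \<alpha>: "\<alpha> = 1 / p - 1 / q" and \<alpha>1: "\<alpha> \<le> 1"
    and X: "radially_controlled p (\<alpha> / 2) X N K"
    and g: "g holomorphic_on ball 0 1" and lg: "little_growth \<alpha> g"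
  shows "compact_operator X N (hardy_space q) (hardy_dist q) (T_op g)"
proof -
  have q: "0 < q" using p by simp
  interpret H: Metric_space "hardy_space q" "hardy_dist q" by (rule Metric_space_hardy[OF q])
  note K = radially_controlledD(1)[OF X] and XD = disc_analyticD[OF radially_controlledD(2)[OF X]]
    and Nf = radially_controlledD(5)[OF X] and Xdiff = radially_controlledD(3)[OF X]
    and Ndiff = radially_controlledD(4)[OF X] and growth = radially_controlledD(6)[OF X]
  have g': "deriv g holomorphic_on ball 0 1" using g by (intro holomorphic_deriv) auto
  have w1: "1 \<le> (1 - norm z) powr (\<alpha> - 1)" if "norm z < 1" for z :: complex
    using that \<alpha>1 by (intro one_le_powr_nonpos) auto
  have fg: "norm (f z * deriv g z) \<le> (\<epsilon> + \<epsilon> * norm (f z)) * (1 - norm z) powr (\<alpha> - 1)"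
    if "0 < \<epsilon>" "norm z < 1" "norm (f z * deriv g z) \<le> \<epsilon> \<or> norm (deriv g z) \<le> \<epsilon> * (1 - norm z) powr (\<alpha> - 1)"
    for \<epsilon> z and f :: "complex \<Rightarrow> complex"
    using that(3)
  proof
    assume "norm (f z * deriv g z) \<le> \<epsilon>"
    also have "\<epsilon> \<le> (\<epsilon> + \<epsilon> * norm (f z)) * 1" using that by simp
    also have "\<dots> \<le> (\<epsilon> + \<epsilon> * norm (f z)) * (1 - norm z) powr (\<alpha> - 1)"
      using that w1 by (intro mult_left_mono) auto
    finally show ?thesis .
  next
    assume "norm (deriv g z) \<le> \<epsilon> * (1 - norm z) powr (\<alpha> - 1)"
    from mult_left_mono[OF this norm_ge_zero[of "f z"]]
    have "norm (f z * deriv g z) \<le> (\<epsilon> * norm (f z)) * (1 - norm z) powr (\<alpha> - 1)"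
      by (simp add: norm_mult mult_ac)
    also have "\<dots> \<le> (\<epsilon> + \<epsilon> * norm (f z)) * (1 - norm z) powr (\<alpha> - 1)"
      using that by (intro mult_right_mono) auto
    finally show ?thesis .
  qed
  have mem: "T_op g f \<in> hardy_space q" if f: "f \<in> X" for f
  proof -
    obtain r where r: "r < 1" "\<And>z. r \<le> norm z \<Longrightarrow> norm z < 1 \<Longrightarrow> norm (deriv g z) \<le> 1 * (1 - norm z) powr (\<alpha> - 1)"
      using lg[unfolded little_growth_def, rule_format, of 1] by auto
    obtain E where E: "0 \<le> E" "\<And>z. norm z \<le> r \<Longrightarrow> norm (f z * deriv g z) \<le> E"
      using disc_compact_bound[OF holomorphic_on_mult[OF XD[OF f] g'] r(1)] by metis
    show ?thesis
    proof (rule T_op_bound(1)[OF p \<alpha> \<alpha>1 X f order_refl g, of "1 + E"])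
      fix z :: complex assume z: "norm z < 1"
      show "norm (f z * deriv g z) \<le> (1 + E + (1 + E) * norm (f z)) * (1 - norm z) powr (\<alpha> - 1)"
      proof (rule fg[OF _ z])
        show "norm (f z * deriv g z) \<le> 1 + E \<or> norm (deriv g z) \<le> (1 + E) * (1 - norm z) powr (\<alpha> - 1)"
        proof (cases "norm z \<le> r")
          case True
          then show ?thesis using E(2)[of z] by auto
        next
          case False
          have "1 * (1 - norm z) powr (\<alpha> - 1) \<le> (1 + E) * (1 - norm z) powr (\<alpha> - 1)"
            using E by (intro mult_right_mono) auto
          from order_trans[OF r(2)[of z] this] show ?thesis using False z by auto
        qed
      qed (use E in auto)
    qed (use E in auto)
  qed
  \<comment> \<open>smallness on a compact disc forces a small image, uniformly on bounded subsets\<close>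
  have small: "\<exists>r<1. \<exists>\<eta>>0. \<forall>f\<in>X. N f \<le> N0 \<longrightarrow> (\<forall>z. norm z \<le> r \<longrightarrow> norm (f z) \<le> \<eta>) \<longrightarrow> hardy_norm q (T_op g f) \<le> e"
    if e: "0 < e" and N0: "0 \<le> N0" for e N0
  proof -
    define D where "D = 2 * (q + 4 / \<alpha>) * ((1 + K * N0) powr q + (1 + K * N0) powr (q - p) * (K * N0 powr p)) powr (1 / q)"
    have \<alpha>0: "0 < \<alpha>" unfolding \<alpha> using p by (simp add: field_simps)
    have D0: "0 \<le> D" using q \<alpha>0 by (simp add: D_def)
    define \<epsilon> where "\<epsilon> = e / (D + 1)"
    have \<epsilon>: "0 < \<epsilon>" "\<epsilon> * D \<le> e" using e D0 by (auto simp: \<epsilon>_def field_simps)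
    obtain r where r: "r < 1" "\<And>z. r \<le> norm z \<Longrightarrow> norm z < 1 \<Longrightarrow> norm (deriv g z) \<le> \<epsilon> * (1 - norm z) powr (\<alpha> - 1)"
      using lg[unfolded little_growth_def, rule_format, OF \<epsilon>(1)] by auto
    obtain G where G: "0 \<le> G" "\<And>z. norm z \<le> r \<Longrightarrow> norm (deriv g z) \<le> G"
      using disc_compact_bound[OF g' r(1)] by metis
    have "hardy_norm q (T_op g f) \<le> e"
      if f: "f \<in> X" "N f \<le> N0" and le: "\<And>z. norm z \<le> r \<Longrightarrow> norm (f z) \<le> \<epsilon> / (G + 1)" for f
    proof -
      have "hardy_norm q (T_op g f) \<le> \<epsilon> * D"
        unfolding D_def
      proof (rule T_op_bound(2)[OF p \<alpha> \<alpha>1 X f g \<epsilon>(1)])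
        fix z :: complex assume z: "norm z < 1"
        show "norm (f z * deriv g z) \<le> (\<epsilon> + \<epsilon> * norm (f z)) * (1 - norm z) powr (\<alpha> - 1)"
        proof (rule fg[OF \<epsilon>(1) z])
          show "norm (f z * deriv g z) \<le> \<epsilon> \<or> norm (deriv g z) \<le> \<epsilon> * (1 - norm z) powr (\<alpha> - 1)"
          proof (cases "norm z \<le> r")
            case True
            have "norm (f z * deriv g z) \<le> \<epsilon> / (G + 1) * G"
              unfolding norm_mult using le[OF True] G(2)[OF True] G(1) \<epsilon> by (intro mult_mono) auto
            also have "\<dots> \<le> \<epsilon>" using G(1) \<epsilon> by (simp add: field_simps)
            finally show ?thesis by simp
          next
            case False
            then show ?thesis using r(2)[of z] z by auto
          qed
        qed
      qed
      then show ?thesis using \<epsilon>(2) by linarith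
    qed
    then show ?thesis using r(1) G(1) \<epsilon>(1) by (intro exI[of _ r] exI[of _ "\<epsilon> / (G + 1)"] conjI) auto
  qed
  show ?thesis
    unfolding compact_operator_def
  proof (intro allI impI)
    fix B assume "B \<subseteq> X \<and> (\<exists>C. \<forall>f\<in>B. N f \<le> C)"
    then obtain C0 where BX: "B \<subseteq> X" and C0: "\<And>f. f \<in> B \<Longrightarrow> N f \<le> C0" by blast
    define C where "C = max 0 C0"
    have C: "0 \<le> C" "\<And>f. f \<in> B \<Longrightarrow> N f \<le> C" using C0 by (auto simp: C_def le_max_iff_disj)
    have img: "T_op g ` B \<subseteq> hardy_space q" using mem BX by auto
    have seq: "\<exists>l r. l \<in> hardy_space q \<and> strict_mono r \<and> limitin H.mtopology (\<sigma> \<circ> r) l sequentially"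
      if \<sigma>: "range \<sigma> \<subseteq> T_op g ` B" for \<sigma> :: "nat \<Rightarrow> complex \<Rightarrow> complex"
    proof -
      have "\<forall>n. \<exists>f. f \<in> B \<and> \<sigma> n = T_op g f" using \<sigma> by (auto simp: image_def)
      then obtain F where F: "\<And>n. F n \<in> B" "\<And>n. \<sigma> n = T_op g (F n)" by metis
      have FX: "F n \<in> X" for n using F BX by blast
      have bounded: "\<exists>b. \<forall>h\<in>range F. \<forall>z\<in>L. norm (h z) \<le> b" if L: "compact L" "L \<subseteq> ball 0 1" for L
      proof (cases "L = {}")
        case False
        obtain w where w: "w \<in> L" "\<And>z. z \<in> L \<Longrightarrow> norm z \<le> norm w"
          using continuous_attains_sup[OF L(1) False continuous_on_norm_id] by auto
        have w1: "norm w < 1" using w L by auto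
        show ?thesis
        proof (intro exI ballI)
          fix h z assume h: "h \<in> range F" and z: "z \<in> L"
          have zw: "norm z \<le> norm w" using w z by auto
          obtain n where n: "h = F n" using h by auto
          have "norm (h z) \<le> K * N h * (1 - norm z) powr (- 1 / p)"
            using growth[of h z] FX n zw w1 by auto
          also have "\<dots> \<le> K * C * (1 - norm w) powr (- 1 / p)"
            using K C F(1) n zw w1 p Nf[OF FX, of n] by (intro mult_mono powr_mono2') auto
          finally show "norm (h z) \<le> K * C * (1 - norm w) powr (- 1 / p)" .
        qed
      qed auto
      obtain f r where f: "f holomorphic_on ball 0 1" and r: "strict_mono (r :: nat \<Rightarrow> nat)"
        and unif: "\<And>L. compact L \<Longrightarrow> L \<subseteq> ball 0 1 \<Longrightarrow> uniform_limit L (F \<circ> r) f sequentially"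
      proof (rule Montel[of "ball 0 1" "range F" F])
        show "h holomorphic_on ball 0 1" if "h \<in> range F" for h using that XD[OF FX] by auto
        show "\<exists>B. \<forall>h\<in>range F. \<forall>z\<in>L. norm (h z) \<le> B" if "compact L" "L \<subseteq> ball 0 1" for L
          using that by (rule bounded)
      qed (use that in auto)
      define u where "u n = T_op g (F (r n))" for n
      have uH: "u n \<in> hardy_space q" for n unfolding u_def by (intro mem FX)
      have unif': "\<exists>J. \<forall>n\<ge>J. \<forall>z. norm z \<le> \<rho> \<longrightarrow> norm (F (r n) z - f z) < e" if "\<rho> < 1" "0 < e" for \<rho> e
      proof -
        have "uniform_limit (cball 0 \<rho>) (F \<circ> r) f sequentially" using that by (intro unif) auto
        from uniform_limitD[OF this that(2)]
        obtain J where "\<forall>n\<ge>J. \<forall>z\<in>cball 0 \<rho>. dist ((F \<circ> r) n z) (f z) < e"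
          unfolding eventually_sequentially by blast
        then show ?thesis by (intro exI[of _ J]) (auto simp: dist_norm)
      qed
      have lim: "(\<lambda>n. u n z) \<longlonglongrightarrow> T_op g f z" if z: "norm z < 1" for z
      proof (rule LIMSEQ_I)
        fix e :: real assume e: "0 < e"
        obtain G where G: "0 \<le> G" "\<And>w. norm w \<le> norm z \<Longrightarrow> norm (deriv g w) \<le> G"
          using disc_compact_bound[OF g' z] by metis
        obtain J where J: "\<And>n w. J \<le> n \<Longrightarrow> norm w \<le> norm z \<Longrightarrow> norm (F (r n) w - f w) < e / (G + 1)"
          using unif'[OF z, of "e / (G + 1)"] e G by (auto simp: divide_pos_pos)
        show "\<exists>J. \<forall>n\<ge>J. norm (u n z - T_op g f z) < e"
        proof (intro exI allI impI)
          fix n assume n: "J \<le> n"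
          have hn: "(\<lambda>z. F (r n) z - f z) holomorphic_on ball 0 1" by (intro holomorphic_intros XD FX f)
          have "norm (T_op g (\<lambda>z. F (r n) z - f z) z) \<le> e / (G + 1) * G"
            by (rule T_op_norm_le[OF hn g z less_imp_le[OF J[OF n]] G(2)])
          also have "\<dots> < e" using e G by (simp add: field_simps)
          finally show "norm (u n z - T_op g f z) < e"
            using T_op_diff[OF XD[OF FX] f g, of "r n"] by (simp add: u_def)
        qed
      qed
      have cauchy: "\<exists>J. \<forall>j\<ge>J. \<forall>k\<ge>J. hardy_norm q (\<lambda>z. u j z - u k z) \<le> e" if e: "0 < e" for e
      proof -
        obtain \<rho> \<eta> where \<rho>: "\<rho> < 1" "0 < \<eta>" and sm: "\<And>f. f \<in> X \<Longrightarrow> N f \<le> K * (C + C) \<Longrightarrow>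
            (\<And>z. norm z \<le> \<rho> \<Longrightarrow> norm (f z) \<le> \<eta>) \<Longrightarrow> hardy_norm q (T_op g f) \<le> e"
          using small[OF e, of "K * (C + C)"] K C by auto
        obtain J where J: "\<And>n z. J \<le> n \<Longrightarrow> norm z \<le> \<rho> \<Longrightarrow> norm (F (r n) z - f z) < \<eta> / 2"
          using unif'[OF \<rho>(1), of "\<eta> / 2"] \<rho>(2) by auto
        have "hardy_norm q (\<lambda>z. u j z - u k z) \<le> e" if jk: "J \<le> j" "J \<le> k" for j k
        proof -
          have "hardy_norm q (T_op g (\<lambda>z. F (r j) z - F (r k) z)) \<le> e"
          proof (rule sm[OF Xdiff[OF FX FX]])
            have "N (\<lambda>z. F (r j) z - F (r k) z) \<le> K * (N (F (r j)) + N (F (r k)))" by (rule Ndiff[OF FX FX])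
            also have "\<dots> \<le> K * (C + C)" using K by (intro mult_left_mono add_mono C F) auto
            finally show "N (\<lambda>z. F (r j) z - F (r k) z) \<le> K * (C + C)" .
            fix z :: complex assume z: "norm z \<le> \<rho>"
            show "norm (F (r j) z - F (r k) z) \<le> \<eta>"
              using J[OF jk(1) z] J[OF jk(2) z] norm_triangle_ineq4[of "F (r j) z - f z" "F (r k) z - f z"] by simp
          qed
          then show ?thesis by (simp add: u_def T_op_diff[OF XD[OF FX] XD[OF FX] g])
        qed
        then show ?thesis by blast
      qed
      note hl = hardy_limit[OF uH q T_op_disc_analytic[OF f g] lim cauchy]
      have "limitin H.mtopology u (T_op g f) sequentially"
        unfolding H.limitin_metric_dist_null
      proof (intro conjI)
        show "T_op g f \<in> hardy_space q" by (rule hl(1))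
        show "eventually (\<lambda>n. u n \<in> hardy_space q) sequentially" using uH by simp
        have "(\<lambda>n. hardy_norm q (\<lambda>z. u n z - T_op g f z) powr min 1 q) \<longlonglongrightarrow> 0 powr min 1 q"
          using q by (intro tendsto_powr' hl(2) tendsto_const)
            (auto intro!: always_eventually hardy_norm_nonneg hardy_norm_diff_quasi(1) uH hl(1))
        then show "((\<lambda>n. hardy_dist q (u n) (T_op g f)) \<longlongrightarrow> 0) sequentially"
          using q by (simp add: hardy_dist_def)
      qed
      moreover have "\<sigma> \<circ> r = u" by (simp add: fun_eq_iff u_def F(2))
      ultimately show ?thesis using hl(1) r by metis
    qed
    have "compactin H.mtopology (H.mtopology closure_of (T_op g ` B))"
      unfolding H.compact_closure_of_eq_Bolzano_Weierstrass
      using H.Bolzano_Weierstrass_property[OF img img] seq by blast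
    then show "T_op g ` B \<subseteq> hardy_space q \<and> compactin H.mtopology (H.mtopology closure_of (T_op g ` B))"
      using img by blast
  qed
qed


section \<open>Area means\<close>

text \<open>
  Lebesgue measure on the complex plane inherits its invariance under rotations from real^2.
\<close>

definition plane_complex :: "real^2 \<Rightarrow> complex" where "plane_complex v = Complex (v $ 1) (v $ 2)"

lemma plane_complex_measurable [measurable]: "plane_complex \<in> borel_measurable borel"
  unfolding plane_complex_def[abs_def]
  by (intro borel_measurable_continuous_onI) (auto intro!: continuous_intros simp: Complex_eq)

lemma Basis_real_2: "(Basis :: (real^2) set) = {axis 1 1, axis 2 1}"
  by (auto simp: Basis_vec_def UNIV_2)

lemma vimage_plane_complex_box:
  "plane_complex -` box l u = box (vector [Re l, Im l]) (vector [Re u, Im u])"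
  by (auto simp: plane_complex_def box_def Basis_complex_def Basis_real_2 inner_complex_def inner_axis)

lemma distr_plane_complex: "distr lborel borel plane_complex = lborel"
proof (rule lborel_eqI[symmetric])
  fix l u :: complex assume le: "\<And>b. b \<in> Basis \<Longrightarrow> l \<bullet> b \<le> u \<bullet> b"
  have le': "Re l \<le> Re u" "Im l \<le> Im u" using le[of 1] le[of \<i>] by (auto simp: Basis_complex_def inner_complex_def)
  have ne: "axis 1 1 \<noteq> (axis 2 1 :: real^2)" by (simp add: axis_eq_axis)
  have "emeasure (distr lborel borel plane_complex) (box l u) = emeasure lborel (box (vector [Re l, Im l]) (vector [Re u, Im u] :: real^2))"
    by (simp add: emeasure_distr vimage_plane_complex_box)
  also have "\<dots> = ennreal (\<Prod>b\<in>Basis. ((vector [Re u, Im u] :: real^2) - vector [Re l, Im l]) \<bullet> b)"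
    using le' by (intro emeasure_lborel_box) (auto simp: Basis_real_2 inner_axis)
  also have "\<dots> = ennreal (\<Prod>b\<in>Basis. (u - l) \<bullet> b)"
    using ne by (simp add: Basis_real_2 Basis_complex_def inner_axis inner_complex_def)
  finally show "emeasure (distr lborel borel plane_complex) (box l u) = ennreal (\<Prod>b\<in>Basis. (u - l) \<bullet> b)" .
qed simp

lemma norm_plane_complex: "norm (plane_complex v) = norm v"
  by (simp add: plane_complex_def norm_vec_def L2_set_def UNIV_2 complex_norm)

lemma lborel_rotation:
  fixes c :: complex
  assumes c: "norm c = 1"
  shows "distr lborel borel (\<lambda>z. c * z) = lborel"
proof (rule lborel_eqI[symmetric])
  fix l u :: complex assume le: "\<And>b. b \<in> Basis \<Longrightarrow> l \<bullet> b \<le> u \<bullet> b"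
  define T :: "complex \<Rightarrow> real^2" where "T z = vector [Re z, Im z]" for z
  have ST: "plane_complex (T z) = z" for z by (simp add: plane_complex_def T_def)
  have TS: "T (plane_complex v) = v" for v
    by (simp add: plane_complex_def T_def vec_eq_iff forall_2)
  have nT: "norm (T z) = norm z" for z using norm_plane_complex[of "T z"] by (simp add: ST)
  define R where "R v = T (cnj c * plane_complex v)" for v
  have "linear R"
    by (rule linearI) (simp_all add: R_def T_def plane_complex_def vec_eq_iff forall_2 algebra_simps)
  then have R: "orthogonal_transformation R"
    unfolding orthogonal_transformation using c by (simp add: R_def nT norm_mult norm_plane_complex)
  define A where "A = plane_complex -` box l u"
  have A: "A \<in> lmeasurable" unfolding A_def vimage_plane_complex_box by simp
  have "emeasure lborel A = emeasure (distr lborel borel plane_complex) (box l u)"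
    by (simp add: emeasure_distr A_def)
  then have A': "emeasure lborel A = emeasure lborel (box l u)" by (simp add: distr_plane_complex)
  have cc: "cnj c * c = 1" using c complex_norm_square[of c] by (simp add: mult.commute)
  have eq: "plane_complex -` ((\<lambda>z. c * z) -` box l u) = R ` A"
  proof (intro equalityI subsetI)
    fix v assume "v \<in> plane_complex -` ((\<lambda>z. c * z) -` box l u)"
    then have v: "c * plane_complex v \<in> box l u" by simp
    have "R (T (c * plane_complex v)) = v" by (simp add: R_def ST TS mult.assoc[symmetric] cc)
    moreover have "T (c * plane_complex v) \<in> A" using v by (simp add: A_def ST)
    ultimately show "v \<in> R ` A" by (metis imageI)
  next
    fix v assume "v \<in> R ` A"
    then obtain w where w: "w \<in> A" "v = R w" by blast
    have "c * plane_complex v = (cnj c * c) * plane_complex w" by (simp add: w(2) R_def ST)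
    then show "v \<in> plane_complex -` ((\<lambda>z. c * z) -` box l u)"
      using w(1) by (simp add: cc A_def)
  qed
  have m: "(\<lambda>z. c * z) -` box l u \<in> sets borel"
    using measurable_sets[of "\<lambda>z. c * z" borel borel "box l u"] by simp
  have "emeasure (distr lborel borel (\<lambda>z. c * z)) (box l u) = emeasure lborel ((\<lambda>z. c * z) -` box l u)"
    by (simp add: emeasure_distr)
  also have "\<dots> = emeasure (distr lborel borel plane_complex) ((\<lambda>z. c * z) -` box l u)"
    by (simp add: distr_plane_complex)
  also have "\<dots> = emeasure lborel (R ` A)"
    using m by (simp add: emeasure_distr eq)
  also have "\<dots> = emeasure lebesgue (R ` A)"
  proof -
    have "R ` A \<in> sets borel" unfolding eq[symmetric]
      using measurable_sets[OF plane_complex_measurable m] by simp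
    then show ?thesis by simp
  qed
  also have "\<dots> = ennreal (measure lebesgue A)"
    using measurable_orthogonal_image[OF R A] measure_orthogonal_image[OF R A]
    by (simp add: emeasure_eq_measure2)
  also have "\<dots> = emeasure lebesgue A" using A by (simp add: emeasure_eq_measure2)
  also have "\<dots> = emeasure lborel A" unfolding A_def vimage_plane_complex_box by simp
  also have "\<dots> = ennreal (\<Prod>b\<in>Basis. (u - l) \<bullet> b)" unfolding A' by (rule emeasure_lborel_box[OF le])
  finally show "emeasure (distr lborel borel (\<lambda>z. c * z)) (box l u) = ennreal (\<Prod>b\<in>Basis. (u - l) \<bullet> b)" .
qed simp


lemma nn_integral_rotation:
  fixes c :: complex
  assumes "norm c = 1" and [measurable]: "F \<in> borel_measurable borel"
  shows "(\<integral>\<^sup>+w. F (c * w) \<partial>lborel) = (\<integral>\<^sup>+w. F w \<partial>lborel)"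
proof -
  have "(\<integral>\<^sup>+w. F w \<partial>lborel) = (\<integral>\<^sup>+w. F w \<partial>distr lborel borel (\<lambda>z. c * z))"
    by (simp add: lborel_rotation[OF assms(1)])
  also have "\<dots> = (\<integral>\<^sup>+w. F (c * w) \<partial>lborel)" by (rule nn_integral_distr) auto
  finally show ?thesis ..
qed

text \<open>
  Averaging over rotations replaces polar coordinates: an integral over the plane is controlled by the means
  of the integrand over the circles centred at the origin.
\<close>

lemma nn_integral_rotation_mean:
  fixes F :: "complex \<Rightarrow> ennreal"
  assumes [measurable]: "F \<in> borel_measurable borel"
  shows "(\<integral>\<^sup>+w. F w \<partial>lborel) = (\<integral>\<^sup>+w. (\<integral>\<^sup>+\<theta>. F (cis \<theta> * w) \<partial>circ) \<partial>lborel)"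
proof -
  interpret P: pair_sigma_finite circ "lborel :: complex measure" ..
  have "(\<integral>\<^sup>+w. F w \<partial>lborel) = (\<integral>\<^sup>+\<theta>. (\<integral>\<^sup>+w. F w \<partial>lborel) \<partial>circ)"
    by (simp add: emeasure_circ_UNIV)
  also have "\<dots> = (\<integral>\<^sup>+\<theta>. (\<integral>\<^sup>+w. F (cis \<theta> * w) \<partial>lborel) \<partial>circ)"
    by (intro nn_integral_cong nn_integral_rotation[symmetric]) auto
  also have "\<dots> = (\<integral>\<^sup>+w. (\<integral>\<^sup>+\<theta>. F (cis \<theta> * w) \<partial>circ) \<partial>lborel)"
    by (rule P.Fubini'[symmetric]) measurable
  finally show ?thesis .
qed

lemma circle_sub_mean:
  fixes h :: "complex \<Rightarrow> complex" and z w :: complex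
  assumes h: "h holomorphic_on ball 0 1" and w: "norm w < r" "norm z + r \<le> 1" and p: "0 < p"
  shows "ennreal (norm (h z) powr p) \<le> (\<integral>\<^sup>+\<theta>. ennreal (norm (h (z + cis \<theta> * w)) powr p) \<partial>circ)"
proof -
  define R where "R = (if w = 0 then 2 else r / norm w)"
  have r: "0 < r" using w(1) norm_ge_zero[of w] by linarith
  have R: "1 < R" using w r by (simp add: R_def)
  have sub: "norm (z + x * w) < 1" if "norm x < R" for x
  proof -
    have "norm (x * w) < r"
    proof (cases "w = 0")
      case False
      then show ?thesis using that by (simp add: R_def norm_mult field_simps)
    qed (use r in simp)
    then show ?thesis using norm_triangle_ineq[of z "x * w"] w(2) by linarith
  qed
  have H: "(\<lambda>x. h (z + x * w)) holomorphic_on ball 0 R"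
    by (rule holomorphic_on_compose_gen[OF _ h, of "\<lambda>x. z + x * w", unfolded o_def])
       (use sub in \<open>auto intro!: holomorphic_intros\<close>)
  have cont: "continuous_on (sphere 0 1) (\<lambda>x. h (z + x * w))"
    using R by (intro holomorphic_on_imp_continuous_on holomorphic_on_subset[OF H]) auto
  obtain B where B: "\<And>\<theta>. norm (h (z + cis \<theta> * w)) \<le> B" using continuous_on_bounded_circle[OF cont] by blast
  have i: "integrable circ (\<lambda>\<theta>. norm (h (z + cis \<theta> * w)) powr p)"
  proof (rule integrable_circ_bounded[OF circ_powr_measurable[OF cont]])
    show "norm (norm (h (z + cis \<theta> * w)) powr p) \<le> B powr p" for \<theta>
      using B[of \<theta>] p by (auto intro!: powr_mono2)
  qed
  have "norm (h z) powr p \<le> (LINT \<theta>|circ. norm (h (z + cis \<theta> * w)) powr p)"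
    using powr_sub_mean[OF H R p, of 0] by (simp add: poisson_def)
  then show ?thesis by (subst nn_integral_eq_integral[OF i]) (auto intro: ennreal_leI)
qed

lemma area_sub_mean:
  fixes h :: "complex \<Rightarrow> complex" and z :: complex
  assumes h: "h holomorphic_on ball 0 1" and [measurable]: "h \<in> borel_measurable borel"
    and r: "norm z + r \<le> 1" and p: "0 < p"
  shows "ennreal (norm (h z) powr p) * emeasure lborel (ball z r)
    \<le> (\<integral>\<^sup>+w. indicator (ball z r) w * ennreal (norm (h w) powr p) \<partial>lborel)"
proof -
  define G where "G w = indicator (ball z r) w * ennreal (norm (h w) powr p)" for w
  have [measurable]: "G \<in> borel_measurable borel"
    unfolding G_def by (intro borel_measurable_times_ennreal borel_measurable_indicator) measurable
  have "emeasure lborel (ball z r) = emeasure lborel (ball (0 :: complex) r)"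
    by (cases "0 \<le> r") (simp_all add: emeasure_ball ball_empty)
  then have "ennreal (norm (h z) powr p) * emeasure lborel (ball z r) = (\<integral>\<^sup>+w. ennreal (norm (h z) powr p) * indicator (ball (0 :: complex) r) w \<partial>lborel)"
    by (simp add: nn_integral_cmult_indicator)
  also have "\<dots> \<le> (\<integral>\<^sup>+w. (\<integral>\<^sup>+\<theta>. G (z + cis \<theta> * w) \<partial>circ) \<partial>lborel)"
  proof (rule nn_integral_mono)
    fix w :: complex
    show "ennreal (norm (h z) powr p) * indicator (ball 0 r) w \<le> (\<integral>\<^sup>+\<theta>. G (z + cis \<theta> * w) \<partial>circ)"
    proof (cases "norm w < r")
      case True
      have "G (z + cis \<theta> * w) = ennreal (norm (h (z + cis \<theta> * w)) powr p)" for \<theta>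
        using True by (simp add: G_def dist_norm norm_mult)
      then show ?thesis using circle_sub_mean[OF h True r p] True by simp
    qed simp
  qed
  also have "\<dots> = (\<integral>\<^sup>+w. G (z + w) \<partial>lborel)"
    by (rule nn_integral_rotation_mean[symmetric]) measurable
  also have "\<dots> = (\<integral>\<^sup>+w. G w \<partial>distr lborel borel ((+) z))"
    by (rule nn_integral_distr[symmetric]) auto
  also have "\<dots> = (\<integral>\<^sup>+w. G w \<partial>lborel)" by (simp add: lborel_distr_plus)
  finally show ?thesis by (simp add: G_def)
qed

text \<open>
  The form in which pointwise bounds on |f|^p are converted into bounds on |f|.
\<close>

lemma powr_mult_bound_root:
  fixes x p :: real
  assumes "x powr p \<le> c * N powr p * y powr b" "0 < p" "0 \<le> x" "0 \<le> c" "0 \<le> N" "0 \<le> y"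
  shows "x \<le> c powr (1 / p) * N * y powr (b / p)"
proof -
  have "x = (x powr p) powr (1 / p)" using assms by (simp add: powr_powr)
  also have "\<dots> \<le> (c * N powr p * y powr b) powr (1 / p)" using assms by (intro powr_mono2) auto
  also have "\<dots> = c powr (1 / p) * N * y powr (b / p)" using assms by (simp add: powr_mult powr_powr)
  finally show ?thesis .
qed

text \<open>
  The radial maximal function bounds |f(t \<zeta>)|^p outright, and the factor ((1 - s) / (1 - t))^\<beta> is at
  least one.
\<close>

lemma radially_controlled_hardy:
  assumes p: "0 < p" and b: "0 \<le> \<beta>"
  shows "\<exists>K. radially_controlled p \<beta> (hardy_space p) (hardy_norm p) K"
proof -
  define K where "K = 2 * 2 powr (1 / p) + 4 powr (1 / p) + 256"
  have K: "0 < K" "2 * 2 powr (1 / p) \<le> K" "4 powr (1 / p) \<le> K" "256 \<le> K"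
    by (auto simp: K_def intro: add_nonneg_pos)
  have "radially_controlled p \<beta> (hardy_space p) (hardy_norm p) K"
    unfolding radially_controlled_def
  proof (intro conjI ballI)
    show "0 < K" by (rule K)
    show "hardy_space p \<subseteq> disc_analytic" using hardy_space_disc by blast
  next
    fix f h assume f: "f \<in> hardy_space p" and h: "h \<in> hardy_space p"
    note nn = hardy_norm_nonneg[OF f p] hardy_norm_nonneg[OF h p]
    show "(\<lambda>z. f z - h z) \<in> hardy_space p" by (rule hardy_norm_diff_quasi(1)[OF f h p])
    have "hardy_norm p (\<lambda>z. f z - h z) \<le> 2 * 2 powr (1 / p) * (hardy_norm p f + hardy_norm p h)"
      by (rule hardy_norm_diff_quasi(2)[OF f h p])
    also have "\<dots> \<le> K * (hardy_norm p f + hardy_norm p h)" using nn K by (intro mult_right_mono) auto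
    finally show "hardy_norm p (\<lambda>z. f z - h z) \<le> K * (hardy_norm p f + hardy_norm p h)" .
  next
    fix f assume f: "f \<in> hardy_space p"
    note N = hardy_norm_nonneg[OF f p] and hf = disc_analyticD[OF hardy_space_disc[OF f]]
    show "0 \<le> hardy_norm p f" by (rule N)
    show "\<forall>z. norm z < 1 \<longrightarrow> norm (f z) \<le> K * hardy_norm p f * (1 - norm z) powr (- 1 / p)"
    proof (intro allI impI)
      fix z :: complex assume z: "norm z < 1"
      have "norm (f z) powr p \<le> 4 * hardy_norm p f powr p * (1 - norm z) powr (-1)"
        using hardy_growth[OF f p z] z by (simp add: powr_minus_divide)
      then have "norm (f z) \<le> 4 powr (1 / p) * hardy_norm p f * (1 - norm z) powr (- 1 / p)"
        by (rule powr_mult_bound_root) (use p N z in auto)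
      also have "\<dots> \<le> K * hardy_norm p f * (1 - norm z) powr (- 1 / p)"
        using K N by (intro mult_right_mono) auto
      finally show "norm (f z) \<le> K * hardy_norm p f * (1 - norm z) powr (- 1 / p)" .
    qed
    obtain M where M: "integrable circ M" "\<And>\<theta>. 0 \<le> M \<theta>" "(LINT \<theta>|circ. M \<theta>) \<le> 256 * hardy_norm p f powr p"
      "AE \<theta> in circ. \<forall>t\<in>{0..<1}. norm (f (of_real t * cis \<theta>)) powr p \<le> M \<theta>"
    proof (rule radial_maximal[OF hf p pmean_le_hardy_norm[OF f p]])
      fix M assume "integrable circ M" "\<And>\<theta>. 0 \<le> M \<theta>" "(LINT \<theta>|circ. M \<theta>) \<le> 256 * hardy_norm p f powr p"
        "AE \<theta> in circ. \<forall>t\<in>{0..<1}. norm (f (of_real t * cis \<theta>)) powr p \<le> M \<theta>"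
      then show thesis by (rule that)
    qed
    show "\<exists>M. radial_majorant p \<beta> f M \<and> (LINT \<theta>|circ. M \<theta>) \<le> K * hardy_norm p f powr p"
      unfolding radial_majorant_def
    proof (intro exI[of _ M] conjI allI M)
      have "256 * hardy_norm p f powr p \<le> K * hardy_norm p f powr p" using K by (intro mult_right_mono) auto
      then show "(LINT \<theta>|circ. M \<theta>) \<le> K * hardy_norm p f powr p" using M(3) by linarith
      show "AE \<theta> in circ. \<forall>s t. 0 \<le> s \<and> s \<le> t \<and> t < 1 \<longrightarrow>
           norm (f (of_real t * cis \<theta>)) \<le> norm (f (of_real s * cis \<theta>)) + M \<theta> powr (1 / p) * ((1 - s) / (1 - t)) powr \<beta>"
        using M(4)
      proof eventually_elim
        case (elim \<theta>)
        show ?case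
        proof (intro allI impI)
          fix s t :: real assume st: "0 \<le> s \<and> s \<le> t \<and> t < 1"
          have "norm (f (of_real t * cis \<theta>)) = (norm (f (of_real t * cis \<theta>)) powr p) powr (1 / p)"
            using p by (simp add: powr_powr)
          also have "\<dots> \<le> M \<theta> powr (1 / p)" using elim st p by (intro powr_mono2) auto
          also have "\<dots> \<le> M \<theta> powr (1 / p) * ((1 - s) / (1 - t)) powr \<beta>"
          proof -
            have "1 \<le> ((1 - s) / (1 - t)) powr \<beta>" using st b by (intro ge_one_powr_ge_zero) auto
            from mult_left_mono[OF this, of "M \<theta> powr (1 / p)"] show ?thesis by simp
          qed
          finally show "norm (f (of_real t * cis \<theta>)) \<le> norm (f (of_real s * cis \<theta>)) + M \<theta> powr (1 / p) * ((1 - s) / (1 - t)) powr \<beta>"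
            by (rule add_increasing[OF norm_ge_zero])
        qed
      qed
    qed
  qed
  then show ?thesis by blast
qed


section \<open>Dirichlet-type spaces\<close>

definition disc_density :: "real \<Rightarrow> (complex \<Rightarrow> complex) \<Rightarrow> complex \<Rightarrow> real" where
  "disc_density p f z = indicator (ball 0 1) z * dirichlet_density p f z"

lemma disc_density_nonneg: "0 \<le> disc_density p f z"
  by (simp add: disc_density_def dirichlet_density_def)

lemma dirichlet_space_integrable:
  "f \<in> dirichlet_space p \<longleftrightarrow> f \<in> disc_analytic \<and> integrable lborel (disc_density p f)"
  by (simp add: dirichlet_space_def set_integrable_def disc_density_def[abs_def])

lemma dirichlet_norm_eq:
  "dirichlet_norm p f = (1 / pi * integral\<^sup>L lborel (disc_density p f) + norm (f 0) powr p) powr (1 / p)"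
  by (simp add: dirichlet_norm_def set_lebesgue_integral_def disc_density_def[abs_def])

lemma integral_disc_density_nonneg: "0 \<le> integral\<^sup>L lborel (disc_density p f)"
  by (intro integral_nonneg_AE) (simp add: disc_density_nonneg)

lemma dirichlet_norm_powr:
  "0 < p \<Longrightarrow> dirichlet_norm p f powr p = 1 / pi * integral\<^sup>L lborel (disc_density p f) + norm (f 0) powr p"
  unfolding dirichlet_norm_eq using integral_disc_density_nonneg[of p f] by (simp add: powr_powr)

lemma dirichlet_norm_nonneg: "0 \<le> dirichlet_norm p f"
  by (simp add: dirichlet_norm_eq)

lemma integral_disc_density_le: "0 < p \<Longrightarrow> integral\<^sup>L lborel (disc_density p f) \<le> pi * dirichlet_norm p f powr p"
  using dirichlet_norm_powr[of p f] by (simp add: distrib_left)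

lemma norm_at_0_le_dirichlet_norm: "0 < p \<Longrightarrow> norm (f 0) \<le> dirichlet_norm p f"
proof -
  assume p: "0 < p"
  have "norm (f 0) powr p \<le> dirichlet_norm p f powr p"
    using dirichlet_norm_powr[OF p, of f] integral_disc_density_nonneg[of p f] by simp
  then show ?thesis using p dirichlet_norm_nonneg[of p f] powr_less_mono2[of p "dirichlet_norm p f" "norm (f 0)"] by linarith
qed

lemma nn_integral_disc_density:
  assumes "f \<in> dirichlet_space p"
  shows "(\<integral>\<^sup>+z. ennreal (disc_density p f z) \<partial>lborel) = ennreal (integral\<^sup>L lborel (disc_density p f))"
  using assms by (intro nn_integral_eq_integral) (auto simp: dirichlet_space_integrable disc_density_nonneg)

lemma deriv_indicator_measurable:
  assumes "f holomorphic_on ball 0 1"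
  shows "(\<lambda>w. indicator (ball 0 1) w *\<^sub>R deriv f w) \<in> borel_measurable borel"
  using assms by (intro borel_measurable_continuous_on_indicator holomorphic_on_imp_continuous_on holomorphic_deriv) auto

lemma disc_density_measurable:
  assumes f: "f holomorphic_on ball 0 1" and p: "0 < p"
  shows "disc_density p f \<in> borel_measurable borel"
proof -
  have [measurable]: "(\<lambda>w. indicator (ball 0 1) w *\<^sub>R deriv f w) \<in> borel_measurable borel"
    by (rule deriv_indicator_measurable[OF f])
  have "disc_density p f = (\<lambda>w. norm (indicator (ball 0 1) w *\<^sub>R deriv f w) powr p * (1 - (norm w)\<^sup>2) powr (p - 1))"
    using p by (auto simp: disc_density_def dirichlet_density_def fun_eq_iff split: split_indicator)
  also have "\<dots> \<in> borel_measurable borel" by measurable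
  finally show ?thesis .
qed

text \<open>
  The area mean of |f'|^p over the ball of radius (1 - |z|) / 2. On this ball 1 - |w|^2 lies between 1/2 and 3
  times 1 - |z|; the minimum in c provides for both signs of the exponent p - 1.
\<close>

lemma deriv_local_mean:
  fixes z :: complex
  assumes f: "f \<in> dirichlet_space p" and p: "0 < p" and z: "norm z < 1"
  defines "c \<equiv> pi / 4 * min ((1/2) powr (p - 1)) (3 powr (p - 1))"
  shows "ennreal (norm (deriv f z) powr p * (c * (1 - norm z) powr (p + 1)))
     \<le> (\<integral>\<^sup>+w. indicator (ball z ((1 - norm z) / 2)) w * ennreal (disc_density p f w) \<partial>lborel)"
proof -
  define d where "d = 1 - norm z"
  define m where "m = min ((1/2) powr (p - 1)) (3 powr (p - 1 :: real))"
  define h where "h w = indicator (ball 0 1) w *\<^sub>R deriv f w" for w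
  have d: "0 < d" using z by (simp add: d_def)
  have m0: "0 \<le> m" by (simp add: m_def)
  have hf: "f holomorphic_on ball 0 1" using f disc_analyticD by (auto simp: dirichlet_space_def)
  have hm [measurable]: "h \<in> borel_measurable borel" unfolding h_def[abs_def] by (rule deriv_indicator_measurable[OF hf])
  have h: "h holomorphic_on ball 0 1"
    by (rule holomorphic_transform[OF holomorphic_deriv[OF hf open_ball]]) (simp add: h_def)
  have hz: "h z = deriv f z" using z by (simp add: h_def)
  have em: "emeasure lborel (ball z (d / 2)) = ennreal (pi / 4 * d\<^sup>2)"
    using d by (simp add: emeasure_ball unit_ball_vol_2 power_divide)
  have pt: "norm (h w) powr p * (m * d powr (p - 1)) \<le> disc_density p f w" if w: "w \<in> ball z (d / 2)" for w
  proof -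
    have nw: "norm w \<le> norm z + d / 2" "norm z - d / 2 \<le> norm w" 
      using w norm_triangle_ineq2[of z w] norm_triangle_ineq2[of w z] by (auto simp: dist_norm norm_minus_commute)
    have "norm z + d / 2 < 1" using d by (simp add: d_def field_simps)
    then have w1: "norm w < 1" using nw(1) by linarith
    have x: "1 - (norm w)\<^sup>2 = (1 - norm w) * (1 + norm w)" by (simp add: power2_eq_square algebra_simps)
    have lo: "d / 2 \<le> 1 - norm w" and hi: "1 - norm w \<le> 3 / 2 * d" using nw by (auto simp: d_def field_simps)
    have lo': "d / 2 \<le> 1 - (norm w)\<^sup>2"
      unfolding x using mult_mono[OF lo, of 1 "1 + norm w"] w1 by simp
    have hi': "1 - (norm w)\<^sup>2 \<le> 3 * d"
      unfolding x using mult_mono[OF hi, of "1 + norm w" 2] w1 d by simp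
    have "m \<le> ((1 - (norm w)\<^sup>2) / d) powr (p - 1)"
    proof (cases "1 \<le> p")
      case True
      have "(1/2) powr (p - 1) \<le> ((1 - (norm w)\<^sup>2) / d) powr (p - 1)"
        using True lo' d by (intro powr_mono2) (auto simp: field_simps)
      then show ?thesis by (simp add: m_def)
    next
      case False
      have "3 powr (p - 1) \<le> ((1 - (norm w)\<^sup>2) / d) powr (p - 1)"
        using False lo' hi' d by (intro powr_mono2') (auto simp: field_simps)
      then show ?thesis by (simp add: m_def)
    qed
    also have "\<dots> = (1 - (norm w)\<^sup>2) powr (p - 1) / d powr (p - 1)"
      using lo' d by (simp add: powr_divide)
    finally have "m * d powr (p - 1) \<le> (1 - (norm w)\<^sup>2) powr (p - 1)"
      using d by (simp add: pos_le_divide_eq)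
    from mult_left_mono[OF this, of "norm (deriv f w) powr p"] w1
    show ?thesis by (simp add: disc_density_def dirichlet_density_def h_def)
  qed
  have E: "norm (deriv f z) powr p * (c * d powr (p + 1)) = (m * d powr (p - 1)) * (norm (h z) powr p * (pi / 4 * d\<^sup>2))"
  proof -
    have "d powr (p + 1) = d powr (p - 1) * d powr 2" by (simp add: powr_add[symmetric] add.commute)
    also have "d powr 2 = d\<^sup>2" using d by (simp add: powr_numeral)
    finally show ?thesis by (simp add: c_def m_def hz)
  qed
  have nn: "0 \<le> m * d powr (p - 1)" "0 \<le> norm (h z) powr p" "0 \<le> pi / 4 * d\<^sup>2" using m0 by simp_all
  have "ennreal (norm (deriv f z) powr p * (c * d powr (p + 1)))
      = ennreal (m * d powr (p - 1)) * (ennreal (norm (h z) powr p) * emeasure lborel (ball z (d / 2)))"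
    unfolding E em by (simp only: ennreal_mult[OF nn(1) mult_nonneg_nonneg[OF nn(2,3)]] ennreal_mult[OF nn(2,3)])
  also have "\<dots> \<le> ennreal (m * d powr (p - 1)) * (\<integral>\<^sup>+w. indicator (ball z (d / 2)) w * ennreal (norm (h w) powr p) \<partial>lborel)"
    using d by (intro mult_left_mono area_sub_mean[OF h hm _ p]) (auto simp: d_def field_simps)
  also have "\<dots> = (\<integral>\<^sup>+w. ennreal (m * d powr (p - 1)) * (indicator (ball z (d / 2)) w * ennreal (norm (h w) powr p)) \<partial>lborel)"
    by (intro nn_integral_cmult[symmetric] borel_measurable_times_ennreal borel_measurable_indicator) (simp, measurable)
  also have "\<dots> \<le> (\<integral>\<^sup>+w. indicator (ball z (d / 2)) w * ennreal (disc_density p f w) \<partial>lborel)"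
  proof (rule nn_integral_mono)
    fix w
    show "ennreal (m * d powr (p - 1)) * (indicator (ball z (d / 2)) w * ennreal (norm (h w) powr p))
        \<le> indicator (ball z (d / 2)) w * ennreal (disc_density p f w)"
    proof (cases "w \<in> ball z (d / 2)")
      case True
      from ennreal_leI[OF pt[OF True]] show ?thesis
        using True m0 by (simp add: ennreal_mult mult.commute)
    qed simp
  qed
  finally show ?thesis by (simp add: d_def)
qed

lemma deriv_growth_dirichlet:
  fixes z :: complex
  assumes f: "f \<in> dirichlet_space p" and p: "0 < p" and z: "norm z < 1"
  defines "c \<equiv> pi / 4 * min ((1/2) powr (p - 1)) (3 powr (p - 1))"
  shows "norm (deriv f z) powr p * (c * (1 - norm z) powr (p + 1)) \<le> integral\<^sup>L lborel (disc_density p f)"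
proof -
  have "ennreal (norm (deriv f z) powr p * (c * (1 - norm z) powr (p + 1))) \<le> (\<integral>\<^sup>+w. ennreal (disc_density p f w) \<partial>lborel)"
    unfolding c_def
    by (rule order_trans[OF deriv_local_mean[OF f p z]], rule nn_integral_mono) (simp split: split_indicator)
  then show ?thesis
    unfolding nn_integral_disc_density[OF f]
    using integral_disc_density_nonneg[of p f] by (simp add: ennreal_le_iff)
qed

text \<open>
  The Poisson integral, from inside the disc to the circle, of the density that defines the Dirichlet norm.
  It keeps the total mass, since the kernel has mass one in the angle.
\<close>

definition density_poisson :: "real \<Rightarrow> (complex \<Rightarrow> complex) \<Rightarrow> real \<Rightarrow> ennreal" where
  "density_poisson p f \<theta> = (\<integral>\<^sup>+w. ennreal (disc_density p f w) * ennreal (poisson w \<theta>) \<partial>lborel)"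

lemma density_poisson:
  assumes f: "f \<in> dirichlet_space p" and p: "0 < p"
  shows density_poisson_measurable: "density_poisson p f \<in> borel_measurable circ"
    and nn_integral_density_poisson:
      "(\<integral>\<^sup>+\<theta>. density_poisson p f \<theta> \<partial>circ) = ennreal (integral\<^sup>L lborel (disc_density p f))"
proof -
  interpret P: pair_sigma_finite "lborel :: complex measure" circ ..
  have [measurable]: "disc_density p f \<in> borel_measurable borel"
    by (rule disc_density_measurable[OF disc_analyticD[OF f[unfolded dirichlet_space_integrable, THEN conjunct1]] p])
  have m: "(\<lambda>(w, \<theta>). ennreal (disc_density p f w) * ennreal (poisson w \<theta>)) \<in> borel_measurable (lborel \<Otimes>\<^sub>M circ)"
    by measurable
  show "density_poisson p f \<in> borel_measurable circ"
    unfolding density_poisson_def[abs_def] by measurable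
  have "(\<integral>\<^sup>+\<theta>. density_poisson p f \<theta> \<partial>circ) = (\<integral>\<^sup>+w. (\<integral>\<^sup>+\<theta>. ennreal (disc_density p f w) * ennreal (poisson w \<theta>) \<partial>circ) \<partial>lborel)"
    unfolding density_poisson_def by (rule P.Fubini'[OF m])
  also have "\<dots> = (\<integral>\<^sup>+w. ennreal (disc_density p f w) \<partial>lborel)"
  proof (rule nn_integral_cong)
    fix w :: complex
    show "(\<integral>\<^sup>+\<theta>. ennreal (disc_density p f w) * ennreal (poisson w \<theta>) \<partial>circ) = ennreal (disc_density p f w)"
    proof (cases "norm w < 1")
      case True
      have i: "integrable circ (poisson w)"
        using integrable_poisson_times[OF True, of "\<lambda>_. 1" 1] by simp
      have "(\<integral>\<^sup>+\<theta>. ennreal (poisson w \<theta>) \<partial>circ) = 1"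
        using integral_poisson[OF True] poisson_nonneg[OF True] by (subst nn_integral_eq_integral[OF i]) auto
      then show ?thesis by (subst nn_integral_cmult) auto
    qed (simp add: disc_density_def)
  qed
  finally show "(\<integral>\<^sup>+\<theta>. density_poisson p f \<theta> \<partial>circ) = ennreal (integral\<^sup>L lborel (disc_density p f))"
    by (simp add: nn_integral_disc_density[OF f])
qed

text \<open>
  On the ball of radius (1 - s) / 2 about s cis \<theta> the Poisson kernel towards \<theta> is at least
  (2/9) / (1 - s). Inserting it into the local area mean lowers the exponent p + 1 of 1 - s to p, and then
  the integral over the ball is extended to the disc, so that it no longer depends on s.
\<close>

lemma deriv_le_density_poisson:
  assumes f: "f \<in> dirichlet_space p" and p: "0 < p" and s: "0 \<le> s" "s < 1"
  defines "c \<equiv> pi / 4 * min ((1/2) powr (p - 1)) (3 powr (p - 1))"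
  shows "ennreal (norm (deriv f (of_real s * cis \<theta>)) powr p * (c * (1 - s) powr p)) \<le> ennreal (9 / 2) * density_poisson p f \<theta>"
proof -
  define z where "z = of_real s * cis \<theta>"
  define d where "d = 1 - s"
  have nz: "norm z = s" using s by (simp add: z_def norm_mult)
  have d: "0 < d" using s by (simp add: d_def)
  have dm [measurable]: "disc_density p f \<in> borel_measurable borel"
    by (rule disc_density_measurable[OF disc_analyticD[OF f[unfolded dirichlet_space_integrable, THEN conjunct1]] p])
  have pt: "1 / d \<le> 9 / 2 * poisson w \<theta>" if w: "w \<in> ball z (d / 2)" for w
  proof -
    have nw: "norm w < s + d / 2" using w norm_triangle_ineq2[of w z] by (auto simp: dist_norm norm_minus_commute nz)
    have w1: "d / 2 \<le> 1 - norm w" using nw by (simp add: d_def field_simps)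
    have "1 - norm w \<le> 1 - (norm w)\<^sup>2" using w1 d by (simp add: power2_eq_square mult_left_le)
    then have num: "d / 2 \<le> 1 - (norm w)\<^sup>2" using w1 by linarith
    have "cis \<theta> - w = (cis \<theta> - z) + (z - w)" by simp
    then have "norm (cis \<theta> - w) \<le> norm (cis \<theta> - z) + norm (z - w)" by (metis norm_triangle_ineq)
    also have "norm (cis \<theta> - z) = d"
    proof -
      have "cis \<theta> - z = of_real d * cis \<theta>" by (simp add: z_def d_def algebra_simps)
      then show ?thesis using d by (simp add: norm_mult)
    qed
    also have "norm (z - w) \<le> d / 2" using w by (simp add: dist_norm)
    finally have den: "norm (cis \<theta> - w) \<le> 3 / 2 * d" by simp
    have den0: "0 < norm (cis \<theta> - w)" using norm_cis_diff_ge[of w \<theta>] w1 d by linarith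
    have "(d / 2) / (3 / 2 * d)\<^sup>2 \<le> poisson w \<theta>"
      unfolding poisson_def using num den den0 d by (intro frac_le power_mono) auto
    moreover have "1 / d = 9 / 2 * ((d / 2) / (3 / 2 * d)\<^sup>2)" using d by (simp add: power2_eq_square)
    ultimately show ?thesis by simp
  qed
  have e: "norm (deriv f z) powr p * (c * d powr p) = 1 / d * (norm (deriv f z) powr p * (c * d powr (p + 1)))"
    using d by (simp add: powr_add)
  have "ennreal (norm (deriv f z) powr p * (c * d powr p)) = ennreal (1 / d) * ennreal (norm (deriv f z) powr p * (c * d powr (p + 1)))"
    unfolding e by (rule ennreal_mult) (use d in \<open>auto simp: c_def\<close>)
  also have "\<dots> \<le> ennreal (1 / d) * (\<integral>\<^sup>+w. indicator (ball z (d / 2)) w * ennreal (disc_density p f w) \<partial>lborel)"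
    using deriv_local_mean[OF f p, of z] s unfolding nz c_def d_def by (intro mult_left_mono) auto
  also have "\<dots> = (\<integral>\<^sup>+w. ennreal (1 / d) * (indicator (ball z (d / 2)) w * ennreal (disc_density p f w)) \<partial>lborel)"
    by (intro nn_integral_cmult[symmetric] borel_measurable_times_ennreal borel_measurable_indicator) (simp, measurable)
  also have "\<dots> \<le> (\<integral>\<^sup>+w. ennreal (9 / 2) * (ennreal (disc_density p f w) * ennreal (poisson w \<theta>)) \<partial>lborel)"
  proof (rule nn_integral_mono)
    fix w
    show "ennreal (1 / d) * (indicator (ball z (d / 2)) w * ennreal (disc_density p f w))
        \<le> ennreal (9 / 2) * (ennreal (disc_density p f w) * ennreal (poisson w \<theta>))"
    proof (cases "w \<in> ball z (d / 2)")
      case True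
      have "ennreal (1 / d) \<le> ennreal (9 / 2 * poisson w \<theta>)" by (rule ennreal_leI[OF pt[OF True]])
      also have "\<dots> = ennreal (9 / 2) * ennreal (poisson w \<theta>)" by (rule ennreal_mult') simp
      finally have "ennreal (1 / d) * ennreal (disc_density p f w) \<le> ennreal (9 / 2) * ennreal (poisson w \<theta>) * ennreal (disc_density p f w)"
        by (rule mult_right_mono) simp
      then show ?thesis using True by (simp add: mult_ac)
    qed simp
  qed
  also have "\<dots> = ennreal (9 / 2) * density_poisson p f \<theta>"
    unfolding density_poisson_def by (rule nn_integral_cmult) measurable
  finally show ?thesis by (simp add: z_def d_def)
qed

lemma disc_radial_derivative:
  assumes "f holomorphic_on ball 0 1" "norm (of_real t * w) < 1"
  shows "((\<lambda>t. f (of_real t * w)) has_vector_derivative w * deriv f (of_real t * w)) (at t)"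
proof -
  have "((\<lambda>t. of_real t * w) has_vector_derivative w) (at t)"
    by (auto intro!: derivative_eq_intros simp: has_vector_derivative_def scaleR_conv_of_real)
  moreover have "(f has_field_derivative deriv f (of_real t * w)) (at (of_real t * w))"
    using assms by (intro holomorphic_derivI[of f "ball 0 1"]) auto
  ultimately show ?thesis using field_vector_diff_chain_at by (fastforce simp: o_def)
qed

lemma dirichlet_diff:
  assumes f: "f \<in> dirichlet_space p" and h: "h \<in> dirichlet_space p" and p: "0 < p"
  shows "(\<lambda>z. f z - h z) \<in> dirichlet_space p"
    and "dirichlet_norm p (\<lambda>z. f z - h z) \<le> 2 * 2 powr (1 / p) * (dirichlet_norm p f + dirichlet_norm p h)"
proof -
  note fd = f[unfolded dirichlet_space_integrable, THEN conjunct1] and hd = h[unfolded dirichlet_space_integrable, THEN conjunct1]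
    and fi = f[unfolded dirichlet_space_integrable, THEN conjunct2] and hi = h[unfolded dirichlet_space_integrable, THEN conjunct2]
  note nn = dirichlet_norm_nonneg[of p f] dirichlet_norm_nonneg[of p h]
  define k where "k = (\<lambda>z. f z - h z)"
  have kd: "k \<in> disc_analytic" unfolding k_def by (rule disc_analytic_diff[OF fd hd])
  have quasi: "norm (a - b) powr p \<le> 2 powr p * (norm a powr p + norm b powr p)" for a b :: complex
  proof -
    have "norm (a - b) powr p \<le> (norm a + norm b) powr p" using p by (intro powr_mono2 norm_triangle_ineq4) auto
    also have "\<dots> \<le> 2 powr p * (norm a powr p + norm b powr p)" using p by (intro powr_add_le_quasi) auto
    finally show ?thesis .
  qed
  have le: "disc_density p k z \<le> 2 powr p * (disc_density p f z + disc_density p h z)" for z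
  proof (cases "z \<in> ball 0 1")
    case True
    have "f field_differentiable at z" "h field_differentiable at z"
      using True disc_analyticD[OF fd] disc_analyticD[OF hd] holomorphic_on_imp_differentiable_at[OF _ open_ball] by blast+
    then have "deriv k z = deriv f z - deriv h z" unfolding k_def by (rule deriv_diff)
    then have "disc_density p k z = norm (deriv f z - deriv h z) powr p * (1 - (norm z)\<^sup>2) powr (p - 1)"
      using True by (simp add: disc_density_def dirichlet_density_def)
    also have "\<dots> \<le> 2 powr p * (norm (deriv f z) powr p + norm (deriv h z) powr p) * (1 - (norm z)\<^sup>2) powr (p - 1)"
      by (intro mult_right_mono quasi) simp
    also have "\<dots> = 2 powr p * (disc_density p f z + disc_density p h z)"
      using True by (simp add: disc_density_def dirichlet_density_def distrib_right)
    finally show ?thesis .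
  qed (simp add: disc_density_def)
  have km: "disc_density p k \<in> borel_measurable borel"
    by (rule disc_density_measurable[OF disc_analyticD[OF kd] p])
  have i2: "integrable lborel (\<lambda>z. 2 powr p * (disc_density p f z + disc_density p h z))" using fi hi by simp
  have ki: "integrable lborel (disc_density p k)"
    by (rule Bochner_Integration.integrable_bound[OF i2]) (use km le disc_density_nonneg in \<open>auto simp: abs_of_nonneg intro: order_trans\<close>)
  then show "(\<lambda>z. f z - h z) \<in> dirichlet_space p" using kd by (simp add: dirichlet_space_integrable k_def)
  have Ile: "integral\<^sup>L lborel (disc_density p k)
      \<le> 2 powr p * (integral\<^sup>L lborel (disc_density p f) + integral\<^sup>L lborel (disc_density p h))"
  proof -
    have "integral\<^sup>L lborel (disc_density p k) \<le> integral\<^sup>L lborel (\<lambda>z. 2 powr p * (disc_density p f z + disc_density p h z))"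
      by (rule integral_mono[OF ki i2 le])
    then show ?thesis using fi hi by simp
  qed
  define A where "A = dirichlet_norm p f + dirichlet_norm p h"
  have A0: "0 \<le> A" using nn by (simp add: A_def)
  have "dirichlet_norm p k powr p \<le> 2 powr p * (dirichlet_norm p f powr p + dirichlet_norm p h powr p)"
    unfolding dirichlet_norm_powr[OF p]
    using mult_left_mono[OF Ile, of "1 / pi"] quasi[of "f 0" "h 0"] by (simp add: k_def algebra_simps)
  also have "\<dots> \<le> 2 powr p * (A powr p + A powr p)"
    using nn p by (intro mult_left_mono add_mono powr_mono2) (auto simp: A_def)
  also have "\<dots> = (2 * 2 powr (1 / p) * A) powr p" using A0 p by (simp add: powr_mult powr_powr)
  finally have "dirichlet_norm p k \<le> 2 * 2 powr (1 / p) * A"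
    using p A0 powr_less_mono2[of p "2 * 2 powr (1 / p) * A" "dirichlet_norm p k"] by fastforce
  then show "dirichlet_norm p (\<lambda>z. f z - h z) \<le> 2 * 2 powr (1 / p) * (dirichlet_norm p f + dirichlet_norm p h)"
    by (simp add: k_def A_def)
qed

text \<open>
  The majorant M1 bounds ((1 - s) |f'|)^p along the ray, so increments of f are at most
  M1^(1/p) log ((1 - s) / (1 - t)), and the logarithm is at most a power with exponent \<beta> divided by \<beta>.
  The latter is obtained directly by estimating 1 / (1 - x) by
  (1 - s)^\<beta> (1 - x)^(-\<beta> - 1) before integrating.
\<close>

lemma radially_controlled_dirichlet:
  assumes p: "0 < p" and b: "0 < \<beta>"
  shows "\<exists>K. radially_controlled p \<beta> (dirichlet_space p) (dirichlet_norm p) K"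
proof -
  define c where "c = pi / 4 * min ((1/2) powr (p - 1)) (3 powr (p - 1))"
  have c: "0 < c" by (simp add: c_def)
  define K1 where "K1 = 1 + p * (pi / c) powr (1 / p)"
  define K2 where "K2 = 9 / 2 * pi / (c * \<beta> powr p)"
  define K where "K = 2 * 2 powr (1 / p) + K1 + K2"
  have K12: "0 \<le> K1" "0 \<le> K2" using p c by (auto simp: K1_def K2_def)
  have "0 < 2 * 2 powr (1 / p)" by simp
  then have "0 < K" unfolding K_def using K12 by linarith
  then have K: "0 < K" "2 * 2 powr (1 / p) \<le> K" "K1 \<le> K" "K2 \<le> K"
    using K12 by (simp_all add: K_def)
  have "radially_controlled p \<beta> (dirichlet_space p) (dirichlet_norm p) K"
    unfolding radially_controlled_def
  proof (intro conjI ballI)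
    show "0 < K" by (rule K)
    show "dirichlet_space p \<subseteq> disc_analytic" by (auto simp: dirichlet_space_def)
  next
    fix f h assume f: "f \<in> dirichlet_space p" and h: "h \<in> dirichlet_space p"
    show "(\<lambda>z. f z - h z) \<in> dirichlet_space p" by (rule dirichlet_diff(1)[OF f h p])
    have "dirichlet_norm p (\<lambda>z. f z - h z) \<le> 2 * 2 powr (1 / p) * (dirichlet_norm p f + dirichlet_norm p h)"
      by (rule dirichlet_diff(2)[OF f h p])
    also have "\<dots> \<le> K * (dirichlet_norm p f + dirichlet_norm p h)"
      using dirichlet_norm_nonneg K by (intro mult_right_mono add_nonneg_nonneg) auto
    finally show "dirichlet_norm p (\<lambda>z. f z - h z) \<le> K * (dirichlet_norm p f + dirichlet_norm p h)" .
  next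
    fix f assume f: "f \<in> dirichlet_space p"
    define N where "N = dirichlet_norm p f"
    have N: "0 \<le> N" unfolding N_def by (rule dirichlet_norm_nonneg)
    have hf: "f holomorphic_on ball 0 1" using f disc_analyticD by (auto simp: dirichlet_space_def)
    show "0 \<le> dirichlet_norm p f" by (rule dirichlet_norm_nonneg)
    have dg: "norm (deriv f z) \<le> (pi / c) powr (1 / p) * N * (1 - norm z) powr (- 1 / p - 1)" if z: "norm z < 1" for z
    proof -
      have "norm (deriv f z) powr p * (c * (1 - norm z) powr (p + 1)) \<le> pi * N powr p"
        using deriv_growth_dirichlet[OF f p z] integral_disc_density_le[OF p, of f] unfolding c_def N_def by linarith
      then have "norm (deriv f z) powr p \<le> pi / c * N powr p * (1 - norm z) powr (- (p + 1))"
        using z c unfolding powr_minus_divide by (simp add: field_simps)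
      from powr_mult_bound_root[OF this p] have "norm (deriv f z) \<le> (pi / c) powr (1 / p) * N * (1 - norm z) powr (- (p + 1) / p)"
        using c N z by simp
      also have "- (p + 1) / p = - 1 / p - 1" using p by (simp add: field_simps)
      finally show ?thesis .
    qed
    show "\<forall>z. norm z < 1 \<longrightarrow> norm (f z) \<le> K * dirichlet_norm p f * (1 - norm z) powr (- 1 / p)"
      unfolding N_def[symmetric]
    proof (intro allI impI)
      fix z :: complex assume z: "norm z < 1"
      obtain \<theta> where zz: "z = of_real (norm z) * cis \<theta>"
        by (metis rcis_cmod_Arg rcis_def)
      define C where "C = (pi / c) powr (1 / p) * N"
      have C0: "0 \<le> C" using N by (simp add: C_def)
      have "norm (f (of_real (norm z) * cis \<theta>) - f (of_real 0 * cis \<theta>))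
          \<le> C * ((1 - 0) powr (- 1 / p) - (1 - norm z) powr (- 1 / p)) / (- 1 / p)"
      proof (rule radial_increment_le)
        fix t :: real assume t: "0 \<le> t" "t < 1"
        show "((\<lambda>t. f (of_real t * cis \<theta>)) has_vector_derivative cis \<theta> * deriv f (of_real t * cis \<theta>)) (at t)"
          by (rule disc_radial_derivative[OF hf]) (use t in \<open>simp add: norm_mult\<close>)
      next
        fix t assume t: "0 < t" "t < norm z"
        show "norm (cis \<theta> * deriv f (of_real t * cis \<theta>)) \<le> C * (1 - t) powr (- 1 / p - 1)"
          using dg[of "of_real t * cis \<theta>"] t z by (simp add: norm_mult C_def)
      qed (use z p in auto)
      then have "norm (f z - f 0) \<le> C * ((1 - 0) powr (- 1 / p) - (1 - norm z) powr (- 1 / p)) / (- 1 / p)"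
        using zz by simp
      also have "\<dots> = p * C * ((1 - norm z) powr (- 1 / p) - 1)" using p by (simp add: field_simps)
      also have "\<dots> \<le> p * C * (1 - norm z) powr (- 1 / p)" using p C0 by (intro mult_left_mono) auto
      finally have 1: "norm (f z - f 0) \<le> p * C * (1 - norm z) powr (- 1 / p)" .
      have "1 \<le> (1 - norm z) powr (- 1 / p)" using z p by (intro one_le_powr_nonpos) auto
      from mult_left_mono[OF this N] have 2: "norm (f 0) \<le> N * (1 - norm z) powr (- 1 / p)"
        using norm_at_0_le_dirichlet_norm[OF p, of f] by (simp add: N_def)
      have "norm (f z) \<le> norm (f z - f 0) + norm (f 0)"
        using norm_triangle_ineq[of "f z - f 0" "f 0"] by simp
      also have "\<dots> \<le> K1 * N * (1 - norm z) powr (- 1 / p)"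
        using 1 2 by (simp add: K1_def C_def algebra_simps)
      also have "\<dots> \<le> K * N * (1 - norm z) powr (- 1 / p)" using K N by (intro mult_right_mono) auto
      finally show "norm (f z) \<le> K * N * (1 - norm z) powr (- 1 / p)" .
    qed
    define I where "I = integral\<^sup>L lborel (disc_density p f)"
    have I0: "0 \<le> I" unfolding I_def by (rule integral_disc_density_nonneg)
    note ed = ennreal_dominant[OF density_poisson_measurable[OF f p] eq_refl[OF nn_integral_density_poisson[OF f p]] integral_disc_density_nonneg]
    define M0 where "M0 \<theta> = enn2real (density_poisson p f \<theta>)" for \<theta>
    define M1 where "M1 \<theta> = 9 / 2 / c * M0 \<theta>" for \<theta>
    define M where "M \<theta> = M1 \<theta> / \<beta> powr p" for \<theta>
    have M0: "0 \<le> M0 \<theta>" for \<theta> by (simp add: M0_def)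
    have M10: "0 \<le> M1 \<theta>" for \<theta> using M0 c by (simp add: M1_def)
    show "\<exists>M. radial_majorant p \<beta> f M \<and> (LINT \<theta>|circ. M \<theta>) \<le> K * dirichlet_norm p f powr p"
      unfolding radial_majorant_def
    proof (intro exI[of _ M] conjI allI)
      show "integrable circ M" unfolding M_def M1_def M0_def using ed(1) by simp
      show "0 \<le> M \<theta>" for \<theta> using M10 by (simp add: M_def)
      have "(LINT \<theta>|circ. M \<theta>) = 9 / 2 / (c * \<beta> powr p) * (LINT \<theta>|circ. M0 \<theta>)"
        unfolding M_def M1_def using ed(1) by (simp add: M0_def)
      also have "\<dots> \<le> 9 / 2 / (c * \<beta> powr p) * (pi * N powr p)"
        using ed(2) integral_disc_density_le[OF p, of f] c unfolding M0_def N_def by (intro mult_left_mono) auto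
      also have "\<dots> = K2 * N powr p" by (simp add: K2_def)
      also have "\<dots> \<le> K * N powr p" using K by (intro mult_right_mono) auto
      finally show "(LINT \<theta>|circ. M \<theta>) \<le> K * dirichlet_norm p f powr p" by (simp add: N_def)
      show "AE \<theta> in circ. \<forall>s t. 0 \<le> s \<and> s \<le> t \<and> t < 1 \<longrightarrow>
           norm (f (of_real t * cis \<theta>)) \<le> norm (f (of_real s * cis \<theta>)) + M \<theta> powr (1 / p) * ((1 - s) / (1 - t)) powr \<beta>"
        using ed(3)
      proof eventually_elim
        case (elim \<theta>)
        have der: "norm (deriv f (of_real s * cis \<theta>)) \<le> M1 \<theta> powr (1 / p) * (1 - s) powr (-1)" if s: "0 \<le> s" "s < 1" for s
        proof -
          have "ennreal (norm (deriv f (of_real s * cis \<theta>)) powr p * (c * (1 - s) powr p)) \<le> ennreal (9 / 2) * ennreal (M0 \<theta>)"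
            using deriv_le_density_poisson[OF f p s, of \<theta>] elim unfolding c_def M0_def by simp
          also have "\<dots> = ennreal (9 / 2 * M0 \<theta>)" by (rule ennreal_mult[symmetric]) (auto simp: M0)
          finally have "norm (deriv f (of_real s * cis \<theta>)) powr p * (c * (1 - s) powr p) \<le> 9 / 2 * M0 \<theta>"
            using M0 by (simp add: ennreal_le_iff)
          then have "norm (deriv f (of_real s * cis \<theta>)) powr p \<le> M1 \<theta> * 1 powr p * (1 - s) powr (- p)"
            using s c unfolding powr_minus_divide by (simp add: M1_def field_simps)
          from powr_mult_bound_root[OF this p] show ?thesis using M10 s p by simp
        qed
        show ?case
        proof (intro allI impI)
          fix s t :: real assume "0 \<le> s \<and> s \<le> t \<and> t < 1"
          then have st: "0 \<le> s" "s \<le> t" "t < 1" by auto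
          define C where "C = M1 \<theta> powr (1 / p) * (1 - s) powr \<beta>"
          have "norm (f (of_real t * cis \<theta>) - f (of_real s * cis \<theta>)) \<le> C * ((1 - s) powr (- \<beta>) - (1 - t) powr (- \<beta>)) / (- \<beta>)"
          proof (rule radial_increment_le[OF st])
            fix x :: real assume x: "0 \<le> x" "x < 1"
            show "((\<lambda>t. f (of_real t * cis \<theta>)) has_vector_derivative cis \<theta> * deriv f (of_real x * cis \<theta>)) (at x)"
              by (rule disc_radial_derivative[OF hf]) (use x in \<open>simp add: norm_mult\<close>)
          next
            fix x assume x: "s < x" "x < t"
            have x1: "0 \<le> x" "x < 1" using x st by auto
            have "(1 - x) powr (-1) = (1 - x) powr \<beta> * (1 - x) powr (- \<beta> - 1)" by (simp add: powr_add[symmetric])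
            also have "\<dots> \<le> (1 - s) powr \<beta> * (1 - x) powr (- \<beta> - 1)"
              using x x1 b by (intro mult_right_mono powr_mono2) auto
            finally have "M1 \<theta> powr (1 / p) * (1 - x) powr (-1) \<le> M1 \<theta> powr (1 / p) * ((1 - s) powr \<beta> * (1 - x) powr (- \<beta> - 1))"
              by (intro mult_left_mono) auto
            then show "norm (cis \<theta> * deriv f (of_real x * cis \<theta>)) \<le> C * (1 - x) powr (- \<beta> - 1)"
              using der[OF x1] by (simp add: norm_mult C_def)
          qed (use b in auto)
          also have "\<dots> = C * ((1 - t) powr (- \<beta>) - (1 - s) powr (- \<beta>)) / \<beta>"
            using b by (simp add: field_simps)
          also have "\<dots> \<le> C * (1 - t) powr (- \<beta>) / \<beta>"
            using b by (intro divide_right_mono mult_left_mono) (auto simp: C_def)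
          also have "\<dots> = M \<theta> powr (1 / p) * ((1 - s) / (1 - t)) powr \<beta>"
          proof -
            have "M \<theta> powr (1 / p) = M1 \<theta> powr (1 / p) / \<beta>"
              using M10[of \<theta>] b p by (simp add: M_def powr_divide powr_powr)
            then show ?thesis using st by (simp add: C_def powr_divide powr_minus_divide)
          qed
          finally show "norm (f (of_real t * cis \<theta>)) \<le> norm (f (of_real s * cis \<theta>)) + M \<theta> powr (1 / p) * ((1 - s) / (1 - t)) powr \<beta>"
            using norm_triangle_ineq2[of "f (of_real t * cis \<theta>)" "f (of_real s * cis \<theta>)"] by linarith
        qed
      qed
    qed
  qed
  then show ?thesis by blast
qed


section \<open>Test functions and the necessity of the growth condition\<close>

text \<open>
  Cauchy's estimate on the ball of radius (1 - |z|) / 2, where the pointwise growth of h is known.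
\<close>

lemma hardy_deriv_growth:
  assumes h: "h \<in> hardy_space q" and q: "0 < q" and z: "norm z < 1"
  shows "norm (deriv h z) \<le> 2 * 8 powr (1 / q) * (1 - norm z) powr (- 1 - 1 / q) * hardy_norm q h"
proof -
  define d where "d = 1 - norm z"
  have d: "0 < d" using z by (simp add: d_def)
  note hol = disc_analyticD[OF hardy_space_disc[OF h]] and N = hardy_norm_nonneg[OF h q]
  have sub: "cball z (d / 2) \<subseteq> ball 0 1"
  proof
    fix w assume "w \<in> cball z (d / 2)"
    then have "norm (z - w) \<le> d / 2" by (simp add: dist_norm)
    then have "norm w \<le> norm z + d / 2" using norm_triangle_ineq2[of w z] by (simp add: norm_minus_commute)
    then show "w \<in> ball 0 1" using d by (simp add: d_def field_simps)
  qed
  have B: "norm (h w) \<le> 8 powr (1 / q) * hardy_norm q h * d powr (- 1 / q)" if w: "norm (z - w) = d / 2" for w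
  proof (rule powr_mult_bound_root[OF _ q])
    have nw: "norm w \<le> norm z + d / 2" using norm_triangle_ineq2[of w z] w by (simp add: norm_minus_commute)
    then have e: "d / 2 \<le> 1 - norm w" by (simp add: d_def field_simps)
    have w1: "norm w < 1" using e d by linarith
    have "norm (h w) powr q \<le> 4 / (1 - norm w) * hardy_norm q h powr q" by (rule hardy_growth[OF h q w1])
    also have "4 / (1 - norm w) \<le> 4 / (d / 2)" using e d by (intro divide_left_mono mult_pos_pos) auto
    finally show "norm (h w) powr q \<le> 8 * hardy_norm q h powr q * d powr (- 1)"
      using d by (simp add: powr_minus_divide mult_right_mono)
  qed (use N d in auto)
  have "norm ((deriv ^^ 1) h z) \<le> fact 1 * (8 powr (1 / q) * hardy_norm q h * d powr (- 1 / q)) / (d / 2) ^ 1"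
  proof (rule Cauchy_inequality)
    show "h holomorphic_on ball z (d / 2)" by (rule holomorphic_on_subset[OF hol]) (use sub ball_subset_cball in blast)
    show "continuous_on (cball z (d / 2)) h"
      by (rule holomorphic_on_imp_continuous_on[OF holomorphic_on_subset[OF hol sub]])
  qed (use B d in auto)
  also have "\<dots> = 2 * 8 powr (1 / q) * (d powr (- 1) * d powr (- 1 / q)) * hardy_norm q h"
    using d by (simp add: powr_minus_divide mult_ac)
  also have "d powr (- 1) * d powr (- 1 / q) = d powr (- 1 - 1 / q)" by (subst powr_add[symmetric]) simp
  finally show ?thesis by (simp add: d_def)
qed

text \<open>
  The function ((1 - |a|^2) / (1 - cnj a z)^2)^(1/p). On the circle the p-th power of its modulus is the Poisson
  kernel at a, whence the name and the bound 1 for its norm in H^p.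
\<close>

definition poisson_root :: "real \<Rightarrow> complex \<Rightarrow> complex \<Rightarrow> complex" where
  "poisson_root p a z =
     (if norm z < 1 then exp (of_real (ln (1 - (norm a)\<^sup>2) / p) - of_real (2 / p) * Ln (1 - cnj a * z)) else 0)"

context
  fixes p :: real and a :: complex
  assumes p: "0 < p" and a: "norm a < 1"
begin

lemma norm_cnj_mult_less: "norm z < 1 \<Longrightarrow> norm (cnj a * z) < 1"
  using a mult_strict_mono'[of "norm a" 1 "norm z" 1] by (simp add: norm_mult)

lemma one_minus_cnj_not_nonpos: "norm z < 1 \<Longrightarrow> 1 - cnj a * z \<notin> \<real>\<^sub>\<le>\<^sub>0"
  using norm_cnj_mult_less[of z] complex_Re_le_cmod[of "cnj a * z"] by (auto simp: complex_nonpos_Reals_iff)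

lemma one_minus_cnj_nonzero: "norm z < 1 \<Longrightarrow> 1 - cnj a * z \<noteq> 0"
  using one_minus_cnj_not_nonpos[of z] by auto

lemma one_minus_norm_square_pos: "0 < 1 - (norm a)\<^sup>2"
  using a by (simp add: abs_square_less_1)

lemma norm_poisson_root:
  assumes "norm z < 1"
  shows "norm (poisson_root p a z) powr p = (1 - (norm a)\<^sup>2) / (norm (1 - cnj a * z))\<^sup>2"
proof -
  have nz: "0 < norm (1 - cnj a * z)" using one_minus_cnj_nonzero[OF assms] by simp
  have "norm (poisson_root p a z) powr p = exp (p * (ln (1 - (norm a)\<^sup>2) / p - 2 / p * ln (norm (1 - cnj a * z))))"
    using assms one_minus_cnj_nonzero[OF assms] by (simp add: poisson_root_def norm_exp_eq_Re powr_def)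
  also have "\<dots> = exp (ln (1 - (norm a)\<^sup>2) - 2 * ln (norm (1 - cnj a * z)))"
    using p by (simp add: right_diff_distrib)
  also have "\<dots> = (1 - (norm a)\<^sup>2) / (norm (1 - cnj a * z))\<^sup>2"
    using nz one_minus_norm_square_pos by (simp add: exp_diff exp_double)
  finally show ?thesis .
qed

lemma poisson_root_has_derivative:
  assumes "norm z < 1"
  shows "(poisson_root p a has_field_derivative poisson_root p a z * (of_real (2 / p) * (cnj a / (1 - cnj a * z)))) (at z)"
proof -
  define F where "F z = exp (of_real (ln (1 - (norm a)\<^sup>2) / p) - of_real (2 / p) * Ln (1 - cnj a * z))" for z
  have "(F has_field_derivative F z * (of_real (2 / p) * (cnj a / (1 - cnj a * z)))) (at z)"
    unfolding F_def using one_minus_cnj_not_nonpos[OF assms] one_minus_cnj_nonzero[OF assms]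
    by (auto intro!: derivative_eq_intros simp: divide_simps)
  then have "(poisson_root p a has_field_derivative F z * (of_real (2 / p) * (cnj a / (1 - cnj a * z)))) (at z)"
    by (rule has_field_derivative_transform_within_open[OF _ open_ball[of 0 1]])
       (use assms in \<open>auto simp: poisson_root_def F_def\<close>)
  then show ?thesis using assms by (simp add: poisson_root_def F_def)
qed

lemma poisson_root_disc_analytic: "poisson_root p a \<in> disc_analytic"
proof -
  have "poisson_root p a holomorphic_on ball 0 1"
    unfolding holomorphic_on_def field_differentiable_def
  proof
    fix x :: complex assume "x \<in> ball 0 1"
    then show "\<exists>f'. (poisson_root p a has_field_derivative f') (at x within ball 0 1)"
      using has_field_derivative_at_within[OF poisson_root_has_derivative[of x]] by auto
  qed
  moreover have "poisson_root p a z = 0" if "z \<notin> ball 0 1" for z using that by (simp add: poisson_root_def)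
  ultimately show ?thesis by (simp add: disc_analytic_def)
qed

lemma poisson_root_hardy: "poisson_root p a \<in> hardy_space p" "hardy_norm p (poisson_root p a) \<le> 1"
proof -
  have B: "pmean p (poisson_root p a) r \<le> 1 powr p" if r: "0 \<le> r" "r < 1" for r
  proof -
    define w where "w = of_real r * a"
    have nw: "norm w < 1" "norm w \<le> norm a"
      using a r mult_strict_mono'[of r 1 "norm a" 1] by (auto simp: w_def norm_mult mult_left_le_one_le)
    have eq: "norm (poisson_root p a (of_real r * cis \<phi>)) powr p = (1 - (norm a)\<^sup>2) / (1 - (norm w)\<^sup>2) * poisson w \<phi>" for \<phi>
    proof -
      have "1 - cnj a * (of_real r * cis \<phi>) = cis \<phi> * cnj (cis \<phi> - w)"
        by (simp add: w_def algebra_simps cis_cnj cis_mult)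
      then have "norm (1 - cnj a * (of_real r * cis \<phi>)) = norm (cis \<phi> - w)"
        by (simp add: norm_mult del: complex_cnj_diff)
      moreover have "1 - (norm w)\<^sup>2 \<noteq> 0" using abs_square_less_1[of "norm w"] nw by simp
      ultimately show ?thesis using r norm_poisson_root[of "of_real r * cis \<phi>"] by (simp add: norm_mult poisson_def)
    qed
    have "pmean p (poisson_root p a) r = (1 - (norm a)\<^sup>2) / (1 - (norm w)\<^sup>2)"
      unfolding pmean_def eq using integral_poisson[OF nw(1)] by simp
    also have "\<dots> \<le> 1"
    proof -
      have "(norm w)\<^sup>2 \<le> (norm a)\<^sup>2" using nw by (intro power_mono) auto
      then show ?thesis using abs_square_less_1[of "norm w"] nw by simp
    qed
    finally show ?thesis by simp
  qed
  show "poisson_root p a \<in> hardy_space p" "hardy_norm p (poisson_root p a) \<le> 1"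
    using hardy_norm_le[OF poisson_root_disc_analytic p B] by auto
qed

end

text \<open>
  The image of area measure on the disc under the modulus has density 2 \<pi> x. The two measures on the
  line are compared on half-lines, which amounts to the area of annuli.
\<close>

lemma nn_integral_radial:
  fixes \<phi> :: "real \<Rightarrow> ennreal"
  assumes [measurable]: "\<phi> \<in> borel_measurable borel"
  shows "(\<integral>\<^sup>+w. indicator (ball 0 1) (w :: complex) * \<phi> (norm w) \<partial>lborel) = (\<integral>\<^sup>+x. ennreal (2 * pi * x) * indicator {0..1} x * \<phi> x \<partial>lborel)"
proof -
  have ind [measurable]: "(indicator (ball (0 :: complex) 1) :: complex \<Rightarrow> ennreal) \<in> borel_measurable borel"
    by (rule borel_measurable_indicator) simp
  define \<mu> where "\<mu> = distr (density lborel (indicator (ball (0 :: complex) 1))) borel norm"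
  define \<nu> where "\<nu> = density lborel (\<lambda>x. ennreal (2 * pi * x) * indicator {0..1} x)"
  have \<mu>: "emeasure \<mu> {x<..} = emeasure lborel ({w :: complex. x < norm w} \<inter> ball 0 1)" for x
  proof -
    have [measurable]: "{w :: complex. x < norm w} \<in> sets borel" by measurable
    have "emeasure \<mu> {x<..} = emeasure (density lborel (indicator (ball (0 :: complex) 1))) {w. x < norm w}"
      unfolding \<mu>_def by (subst emeasure_distr) (auto simp: vimage_def)
    also have "\<dots> = (\<integral>\<^sup>+w. indicator (ball (0 :: complex) 1) w * indicator {w. x < norm w} w \<partial>lborel)"
      by (rule emeasure_density) auto
    also have "\<dots> = (\<integral>\<^sup>+w. indicator ({w :: complex. x < norm w} \<inter> ball 0 1) w \<partial>lborel)"
      by (intro nn_integral_cong) (auto split: split_indicator)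
    also have "\<dots> = emeasure lborel ({w :: complex. x < norm w} \<inter> ball 0 1)"
      by (intro nn_integral_indicator) auto
    finally show ?thesis .
  qed
  have B: "emeasure lborel (ball (0 :: complex) r) = ennreal (pi * r\<^sup>2)" "emeasure lborel (cball (0 :: complex) r) = ennreal (pi * r\<^sup>2)" if "0 \<le> r" for r
    using that by (simp_all add: emeasure_ball emeasure_cball unit_ball_vol_2)
  have "\<mu> = \<nu>"
  proof (rule measure_eqI_lessThan)
    show "sets \<mu> = sets borel" "sets \<nu> = sets borel" by (simp_all add: \<mu>_def \<nu>_def)
    show "emeasure \<mu> {x<..} < \<infinity>" for x
    proof -
      have "emeasure \<mu> {x<..} \<le> emeasure lborel (ball (0 :: complex) 1)" unfolding \<mu> by (intro emeasure_mono) auto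
      then show ?thesis using B[of 1] by (simp add: order_le_less_trans)
    qed
    show "emeasure \<mu> {x<..} = emeasure \<nu> {x<..}" for x
    proof -
      define y where "y = max 0 x"
      have nu: "emeasure \<nu> {x<..} = (\<integral>\<^sup>+t. ennreal (2 * pi * t) * indicator {y..1} t \<partial>lborel)"
      proof -
        have "emeasure \<nu> {x<..} = (\<integral>\<^sup>+t. ennreal (2 * pi * t) * indicator {0..1} t * indicator {x<..} t \<partial>lborel)"
          unfolding \<nu>_def by (subst emeasure_density) auto
        also have "\<dots> = (\<integral>\<^sup>+t. ennreal (2 * pi * t) * indicator {y..1} t \<partial>lborel)"
        proof (rule nn_integral_cong_AE)
          show "AE t in lborel. ennreal (2 * pi * t) * indicator {0..1} t * indicator {x<..} t = ennreal (2 * pi * t) * indicator {y..1} t"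
            using AE_lborel_singleton[of x]
          proof eventually_elim
            case (elim t)
            have "t \<in> {0..1} \<and> t \<in> {x<..} \<longleftrightarrow> t \<in> {y..1}" using elim by (auto simp: y_def)
            then show ?case by (auto split: split_indicator)
          qed
        qed
        finally show ?thesis .
      qed
      show ?thesis
      proof (cases "y \<le> 1")
        case True
        have "emeasure \<nu> {x<..} = ennreal (pi * 1\<^sup>2 - pi * y\<^sup>2)"
          unfolding nu using True
          by (intro nn_integral_FTC_Icc[where F="\<lambda>t. pi * t\<^sup>2"]) (auto intro!: derivative_eq_intros simp: y_def)
        moreover have "emeasure \<mu> {x<..} = ennreal (pi * 1\<^sup>2 - pi * y\<^sup>2)"
        proof (cases "x < 0")
          case x: True
          have "{w :: complex. x < norm w} \<inter> ball 0 1 = ball 0 1" using x by (auto intro: less_le_trans)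
          then show ?thesis unfolding \<mu> using x B(1)[of 1] by (simp add: y_def)
        next
          case False
          then have xy: "y = x" "0 \<le> x" by (auto simp: y_def)
          show ?thesis
          proof (cases "x = 1")
            case True
            then have "{w :: complex. x < norm w} \<inter> ball 0 1 = {}" by auto
            then show ?thesis unfolding \<mu> using True xy by simp
          next
            case F: False
            have "{w :: complex. x < norm w} \<inter> ball 0 1 = ball 0 1 - cball 0 x" by auto
            then have "emeasure \<mu> {x<..} = emeasure lborel (ball (0 :: complex) 1 - cball 0 x)" unfolding \<mu> by simp
            also have "\<dots> = emeasure lborel (ball (0 :: complex) 1) - emeasure lborel (cball (0 :: complex) x)"
              using F True xy B(2)[of x] by (intro emeasure_Diff) auto
            also have "\<dots> = ennreal (pi * 1\<^sup>2 - pi * y\<^sup>2)" using xy B by (simp add: ennreal_minus)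
            finally show ?thesis .
          qed
        qed
        ultimately show ?thesis by simp
      next
        case False
        then have "{w :: complex. x < norm w} \<inter> ball 0 1 = {}" by (auto simp: y_def max_def split: if_splits)
        moreover have "(\<integral>\<^sup>+t. ennreal (2 * pi * t) * indicator {y..1} t \<partial>lborel) = 0"
          using False by simp
        ultimately show ?thesis unfolding \<mu> nu by simp
      qed
    qed
  qed
  have "(\<integral>\<^sup>+w. indicator (ball 0 1) (w :: complex) * \<phi> (norm w) \<partial>lborel) = (\<integral>\<^sup>+x. \<phi> x \<partial>\<mu>)"
    unfolding \<mu>_def by (subst nn_integral_distr) (auto simp: nn_integral_density)
  also have "\<dots> = (\<integral>\<^sup>+x. ennreal (2 * pi * x) * indicator {0..1} x * \<phi> x \<partial>lborel)"
    unfolding \<open>\<mu> = \<nu>\<close> \<nu>_def by (subst nn_integral_density) auto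
  finally show ?thesis .
qed

text \<open>
  The weight is the derivative of -(1/p) ((1 - x) / (1 - x + \<delta>))^p, so its integral over [0,1] is at most 1/p,
  uniformly in \<delta>. The factor x of the area element is estimated by 1.
\<close>

lemma nn_integral_radial_weight:
  assumes p: "0 < p" and d: "0 < \<delta>"
  shows "(\<integral>\<^sup>+w. indicator (ball 0 1) (w :: complex) * ennreal (\<delta> * (1 - norm w) powr (p - 1) * (1 - norm w + \<delta>) powr (- p - 1)) \<partial>lborel)
     \<le> ennreal (2 * pi / p)"
proof -
  define \<phi> where "\<phi> x = \<delta> * (1 - x) powr (p - 1) * (1 - x + \<delta>) powr (- p - 1)" for x
  define \<Phi> where "\<Phi> x = - (1 / p) * ((1 - x) powr p * (1 - x + \<delta>) powr (- p))" for x
  have "(\<phi> has_integral (\<Phi> 1 - \<Phi> 0)) {0..1}"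
  proof (rule fundamental_theorem_of_calculus_interior)
    show "continuous_on {0..1} \<Phi>"
      unfolding \<Phi>_def using p d by (intro continuous_intros continuous_on_powr') auto
    fix x :: real assume x: "x \<in> {0<..<1}"
    have e1: "(1 - x + \<delta>) powr (- p) = (1 - x + \<delta>) * (1 - x + \<delta>) powr (- p - 1)"
      using x d by (simp add: powr_diff)
    have e2: "(1 - x) powr p = (1 - x) * (1 - x) powr (p - 1)" using x by (simp add: powr_diff)
    have D: "(\<Phi> has_real_derivative (- (1 / p) * ((p * (1 - x) powr (p - 1) * (-1)) * (1 - x + \<delta>) powr (- p)
          + (1 - x) powr p * ((- p) * (1 - x + \<delta>) powr (- p - 1) * (-1))))) (at x)"
      unfolding \<Phi>_def using x d p by (auto intro!: derivative_eq_intros)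
    also have "(- (1 / p) * ((p * (1 - x) powr (p - 1) * (-1)) * (1 - x + \<delta>) powr (- p)
          + (1 - x) powr p * ((- p) * (1 - x + \<delta>) powr (- p - 1) * (-1)))) = \<phi> x"
      unfolding e1 e2 \<phi>_def using p by (simp add: field_simps)
    finally show "(\<Phi> has_vector_derivative \<phi> x) (at x)"
      by (simp add: has_real_derivative_iff_has_vector_derivative)
  qed simp
  moreover have \<phi>0: "0 \<le> \<phi> x" for x using d by (simp add: \<phi>_def)
  ultimately have I: "(\<integral>\<^sup>+x. ennreal (\<phi> x) * indicator {0..1} x \<partial>lborel) = ennreal (\<Phi> 1 - \<Phi> 0)"
    by (intro nn_integral_has_integral_lebesgue') auto
  have "\<Phi> 1 - \<Phi> 0 = (1 / p) * (1 + \<delta>) powr (- p)" using p by (simp add: \<Phi>_def)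
  also have "\<dots> \<le> 1 / p" using p d powr_mono2'[of "- p" 1 "1 + \<delta>"] by (simp add: divide_right_mono)
  finally have \<Phi>: "\<Phi> 1 - \<Phi> 0 \<le> 1 / p" .
  have [measurable]: "\<phi> \<in> borel_measurable borel" unfolding \<phi>_def by measurable
  have "(\<integral>\<^sup>+w. indicator (ball 0 1) (w :: complex) * ennreal (\<phi> (norm w)) \<partial>lborel)
      = (\<integral>\<^sup>+x. ennreal (2 * pi * x) * indicator {0..1} x * ennreal (\<phi> x) \<partial>lborel)"
    by (rule nn_integral_radial) measurable
  also have "\<dots> \<le> (\<integral>\<^sup>+x. ennreal (2 * pi) * (ennreal (\<phi> x) * indicator {0..1} x) \<partial>lborel)"
  proof (rule nn_integral_mono)
    fix x :: real
    show "ennreal (2 * pi * x) * indicator {0..1} x * ennreal (\<phi> x) \<le> ennreal (2 * pi) * (ennreal (\<phi> x) * indicator {0..1} x)"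
    proof (cases "x \<in> {0..1}")
      case True
      then have "ennreal (2 * pi * x) \<le> ennreal (2 * pi)" by (intro ennreal_leI) (simp add: mult_left_le)
      then show ?thesis using True by (simp add: mult_right_mono)
    qed simp
  qed
  also have "\<dots> = ennreal (2 * pi) * ennreal (\<Phi> 1 - \<Phi> 0)" unfolding I[symmetric] by (rule nn_integral_cmult) measurable
  also have "\<dots> \<le> ennreal (2 * pi) * ennreal (1 / p)" by (intro mult_left_mono ennreal_leI \<Phi>) simp
  also have "\<dots> = ennreal (2 * pi / p)" by (subst ennreal_mult[symmetric]) (use p in auto)
  finally show ?thesis by (simp add: \<phi>_def)
qed

text \<open>
  The density is (1 - |a|^2) (1 - |z|^2)^(p-1) / |1 - cnj a z|^(p+2) up to constants. In its mean over a circle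
  the square of the denominator is integrated exactly as a Poisson kernel, and the remaining power p is estimated
  by its maximum. With \<delta> = 1 - |a| this leaves the radial weight of the preceding lemma, because
  1 - |a| |w| is at least half of (1 - |w|) + \<delta>.
\<close>

lemma poisson_root_dirichlet:
  assumes p: "0 < p"
  obtains C where "\<And>a. norm a < 1 \<Longrightarrow> poisson_root p a \<in> dirichlet_space p \<and> dirichlet_norm p (poisson_root p a) \<le> C"
proof -
  define C1 where "C1 = (2 / p) powr p * 2 * 2 powr p * 2 powr (p + 1)"
  define C2 where "C2 = C1 * (2 * pi / p)"
  have C1: "0 \<le> C1" by (simp add: C1_def)
  have C2: "0 \<le> C2" using p C1 by (simp add: C2_def)
  have main: "poisson_root p a \<in> dirichlet_space p \<and> dirichlet_norm p (poisson_root p a) \<le> (C2 / pi + 1) powr (1 / p)"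
    if a: "norm a < 1" for a
  proof -
    define f where "f = poisson_root p a"
    define \<delta> where "\<delta> = 1 - norm a"
    have \<delta>: "0 < \<delta>" using a by (simp add: \<delta>_def)
    have fd: "f \<in> disc_analytic" unfolding f_def by (rule poisson_root_disc_analytic[OF p a])
    note na = one_minus_norm_square_pos[OF p a]
    have dens: "disc_density p f z = (2 / p) powr p * norm a powr p * (1 - (norm a)\<^sup>2) * (1 - (norm z)\<^sup>2) powr (p - 1)
        / (norm (1 - cnj a * z) powr p * (norm (1 - cnj a * z))\<^sup>2)" if z: "norm z < 1" for z
    proof -
      have "deriv f z = f z * (of_real (2 / p) * (cnj a / (1 - cnj a * z)))"
        unfolding f_def by (rule DERIV_imp_deriv[OF poisson_root_has_derivative[OF p a z]])
      then have "norm (deriv f z) powr p = norm (f z) powr p * ((2 / p) powr p * (norm a powr p / norm (1 - cnj a * z) powr p))"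
        using p by (simp add: norm_mult norm_divide powr_mult powr_divide)
      also have "norm (f z) powr p = (1 - (norm a)\<^sup>2) / (norm (1 - cnj a * z))\<^sup>2"
        unfolding f_def by (rule norm_poisson_root[OF p a z])
      finally show ?thesis using z by (simp add: disc_density_def dirichlet_density_def mult_ac)
    qed
    have [measurable]: "disc_density p f \<in> borel_measurable borel"
      by (rule disc_density_measurable[OF disc_analyticD[OF fd] p])
    have inner: "(\<integral>\<^sup>+\<theta>. ennreal (disc_density p f (cis \<theta> * w)) \<partial>circ)
        \<le> ennreal C1 * ennreal (\<delta> * (1 - norm w) powr (p - 1) * (1 - norm w + \<delta>) powr (- p - 1))" if w: "norm w < 1" for w
    proof -
      define b where "b = a * cnj w"
      have nb: "norm b = norm a * norm w" by (simp add: b_def norm_mult)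
      have b1: "norm b < 1" using norm_cnj_mult_less[OF p a w] by (simp add: nb norm_mult)
      define X where "X = 1 - norm b"
      have X: "0 < X" using b1 by (simp add: X_def)
      have Xge: "(1 - norm w + \<delta>) / 2 \<le> X"
      proof -
        have "norm b \<le> norm w" "norm b \<le> norm a" using a w by (auto simp: nb mult_left_le_one_le mult_left_le)
        then show ?thesis by (simp add: X_def \<delta>_def)
      qed
      define k where "k = (2 / p) powr p * (2 * \<delta>) * (2 powr p * (1 - norm w) powr (p - 1)) * X powr (- p)"
      have k0: "0 \<le> k" using \<delta> by (simp add: k_def)
      have pt: "disc_density p f (cis \<theta> * w) \<le> k / (1 - (norm b)\<^sup>2) * poisson b \<theta>" for \<theta>
      proof -
        have z: "norm (cis \<theta> * w) < 1" using w by (simp add: norm_mult)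
        have "1 - cnj a * (cis \<theta> * w) = cis \<theta> * cnj (cis \<theta> - b)"
          by (simp add: b_def algebra_simps cis_cnj cis_mult)
        then have n: "norm (1 - cnj a * (cis \<theta> * w)) = norm (cis \<theta> - b)"
          by (simp add: norm_mult del: complex_cnj_diff)
        have nX: "X \<le> norm (cis \<theta> - b)" unfolding X_def by (rule norm_cis_diff_ge)
        have b2: "0 < 1 - (norm b)\<^sup>2" using b1 by (simp add: abs_square_less_1)
        have "disc_density p f (cis \<theta> * w) = (2 / p) powr p * norm a powr p * (1 - (norm a)\<^sup>2) * (1 - (norm w)\<^sup>2) powr (p - 1)
            * norm (cis \<theta> - b) powr (- p) * (1 / (norm (cis \<theta> - b))\<^sup>2)"
          unfolding dens[OF z] n using w by (simp add: norm_mult powr_minus_divide)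
        also have "\<dots> \<le> k * (1 / (norm (cis \<theta> - b))\<^sup>2)"
        proof (rule mult_right_mono)
          have 1: "norm a powr p * (1 - (norm a)\<^sup>2) \<le> 1 * (2 * \<delta>)"
          proof (rule mult_mono)
            show "norm a powr p \<le> 1" using a p by (intro powr_le1) auto
            have "1 - (norm a)\<^sup>2 = \<delta> * (1 + norm a)" by (simp add: \<delta>_def power2_eq_square algebra_simps)
            also have "\<dots> \<le> \<delta> * 2" using a \<delta> by (intro mult_left_mono) auto
            finally show "1 - (norm a)\<^sup>2 \<le> 2 * \<delta>" by simp
          qed (use na in auto)
          have 2: "(1 - (norm w)\<^sup>2) powr (p - 1) \<le> 2 powr p * (1 - norm w) powr (p - 1)"
          proof -
            have "1 - (norm w)\<^sup>2 = (1 + norm w) * (1 - norm w)" by (simp add: power2_eq_square algebra_simps)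
            then have "(1 - (norm w)\<^sup>2) powr (p - 1) = (1 + norm w) powr (p - 1) * (1 - norm w) powr (p - 1)"
              using w by (simp add: powr_mult)
            also have "(1 + norm w) powr (p - 1) \<le> (1 + norm w) powr p" by (intro powr_mono) auto
            also have "\<dots> \<le> 2 powr p" using w p by (intro powr_mono2) auto
            finally show ?thesis by (simp add: mult_right_mono)
          qed
          have 3: "norm (cis \<theta> - b) powr (- p) \<le> X powr (- p)" using nX X p by (intro powr_mono2') auto
          have "(2 / p) powr p * (norm a powr p * (1 - (norm a)\<^sup>2)) * (1 - (norm w)\<^sup>2) powr (p - 1) * norm (cis \<theta> - b) powr (- p)
              \<le> (2 / p) powr p * (1 * (2 * \<delta>)) * (2 powr p * (1 - norm w) powr (p - 1)) * X powr (- p)"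
            using na \<delta> by (intro mult_mono 1 2 3 order_refl mult_nonneg_nonneg) auto
          then show "(2 / p) powr p * norm a powr p * (1 - (norm a)\<^sup>2) * (1 - (norm w)\<^sup>2) powr (p - 1) * norm (cis \<theta> - b) powr (- p) \<le> k"
            by (simp add: k_def mult.assoc)
        qed simp
        also have "\<dots> = k / (1 - (norm b)\<^sup>2) * poisson b \<theta>" using b2 by (simp add: poisson_def)
        finally show ?thesis .
      qed
      have i: "integrable circ (\<lambda>\<theta>. k / (1 - (norm b)\<^sup>2) * poisson b \<theta>)"
        using integrable_poisson_times[OF b1, of "\<lambda>_. 1" 1] by simp
      have b2: "0 < 1 - (norm b)\<^sup>2" using b1 by (simp add: abs_square_less_1)
      have "(\<integral>\<^sup>+\<theta>. ennreal (disc_density p f (cis \<theta> * w)) \<partial>circ) \<le> (\<integral>\<^sup>+\<theta>. ennreal (k / (1 - (norm b)\<^sup>2) * poisson b \<theta>) \<partial>circ)"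
        by (intro nn_integral_mono ennreal_leI pt)
      also have "\<dots> = ennreal (LINT \<theta>|circ. k / (1 - (norm b)\<^sup>2) * poisson b \<theta>)"
        using k0 b2 poisson_nonneg[OF b1] by (intro nn_integral_eq_integral i) auto
      also have "(LINT \<theta>|circ. k / (1 - (norm b)\<^sup>2) * poisson b \<theta>) = k / (1 - (norm b)\<^sup>2)"
        using integral_poisson[OF b1] by simp
      finally have E: "(\<integral>\<^sup>+\<theta>. ennreal (disc_density p f (cis \<theta> * w)) \<partial>circ) \<le> ennreal (k / (1 - (norm b)\<^sup>2))" .
      have "k / (1 - (norm b)\<^sup>2) \<le> k / X"
      proof -
        have "X \<le> 1 - (norm b)\<^sup>2" using b1 by (simp add: X_def power2_eq_square mult_left_le)
        then show ?thesis using k0 X b2 by (intro divide_left_mono) auto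
      qed
      also have "k / X = (2 / p) powr p * (2 * \<delta>) * (2 powr p * (1 - norm w) powr (p - 1)) * X powr (- p - 1)"
        using X by (simp add: k_def powr_diff)
      also have "\<dots> \<le> (2 / p) powr p * (2 * \<delta>) * (2 powr p * (1 - norm w) powr (p - 1)) * (2 powr (p + 1) * (1 - norm w + \<delta>) powr (- p - 1))"
      proof (rule mult_left_mono)
        have "X powr (- p - 1) \<le> ((1 - norm w + \<delta>) / 2) powr (- p - 1)"
          using Xge w \<delta> p by (intro powr_mono2') auto
        also have "\<dots> = (1 - norm w + \<delta>) powr (- p - 1) / 2 powr (- (p + 1))" using w \<delta> by (simp add: powr_divide)
        also have "\<dots> = 2 powr (p + 1) * (1 - norm w + \<delta>) powr (- p - 1)" unfolding powr_minus_divide[of 2] by simp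
        finally show "X powr (- p - 1) \<le> 2 powr (p + 1) * (1 - norm w + \<delta>) powr (- p - 1)" .
      qed (use \<delta> in auto)
      also have "\<dots> = C1 * (\<delta> * (1 - norm w) powr (p - 1) * (1 - norm w + \<delta>) powr (- p - 1))"
        by (simp add: C1_def)
      finally have "ennreal (k / (1 - (norm b)\<^sup>2)) \<le> ennreal (C1 * (\<delta> * (1 - norm w) powr (p - 1) * (1 - norm w + \<delta>) powr (- p - 1)))"
        by (rule ennreal_leI)
      also have "\<dots> = ennreal C1 * ennreal (\<delta> * (1 - norm w) powr (p - 1) * (1 - norm w + \<delta>) powr (- p - 1))"
        by (rule ennreal_mult'[OF C1])
      finally show ?thesis using E by (rule order_trans[rotated])
    qed
    have I: "(\<integral>\<^sup>+z. ennreal (disc_density p f z) \<partial>lborel) \<le> ennreal C2"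
    proof -
      have "(\<integral>\<^sup>+z. ennreal (disc_density p f z) \<partial>lborel) = (\<integral>\<^sup>+w. (\<integral>\<^sup>+\<theta>. ennreal (disc_density p f (cis \<theta> * w)) \<partial>circ) \<partial>lborel)"
        by (rule nn_integral_rotation_mean) measurable
      also have "\<dots> \<le> (\<integral>\<^sup>+w. ennreal C1 * (indicator (ball 0 1) (w :: complex) * ennreal (\<delta> * (1 - norm w) powr (p - 1) * (1 - norm w + \<delta>) powr (- p - 1))) \<partial>lborel)"
      proof (rule nn_integral_mono)
        fix w :: complex
        show "(\<integral>\<^sup>+\<theta>. ennreal (disc_density p f (cis \<theta> * w)) \<partial>circ)
            \<le> ennreal C1 * (indicator (ball 0 1) w * ennreal (\<delta> * (1 - norm w) powr (p - 1) * (1 - norm w + \<delta>) powr (- p - 1)))"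
        proof (cases "norm w < 1")
          case False
          then show ?thesis by (simp add: disc_density_def norm_mult)
        qed (use inner[of w] in simp)
      qed
      also have "\<dots> = ennreal C1 * (\<integral>\<^sup>+w. indicator (ball 0 1) (w :: complex) * ennreal (\<delta> * (1 - norm w) powr (p - 1) * (1 - norm w + \<delta>) powr (- p - 1)) \<partial>lborel)"
        by (rule nn_integral_cmult) (intro borel_measurable_times_ennreal borel_measurable_indicator, simp, measurable)
      also have "\<dots> \<le> ennreal C1 * ennreal (2 * pi / p)"
        by (intro mult_left_mono nn_integral_radial_weight p \<delta>) simp
      also have "\<dots> = ennreal C2" unfolding C2_def by (rule ennreal_mult[symmetric]) (use C1 p in auto)
      finally show ?thesis .
    qed
    have i: "integrable lborel (disc_density p f)"
      by (rule integrableI_nonneg) (use I in \<open>auto simp: disc_density_nonneg order_le_less_trans\<close>)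
    have fD: "f \<in> dirichlet_space p" using i fd by (simp add: dirichlet_space_integrable)
    have "integral\<^sup>L lborel (disc_density p f) \<le> C2"
      using I C2 unfolding nn_integral_disc_density[OF fD] by (simp add: ennreal_le_iff)
    moreover have "norm (f 0) powr p \<le> 1" using norm_poisson_root[OF p a, of 0] by (simp add: f_def)
    ultimately have "dirichlet_norm p f \<le> (C2 / pi + 1) powr (1 / p)"
      unfolding dirichlet_norm_eq using p integral_disc_density_nonneg[of p f]
      by (intro powr_mono2) (auto simp: divide_right_mono intro!: add_mono)
    then show ?thesis using fD by (simp add: f_def)
  qed
  show thesis by (rule that[OF main])
qed

text \<open>
  If the condition failed along points a n tending to the circle, a subsequence of the images of the test
  functions at a n would converge in H^q by compactness. Its limit is zero, since the images tend to zero
  at every point. But the derivative of the n-th image at a n is f(a n) g'(a n), where |f(a n)| is at least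
  a multiple of (1 - |a n|)^(-1/p), and this keeps the norms of the images away from zero.
\<close>

lemma little_growth_if_compact_operator:
  assumes p: "0 < p" "p < q" and \<alpha>: "\<alpha> = 1 / p - 1 / q"
    and g: "g holomorphic_on ball 0 1"
    and X: "\<And>a. norm a < 1 \<Longrightarrow> poisson_root p a \<in> X \<and> N (poisson_root p a) \<le> C"
    and comp: "compact_operator X N (hardy_space q) (hardy_dist q) (T_op g)"
  shows "little_growth \<alpha> g"
proof (rule ccontr)
  have q: "0 < q" using p by simp
  interpret H: Metric_space "hardy_space q" "hardy_dist q" by (rule Metric_space_hardy[OF q])
  have g': "deriv g holomorphic_on ball 0 1" using g by (intro holomorphic_deriv) auto
  assume "\<not> little_growth \<alpha> g"
  then obtain \<epsilon> where \<epsilon>: "0 < \<epsilon>" and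
    bad: "\<And>r. r \<in> {0..<1} \<Longrightarrow> \<exists>z. r \<le> norm z \<and> norm z < 1 \<and> \<epsilon> * (1 - norm z) powr (\<alpha> - 1) < norm (deriv g z)"
    unfolding little_growth_def by (auto simp: not_le)
  have "\<forall>n. \<exists>z. 1 - inverse (real (Suc n)) \<le> norm z \<and> norm z < 1 \<and> \<epsilon> * (1 - norm z) powr (\<alpha> - 1) < norm (deriv g z)"
    by (intro allI bad) (auto simp: field_simps)
  then obtain a where a: "\<And>n. 1 - inverse (real (Suc n)) \<le> norm (a n)" "\<And>n. norm (a n) < 1"
      "\<And>n. \<epsilon> * (1 - norm (a n)) powr (\<alpha> - 1) < norm (deriv g (a n))" by metis
  define F where "F n = poisson_root p (a n)" for n
  define \<sigma> where "\<sigma> n = T_op g (F n)" for n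
  have Fd: "F n holomorphic_on ball 0 1" for n
    unfolding F_def by (rule disc_analyticD[OF poisson_root_disc_analytic[OF p(1) a(2)]])
  have "range F \<subseteq> X \<and> (\<exists>C. \<forall>f\<in>range F. N f \<le> C)" using X a(2) by (auto simp: F_def)
  with comp have sub: "T_op g ` range F \<subseteq> hardy_space q"
    and cp: "compactin H.mtopology (H.mtopology closure_of (T_op g ` range F))"
    unfolding compact_operator_def by blast+
  have \<sigma>H: "\<sigma> n \<in> hardy_space q" for n using sub by (auto simp: \<sigma>_def)
  have "range \<sigma> \<subseteq> H.mtopology closure_of (T_op g ` range F)"
    using closure_of_subset[of "T_op g ` range F" H.mtopology] sub by (auto simp: \<sigma>_def)
  then obtain l r where l: "strict_mono (r :: nat \<Rightarrow> nat)" "limitin H.mtopology (\<sigma> \<circ> r) l sequentially"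
    using cp unfolding H.compactin_sequentially by blast
  have lH: "l \<in> hardy_space q" and d0: "(\<lambda>n. hardy_dist q (\<sigma> (r n)) l) \<longlonglongrightarrow> 0"
    using l(2) unfolding H.limitin_metric_dist_null by (auto simp: o_def)
  have D: "(\<lambda>z. \<sigma> n z - l z) \<in> hardy_space q" for n by (rule hardy_norm_diff_quasi(1)[OF \<sigma>H lH q])
  have n0: "(\<lambda>n. hardy_norm q (\<lambda>z. \<sigma> (r n) z - l z)) \<longlonglongrightarrow> 0"
  proof -
    have "(\<lambda>n. (hardy_norm q (\<lambda>z. \<sigma> (r n) z - l z) powr min 1 q) powr (1 / min 1 q)) \<longlonglongrightarrow> 0 powr (1 / min 1 q)"
      using d0 q unfolding hardy_dist_def by (intro tendsto_powr' tendsto_const) auto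
    moreover have "min 1 q \<noteq> 0" using q by auto
    ultimately show ?thesis using q hardy_norm_nonneg[OF D q] by (simp add: powr_powr)
  qed
  \<comment> \<open>the test functions tend to zero locally uniformly, so the limit vanishes\<close>
  have a1: "(\<lambda>n. 1 - (norm (a (r n)))\<^sup>2) \<longlonglongrightarrow> 0"
  proof -
    have "(\<lambda>n. norm (a n)) \<longlonglongrightarrow> 1"
    proof (rule tendsto_sandwich)
      show "(\<lambda>n. 1 - inverse (real (Suc n))) \<longlonglongrightarrow> 1"
        using tendsto_diff[OF tendsto_const[of 1] LIMSEQ_inverse_real_of_nat] by simp
      show "(\<lambda>n. 1::real) \<longlonglongrightarrow> 1" by simp
    qed (use a in \<open>auto intro!: always_eventually less_imp_le\<close>)
    then have "(\<lambda>n. norm (a (r n))) \<longlonglongrightarrow> 1" using LIMSEQ_subseq_LIMSEQ[OF _ l(1)] by (force simp: o_def)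
    then have "(\<lambda>n. 1 - (norm (a (r n)))\<^sup>2) \<longlonglongrightarrow> 1 - 1\<^sup>2" by (intro tendsto_intros)
    then show ?thesis by simp
  qed
  have lz: "l z = 0" for z
  proof (cases "norm z < 1")
    case z: True
    obtain G where G: "0 \<le> G" "\<And>w. norm w \<le> norm z \<Longrightarrow> norm (deriv g w) \<le> G"
      using disc_compact_bound[OF g' z] by metis
    define e where "e n = ((1 - (norm (a (r n)))\<^sup>2) / (1 - norm z)\<^sup>2) powr (1 / p)" for n
    have e0: "e \<longlonglongrightarrow> 0"
    proof -
      have "e \<longlonglongrightarrow> (0 / (1 - norm z)\<^sup>2) powr (1 / p)"
        unfolding e_def using z p a(2) by (intro tendsto_powr' tendsto_divide a1 tendsto_const) (auto simp: abs_square_le_1 less_imp_le)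
      then show ?thesis by simp
    qed
    have le: "norm (F (r n) w) \<le> e n" if w: "norm w \<le> norm z" for w n
    proof -
      have w1: "norm w < 1" using w z by simp
      have "norm (F (r n) w) = (norm (F (r n) w) powr p) powr (1 / p)" using p by (simp add: powr_powr)
      also have "norm (F (r n) w) powr p = (1 - (norm (a (r n)))\<^sup>2) / (norm (1 - cnj (a (r n)) * w))\<^sup>2"
        unfolding F_def by (rule norm_poisson_root[OF p(1) a(2) w1])
      also have "\<dots> powr (1 / p) \<le> e n"
        unfolding e_def
      proof (intro powr_mono2 divide_left_mono power_mono mult_pos_pos zero_less_power)
        have "norm (cnj (a (r n)) * w) \<le> 1 * norm z"
          unfolding norm_mult using a(2)[of "r n"] w by (intro mult_mono) auto
        then show "1 - norm z \<le> norm (1 - cnj (a (r n)) * w)"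
          using norm_triangle_ineq2[of 1 "cnj (a (r n)) * w"] by simp
        then show "0 < norm (1 - cnj (a (r n)) * w)" using z by linarith
      qed (use p z a(2)[of "r n"] in \<open>auto simp: abs_square_le_1 intro: less_imp_le\<close>)
      finally show ?thesis .
    qed
    have "(\<lambda>n. \<sigma> (r n) z) \<longlonglongrightarrow> 0"
    proof (rule Lim_null_comparison)
      show "eventually (\<lambda>n. norm (\<sigma> (r n) z) \<le> e n * G) sequentially"
        unfolding \<sigma>_def by (intro always_eventually allI T_op_norm_le[OF Fd g z le G(2)])
      show "(\<lambda>n. e n * G) \<longlonglongrightarrow> 0" using tendsto_mult[OF e0 tendsto_const[of G]] by simp
    qed
    moreover have "(\<lambda>n. \<sigma> (r n) z - l z) \<longlonglongrightarrow> 0"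
    proof (rule Lim_null_comparison)
      show "eventually (\<lambda>n. norm (\<sigma> (r n) z - l z) \<le> 4 powr (1 / q) * hardy_norm q (\<lambda>z. \<sigma> (r n) z - l z) * (1 - norm z) powr (- 1 / q)) sequentially"
      proof (intro always_eventually allI)
        fix n
        have "norm (\<sigma> (r n) z - l z) powr q \<le> 4 * hardy_norm q (\<lambda>z. \<sigma> (r n) z - l z) powr q * (1 - norm z) powr (- 1)"
          using hardy_growth[OF D q z] z by (simp add: powr_minus_divide)
        from powr_mult_bound_root[OF this q] show "norm (\<sigma> (r n) z - l z) \<le> 4 powr (1 / q) * hardy_norm q (\<lambda>z. \<sigma> (r n) z - l z) * (1 - norm z) powr (- 1 / q)"
          using z hardy_norm_nonneg[OF D q] by simp
      qed
      show "(\<lambda>n. 4 powr (1 / q) * hardy_norm q (\<lambda>z. \<sigma> (r n) z - l z) * (1 - norm z) powr (- 1 / q)) \<longlonglongrightarrow> 0"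
        by (rule tendsto_eq_intros n0 refl | simp)+
    qed
    ultimately have "(\<lambda>n. \<sigma> (r n) z - (\<sigma> (r n) z - l z)) \<longlonglongrightarrow> 0 - 0" by (rule tendsto_diff)
    then show ?thesis by (simp add: LIMSEQ_const_iff)
  next
    case False
    then show ?thesis using hardy_space_disc[OF lH] by (auto simp: disc_analytic_def)
  qed
  define K where "K = 2 * 8 powr (1 / q)"
  have low: "\<epsilon> * 2 powr (- 1 / p) / K \<le> hardy_norm q (\<sigma> n)" for n
  proof -
    define d where "d = 1 - norm (a n)"
    have d: "0 < d" using a(2)[of n] by (simp add: d_def)
    have na: "norm (a n) < 1" by (rule a(2))
    have "deriv (\<sigma> n) (a n) = F n (a n) * deriv g (a n)"
      unfolding \<sigma>_def by (rule DERIV_imp_deriv[OF T_op_has_field_derivative[OF Fd g na]])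
    then have up: "norm (F n (a n)) * norm (deriv g (a n)) \<le> K * d powr (- 1 - 1 / q) * hardy_norm q (\<sigma> n)"
      using hardy_deriv_growth[OF \<sigma>H q na, of n] by (simp add: norm_mult K_def d_def)
    have Fa: "2 powr (- 1 / p) * d powr (- 1 / p) \<le> norm (F n (a n))"
    proof -
      have s: "1 - (norm (a n))\<^sup>2 = d * (1 + norm (a n))" by (simp add: d_def power2_eq_square algebra_simps)
      have s0: "0 < 1 - (norm (a n))\<^sup>2" unfolding s using d by (intro mult_pos_pos) (auto intro: add_pos_nonneg)
      have s2: "1 - (norm (a n))\<^sup>2 \<le> 2 * d" unfolding s using d na by simp
      have "norm (1 - cnj (a n) * a n) = 1 - (norm (a n))\<^sup>2"
      proof -
        have "1 - cnj (a n) * a n = of_real (1 - (norm (a n))\<^sup>2)"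
          by (simp only: of_real_diff complex_norm_square) (simp add: mult.commute)
        then show ?thesis using s0 by (simp only: norm_of_real)
      qed
      then have eqp: "norm (F n (a n)) powr p = 1 / (1 - (norm (a n))\<^sup>2)"
        using norm_poisson_root[OF p(1) na na] s0 by (simp add: F_def power2_eq_square)
      have "norm (F n (a n)) = (norm (F n (a n)) powr p) powr (1 / p)" using p by (simp add: powr_powr)
      then have "norm (F n (a n)) = (1 / (1 - (norm (a n))\<^sup>2)) powr (1 / p)" unfolding eqp .
      moreover have "(1 / (2 * d)) powr (1 / p) \<le> (1 / (1 - (norm (a n))\<^sup>2)) powr (1 / p)"
        using s0 s2 d p by (intro powr_mono2 divide_left_mono) auto
      moreover have "(1 / (2 * d)) powr (1 / p) = 2 powr (- 1 / p) * d powr (- 1 / p)"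
        using d by (simp add: powr_divide powr_mult powr_minus_divide)
      ultimately show ?thesis by simp
    qed
    have "2 powr (- 1 / p) * d powr (- 1 / p) * (\<epsilon> * d powr (\<alpha> - 1)) \<le> norm (F n (a n)) * norm (deriv g (a n))"
      using Fa a(3)[of n] \<epsilon> by (intro mult_mono) (auto simp: d_def)
    also have "2 powr (- 1 / p) * d powr (- 1 / p) * (\<epsilon> * d powr (\<alpha> - 1)) = \<epsilon> * 2 powr (- 1 / p) * d powr (- 1 - 1 / q)"
    proof -
      have "- 1 - 1 / q = - 1 / p + (\<alpha> - 1)" by (simp add: \<alpha>)
      then have "d powr (- 1 - 1 / q) = d powr (- 1 / p) * d powr (\<alpha> - 1)" by (simp only: powr_add)
      then show ?thesis by simp
    qed
    finally have "\<epsilon> * 2 powr (- 1 / p) * d powr (- 1 - 1 / q) \<le> (K * hardy_norm q (\<sigma> n)) * d powr (- 1 - 1 / q)"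
      using up by (simp add: mult_ac)
    then have "\<epsilon> * 2 powr (- 1 / p) \<le> K * hardy_norm q (\<sigma> n)"
      using d by (simp add: mult_le_cancel_right)
    then show ?thesis by (simp add: K_def field_simps)
  qed
  have "(\<lambda>n. hardy_norm q (\<sigma> (r n))) \<longlonglongrightarrow> 0" using n0 by (simp add: lz)
  then have "\<epsilon> * 2 powr (- 1 / p) / K \<le> 0" by (rule LIMSEQ_le_const) (use low in auto)
  moreover have "0 < \<epsilon> * 2 powr (- 1 / p) / K" using \<epsilon> by (simp add: K_def)
  ultimately show False by simp
qed


section \<open>Growth of the derivative and smoothness on the circle\<close>

lemma little_growth_bound:
  assumes g: "g holomorphic_on ball 0 1" and lg: "little_growth \<alpha> g" and \<alpha>1: "\<alpha> \<le> 1"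
  obtains C where "0 \<le> C" "\<And>z. norm z < 1 \<Longrightarrow> norm (deriv g z) \<le> C * (1 - norm z) powr (\<alpha> - 1)"
proof -
  have g': "deriv g holomorphic_on ball 0 1" using g by (intro holomorphic_deriv) auto
  obtain r where r: "r < 1" "\<And>z. r \<le> norm z \<Longrightarrow> norm z < 1 \<Longrightarrow> norm (deriv g z) \<le> 1 * (1 - norm z) powr (\<alpha> - 1)"
    using lg[unfolded little_growth_def, rule_format, of 1] by auto
  obtain G where G: "0 \<le> G" "\<And>z. norm z \<le> r \<Longrightarrow> norm (deriv g z) \<le> G"
    using disc_compact_bound[OF g' r(1)] by metis
  have "norm (deriv g z) \<le> (1 + G) * (1 - norm z) powr (\<alpha> - 1)" if z: "norm z < 1" for z
  proof (cases "norm z \<le> r")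
    case True
    have "1 \<le> (1 - norm z) powr (\<alpha> - 1)" using z \<alpha>1 by (intro one_le_powr_nonpos) auto
    from mult_mono[OF _ this, of G "1 + G"] show ?thesis using G(1) G(2)[OF True] by simp
  next
    case False
    have "1 * (1 - norm z) powr (\<alpha> - 1) \<le> (1 + G) * (1 - norm z) powr (\<alpha> - 1)"
      using G by (intro mult_right_mono) auto
    from order_trans[OF r(2)[of z] this] show ?thesis using False z by auto
  qed
  then show ?thesis using G(1) that[of "1 + G"] by auto
qed

lemma radial_diff_le:
  assumes g: "g holomorphic_on ball 0 1" and \<alpha>: "0 < \<alpha>" "\<alpha> \<le> 1" and C: "0 \<le> C" and w: "norm w \<le> 1"
    and st: "0 \<le> s" "s \<le> t" "t < 1"
    and le: "\<And>x. s < x \<Longrightarrow> x < 1 \<Longrightarrow> norm (deriv g (of_real x * w)) \<le> C * (1 - norm (of_real x * w)) powr (\<alpha> - 1)"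
  shows "norm (g (of_real t * w) - g (of_real s * w)) \<le> C * (1 - s) powr \<alpha> / \<alpha>"
proof -
  have "norm (g (of_real t * w) - g (of_real s * w)) \<le> C * ((1 - s) powr \<alpha> - (1 - t) powr \<alpha>) / \<alpha>"
  proof (rule radial_increment_le[OF st])
    fix x :: real assume x: "0 \<le> x" "x < 1"
    have "x * norm w \<le> x" using x w by (simp add: mult_left_le)
    then show "((\<lambda>t. g (of_real t * w)) has_vector_derivative w * deriv g (of_real x * w)) (at x)"
      using x by (intro disc_radial_derivative[OF g]) (simp add: norm_mult)
  next
    fix x assume x: "s < x" "x < t"
    then have x1: "0 \<le> x" "x < 1" using st by auto
    have xw: "norm (of_real x * w) \<le> x" using x1 w by (simp add: norm_mult mult_left_le)
    have "norm (w * deriv g (of_real x * w)) \<le> 1 * (C * (1 - norm (of_real x * w)) powr (\<alpha> - 1))"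
      unfolding norm_mult[of w] using w le[OF x(1) x1(2)] by (intro mult_mono) auto
    also have "\<dots> \<le> 1 * (C * (1 - x) powr (\<alpha> - 1))"
      using xw x1 \<alpha> C by (intro mult_left_mono powr_mono2') auto
    finally show "norm (w * deriv g (of_real x * w)) \<le> C * (1 - x) powr (\<alpha> - 1)" by simp
  qed (use \<alpha> in auto)
  also have "\<dots> \<le> C * (1 - s) powr \<alpha> / \<alpha>" using \<alpha> C by (intro divide_right_mono mult_left_mono) auto
  finally show ?thesis .
qed

lemma circle_arc_diff_le:
  assumes g: "g holomorphic_on ball 0 1" and \<rho>: "0 \<le> \<rho>" "\<rho> < 1" and t: "0 < t"
    and le: "\<And>x. norm (deriv g (of_real \<rho> * cis x)) \<le> B"
  shows "norm (g (of_real \<rho> * cis (\<theta> + t)) - g (of_real \<rho> * cis \<theta>)) \<le> B * t"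
proof -
  define f' where "f' x = of_real \<rho> * (\<i> * cis x) * deriv g (of_real \<rho> * cis x)" for x
  have d: "((\<lambda>x. g (of_real \<rho> * cis x)) has_vector_derivative f' x) (at x)" for x
  proof -
    have "((\<lambda>x. of_real \<rho> * cis x) has_vector_derivative of_real \<rho> * (\<i> * cis x)) (at x)"
      unfolding has_vector_derivative_def
      by (auto intro!: derivative_eq_intros simp: scaleR_conv_of_real)
    moreover have "(g has_field_derivative deriv g (of_real \<rho> * cis x)) (at (of_real \<rho> * cis x))"
      using \<rho> by (intro holomorphic_derivI[OF g open_ball]) (auto simp: norm_mult)
    ultimately show ?thesis unfolding f'_def using field_vector_diff_chain_at by (fastforce simp: o_def)
  qed
  have "norm (g (of_real \<rho> * cis (\<theta> + t)) - g (of_real \<rho> * cis \<theta>)) \<le> B * (\<theta> + t) - B * \<theta>"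
  proof (rule differentiable_bound_general[where f="\<lambda>x. g (of_real \<rho> * cis x)" and f'=f' and \<phi>="\<lambda>x. B * x" and \<phi>'="\<lambda>x. B"])
    show "continuous_on {\<theta>..\<theta> + t} (\<lambda>x. g (of_real \<rho> * cis x))"
      using d has_vector_derivative_continuous by (intro continuous_at_imp_continuous_on ballI) blast
    fix x
    show "((\<lambda>x. B * x) has_vector_derivative B) (at x)"
      unfolding has_real_derivative_iff_has_vector_derivative[symmetric] by (auto intro!: derivative_eq_intros)
    have "norm (f' x) = \<rho> * norm (deriv g (of_real \<rho> * cis x))" using \<rho> by (simp add: f'_def norm_mult)
    also have "\<dots> \<le> 1 * norm (deriv g (of_real \<rho> * cis x))" using \<rho> by (intro mult_right_mono) auto
    finally show "norm (f' x) \<le> B" using le[of x] by simp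
  qed (use t d in \<open>auto intro!: continuous_intros\<close>)
  then show ?thesis by (simp add: algebra_simps)
qed

text \<open>
  The dilates g(r w) converge uniformly on the closed disc, because the growth of g' is integrable along radii;
  their limit is the continuous extension. For the modulus of continuity, boundary points at angular
  distance t are joined through the circle of radius 1 - t: both radial pieces contribute
  \<epsilon> t^\<alpha> / \<alpha>, and the arc contributes t times \<epsilon> t^(\<alpha> - 1).
\<close>

lemma little_lipschitz_if_little_growth:
  assumes g: "g holomorphic_on ball 0 1" and \<alpha>: "0 < \<alpha>" "\<alpha> \<le> 1" and lg: "little_growth \<alpha> g"
  shows "g \<in> little_lipschitz \<alpha>"
proof -
  obtain C where C: "0 \<le> C" "\<And>z. norm z < 1 \<Longrightarrow> norm (deriv g z) \<le> C * (1 - norm z) powr (\<alpha> - 1)"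
    using little_growth_bound[OF g lg \<alpha>(2)] by blast
  have contg: "continuous_on (ball 0 1) g" using g by (rule holomorphic_on_imp_continuous_on)
  define r where "r n = 1 - inverse (real (Suc n))" for n
  have r: "0 \<le> r n" "r n < 1" for n by (simp_all add: r_def field_simps)
  have rmono: "r m \<le> r n" if "m \<le> n" for m n using that by (simp add: r_def)
  have r1: "r \<longlonglongrightarrow> 1"
    unfolding r_def using tendsto_diff[OF tendsto_const[of 1] LIMSEQ_inverse_real_of_nat] by simp
  define f where "f n w = g (of_real (r n) * w)" for n w
  have rw: "norm (of_real x * w) < 1" if "norm w \<le> 1" "0 \<le> x" "x < 1" for x and w :: complex
    using that mult_left_le[of "norm w" x] by (simp add: norm_mult)
  have "uniformly_Cauchy_on (cball 0 1) f"
  proof (rule uniformly_Cauchy_onI')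
    fix e :: real assume e: "0 < e"
    have "(\<lambda>n. C * (1 - r n) powr \<alpha> / \<alpha>) \<longlonglongrightarrow> C * (1 - 1) powr \<alpha> / \<alpha>"
      using \<alpha> r by (intro tendsto_intros tendsto_powr' r1) (auto intro!: always_eventually less_imp_le)
    then have "(\<lambda>n. C * (1 - r n) powr \<alpha> / \<alpha>) \<longlonglongrightarrow> 0" by simp
    from order_tendstoD(2)[OF this e] obtain M where M: "\<And>m. M \<le> m \<Longrightarrow> C * (1 - r m) powr \<alpha> / \<alpha> < e"
      by (auto simp: eventually_sequentially)
    have "dist (f m w) (f n w) < e" if "norm w \<le> 1" "M \<le> m" "m < n" for w m n
    proof -
      have "norm (f n w - f m w) \<le> C * (1 - r m) powr \<alpha> / \<alpha>"
        unfolding f_def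
        by (rule radial_diff_le[OF g \<alpha> C(1) that(1) r(1) rmono r(2)])
           (use that r(1)[of m] rw in \<open>auto intro!: C(2)\<close>)
      then show ?thesis using M[OF that(2)] by (simp add: dist_norm norm_minus_commute)
    qed
    then show "\<exists>M. \<forall>x\<in>cball 0 1. \<forall>m\<ge>M. \<forall>n>m. dist (f m x) (f n x) < e"
      by (intro exI[of _ M]) auto
  qed
  then have "uniformly_convergent_on (cball 0 1) f" by (rule Cauchy_uniformly_convergent)
  then obtain G where G: "uniform_limit (cball 0 1) f G sequentially" unfolding uniformly_convergent_on_def by blast
  have Glim: "(\<lambda>n. f n w) \<longlonglongrightarrow> G w" if "norm w \<le> 1" for w
    using tendsto_uniform_limitI[OF G, of w] that by simp
  have contG: "continuous_on (cball 0 1) G"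
  proof (rule uniform_limit_theorem[OF _ G])
    show "\<forall>\<^sub>F n in sequentially. continuous_on (cball 0 1) (f n)"
      unfolding f_def using rw r
      by (intro always_eventually allI continuous_on_compose2[OF contg] continuous_intros) auto
  qed simp
  have Gg: "G z = g z" if "z \<in> ball 0 1" for z
  proof -
    have "isCont g z" using contg that continuous_on_interior interior_ball by metis
    moreover have "(\<lambda>n. of_real (r n) * z) \<longlonglongrightarrow> of_real 1 * z" by (intro tendsto_intros r1)
    ultimately have "(\<lambda>n. f n z) \<longlonglongrightarrow> g z"
      unfolding f_def using isCont_tendsto_compose by fastforce
    then show ?thesis using Glim[of z] that LIMSEQ_unique by auto
  qed
  have boundary: "norm (G w - g (of_real s * w)) \<le> \<epsilon> * (1 - s) powr \<alpha> / \<alpha>"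
    if w: "norm w \<le> 1" and s: "0 \<le> s" "s < 1" and \<epsilon>: "0 \<le> \<epsilon>"
      and le: "\<And>x. s < x \<Longrightarrow> x < 1 \<Longrightarrow> norm (deriv g (of_real x * w)) \<le> \<epsilon> * (1 - norm (of_real x * w)) powr (\<alpha> - 1)"
    for w s \<epsilon>
  proof (rule tendsto_upperbound)
    show "(\<lambda>n. norm (f n w - g (of_real s * w))) \<longlonglongrightarrow> norm (G w - g (of_real s * w))"
      by (intro tendsto_intros Glim w)
    have "eventually (\<lambda>n. s < r n) sequentially" by (rule order_tendstoD(1)[OF r1 s(2)])
    then show "\<forall>\<^sub>F n in sequentially. norm (f n w - g (of_real s * w)) \<le> \<epsilon> * (1 - s) powr \<alpha> / \<alpha>"
    proof eventually_elim
      case (elim n)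
      then show ?case unfolding f_def by (intro radial_diff_le[OF g \<alpha> \<epsilon> w s(1) _ r(2) le]) auto
    qed
  qed simp
  have "((\<lambda>t. SUP \<theta>\<in>{0..2 * pi}. norm (G (cis (\<theta> + t)) - G (cis \<theta>)) / t powr \<alpha>) \<longlongrightarrow> 0) (at_right 0)"
  proof (rule tendstoI)
    fix e :: real assume e: "0 < e"
    define \<epsilon> where "\<epsilon> = e / (2 * (2 / \<alpha> + 1))"
    have c: "0 < 2 / \<alpha> + 1" using \<alpha> by (simp add: add_pos_pos)
    have "e / (2 * d) * d = e / 2" if "d \<noteq> 0" for d :: real using that by simp
    from this[of "2 / \<alpha> + 1"] c have \<epsilon>: "0 < \<epsilon>" "\<epsilon> * (2 / \<alpha> + 1) = e / 2"
      using e by (simp_all add: \<epsilon>_def)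
    obtain s where s: "s \<in> {0..<1}" "\<And>z. s \<le> norm z \<Longrightarrow> norm z < 1 \<Longrightarrow> norm (deriv g z) \<le> \<epsilon> * (1 - norm z) powr (\<alpha> - 1)"
      using lg[unfolded little_growth_def, rule_format, OF \<epsilon>(1)] by blast
    show "\<forall>\<^sub>F t in at_right 0. dist (SUP \<theta>\<in>{0..2 * pi}. norm (G (cis (\<theta> + t)) - G (cis \<theta>)) / t powr \<alpha>) 0 < e"
    proof (rule eventually_at_rightI)
      fix t assume t: "t \<in> {0<..<1 - s}"
      define \<rho> where "\<rho> = 1 - t"
      have \<rho>: "0 \<le> \<rho>" "\<rho> < 1" "s \<le> \<rho>" using t s by (auto simp: \<rho>_def)
      have bd: "norm (G (cis \<theta>) - g (of_real \<rho> * cis \<theta>)) \<le> \<epsilon> * t powr \<alpha> / \<alpha>" for \<theta>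
      proof -
        have "norm (G (cis \<theta>) - g (of_real \<rho> * cis \<theta>)) \<le> \<epsilon> * (1 - \<rho>) powr \<alpha> / \<alpha>"
          using \<rho> \<epsilon> by (intro boundary s(2)) (auto simp: norm_mult)
        then show ?thesis by (simp add: \<rho>_def)
      qed
      have arc: "norm (g (of_real \<rho> * cis (\<theta> + t)) - g (of_real \<rho> * cis \<theta>)) \<le> \<epsilon> * t powr \<alpha>" for \<theta>
      proof -
        have "norm (g (of_real \<rho> * cis (\<theta> + t)) - g (of_real \<rho> * cis \<theta>)) \<le> (\<epsilon> * (1 - \<rho>) powr (\<alpha> - 1)) * t"
        proof (rule circle_arc_diff_le[OF g \<rho>(1,2)])
          fix x
          have "norm (of_real \<rho> * cis x) = \<rho>" using \<rho> by (simp add: norm_mult)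
          then show "norm (deriv g (of_real \<rho> * cis x)) \<le> \<epsilon> * (1 - \<rho>) powr (\<alpha> - 1)"
            using s(2)[of "of_real \<rho> * cis x"] \<rho> by simp
        qed (use t in simp)
        also have "\<dots> = \<epsilon> * t powr \<alpha>" using t by (simp add: \<rho>_def powr_diff)
        finally show ?thesis .
      qed
      have est: "norm (G (cis (\<theta> + t)) - G (cis \<theta>)) / t powr \<alpha> \<le> e / 2" for \<theta>
      proof -
        define A where "A = G (cis (\<theta> + t)) - g (of_real \<rho> * cis (\<theta> + t))"
        define B where "B = g (of_real \<rho> * cis (\<theta> + t)) - g (of_real \<rho> * cis \<theta>)"
        define D where "D = G (cis \<theta>) - g (of_real \<rho> * cis \<theta>)"
        have "G (cis (\<theta> + t)) - G (cis \<theta>) = A + B - D" by (simp add: A_def B_def D_def)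
        then have "norm (G (cis (\<theta> + t)) - G (cis \<theta>)) \<le> norm A + norm B + norm D"
          using norm_triangle_ineq4[of "A + B" D] norm_triangle_ineq[of A B] by simp
        also have "\<dots> \<le> \<epsilon> * t powr \<alpha> / \<alpha> + \<epsilon> * t powr \<alpha> + \<epsilon> * t powr \<alpha> / \<alpha>"
          unfolding A_def B_def D_def by (intro add_mono bd arc)
        also have "\<dots> = \<epsilon> * (2 / \<alpha> + 1) * t powr \<alpha>" by (simp add: algebra_simps)
        finally show ?thesis using t \<epsilon> by (simp add: pos_divide_le_eq)
      qed
      have "(SUP \<theta>\<in>{0..2 * pi}. norm (G (cis (\<theta> + t)) - G (cis \<theta>)) / t powr \<alpha>) \<le> e / 2"
        by (rule cSUP_least) (use est in auto)
      moreover have "0 \<le> (SUP \<theta>\<in>{0..2 * pi}. norm (G (cis (\<theta> + t)) - G (cis \<theta>)) / t powr \<alpha>)"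
      proof (rule cSUP_upper2[of _ _ 0])
        show "bdd_above ((\<lambda>\<theta>. norm (G (cis (\<theta> + t)) - G (cis \<theta>)) / t powr \<alpha>) ` {0..2 * pi})"
          by (rule bdd_aboveI2[where M="e / 2"]) (rule est)
      qed auto
      ultimately show "dist (SUP \<theta>\<in>{0..2 * pi}. norm (G (cis (\<theta> + t)) - G (cis \<theta>)) / t powr \<alpha>) 0 < e"
        using e by (simp add: dist_real_def)
    qed (use s in auto)
  qed
  then show ?thesis
    unfolding little_lipschitz_def using g contG Gg by blast
qed

text \<open>
  Periodicity extends the estimate to all angles, which makes it available for backward increments too.
\<close>

lemma little_lipschitz_uniform:
  assumes cont: "continuous_on (cball 0 1) G"
    and lim: "((\<lambda>t. SUP \<theta>\<in>{0..2 * pi}. norm (G (cis (\<theta> + t)) - G (cis \<theta>) :: complex) / t powr \<alpha>) \<longlongrightarrow> 0) (at_right 0)"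
    and \<epsilon>: "0 < \<epsilon>"
  obtains t0 where "0 < t0" "\<And>t \<theta>. 0 < t \<Longrightarrow> t < t0 \<Longrightarrow> norm (G (cis (\<theta> + t)) - G (cis \<theta>)) \<le> \<epsilon> * t powr \<alpha>"
proof -
  obtain B where B: "\<And>x. norm (G (cis x)) \<le> B"
    using continuous_on_bounded_circle[OF continuous_on_subset[OF cont sphere_cball]] by blast
  obtain t0 where t0: "0 < t0" and sup: "\<And>t. 0 < t \<Longrightarrow> t < t0 \<Longrightarrow>
      dist (SUP \<theta>\<in>{0..2 * pi}. norm (G (cis (\<theta> + t)) - G (cis \<theta>)) / t powr \<alpha>) 0 < \<epsilon>"
    using tendstoD[OF lim \<epsilon>] unfolding eventually_at_right_field by auto
  have "norm (G (cis (\<theta> + t)) - G (cis \<theta>)) \<le> \<epsilon> * t powr \<alpha>" if t: "0 < t" "t < t0" for t \<theta>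
  proof -
    define \<phi> where "\<phi> = Arg2pi (cis \<theta>)"
    have \<phi>: "\<phi> \<in> {0..2 * pi}" using Arg2pi[of "cis \<theta>"] by (simp add: \<phi>_def)
    have c: "cis \<phi> = cis \<theta>" using Arg2pi_eq[of "cis \<theta>"] by (simp add: \<phi>_def cis_conv_exp)
    have ct: "cis (\<phi> + t) = cis (\<theta> + t)" by (simp add: cis_mult[symmetric] c)
    have "bdd_above ((\<lambda>\<theta>. norm (G (cis (\<theta> + t)) - G (cis \<theta>)) / t powr \<alpha>) ` {0..2 * pi})"
    proof (rule bdd_aboveI2)
      fix x
      have "norm (G (cis (x + t)) - G (cis x)) \<le> B + B"
        by (rule order_trans[OF norm_triangle_ineq4 add_mono[OF B B]])
      then show "norm (G (cis (x + t)) - G (cis x)) / t powr \<alpha> \<le> (B + B) / t powr \<alpha>"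
        by (rule divide_right_mono) simp
    qed
    from cSUP_upper[OF \<phi> this] sup[OF t]
    have "norm (G (cis (\<phi> + t)) - G (cis \<phi>)) / t powr \<alpha> \<le> \<epsilon>" by (simp add: dist_real_def)
    then show ?thesis using t by (simp add: c ct pos_divide_le_eq)
  qed
  then show ?thesis using t0 that by blast
qed

lemma norm_one_minus_cis_ge:
  assumes "0 \<le> t" "t \<le> pi"
  shows "t / 2 \<le> norm (1 - cis t)"
proof -
  define x where "x = t / 2"
  have x: "0 \<le> x" "x \<le> 16 / 10" using assms pi_approx by (auto simp: x_def)
  \<comment> \<open>Taylor gives sin x \<ge> x - x^3 / 6, and x^2 / 6 \<le> 1/2 because \<pi> / 2 \<le> 16/10\<close>
  have "\<bar>sin x - (\<Sum>m<3. sin_coeff m * x ^ m)\<bar> \<le> inverse (fact 3) * \<bar>x\<bar> ^ 3" by (rule Maclaurin_sin_bound)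
  also have "(\<Sum>m<3. sin_coeff m * x ^ m) = x" by (simp add: eval_nat_numeral sin_coeff_def)
  finally have "\<bar>sin x - x\<bar> \<le> x ^ 3 / 6" using x by (simp add: fact_numeral)
  then have "x - x ^ 3 / 6 \<le> sin x" by linarith
  moreover have "x ^ 3 / 6 \<le> x / 2"
  proof -
    have "x * x \<le> 16 / 10 * (16 / 10)" using x by (intro mult_mono) auto
    then have "x * (x * x) \<le> x * 3" using x by (intro mult_left_mono) auto
    then show ?thesis by (simp add: power3_eq_cube)
  qed
  ultimately have s: "x / 2 \<le> sin x" by linarith
  have "(norm (1 - cis t))\<^sup>2 = 2 - 2 * cos t"
    unfolding cmod_power2 using sin_cos_squared_add[of t] by (simp add: power2_eq_square algebra_simps)
  also have "\<dots> = (2 * sin x)\<^sup>2"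
    using cos_double_sin[of x] by (simp add: x_def power2_eq_square)
  finally have "norm (1 - cis t) = \<bar>2 * sin x\<bar>" by (metis abs_norm_cancel power2_eq_iff abs_of_nonneg abs_ge_zero abs_minus_cancel)
  then show ?thesis using s x by (simp add: x_def)
qed

text \<open>
  An arc of length \<theta> is divided into n equal parts. The increments over the parts are o(1/n) uniformly, so
  the increment over the arc vanishes: G is constant on the circle, and by the maximum principle in the
  disc.
\<close>

lemma little_growth_if_little_lipschitz_1:
  assumes "g \<in> little_lipschitz 1"
  shows "little_growth 1 g"
proof -
  obtain G where g: "g holomorphic_on ball 0 1" and cont: "continuous_on (cball 0 1) G"
    and Gg: "\<And>z. z \<in> ball 0 1 \<Longrightarrow> G z = g z"
    and lim: "((\<lambda>t. SUP \<theta>\<in>{0..2 * pi}. norm (G (cis (\<theta> + t)) - G (cis \<theta>)) / t powr 1) \<longlongrightarrow> 0) (at_right 0)"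
    using assms unfolding little_lipschitz_def by blast
  have const: "G (cis \<theta>) = G (cis 0)" if \<theta>: "0 < \<theta>" for \<theta>
  proof -
    have "norm (G (cis \<theta>) - G (cis 0)) \<le> 0 + e" if e: "0 < e" for e
    proof -
      obtain t0 where t0: "0 < t0" and le: "\<And>t x. 0 < t \<Longrightarrow> t < t0 \<Longrightarrow> norm (G (cis (x + t)) - G (cis x)) \<le> e / \<theta> * t powr 1"
        using little_lipschitz_uniform[OF cont lim, of "e / \<theta>"] e \<theta> by (metis divide_pos_pos)
      obtain n where n: "\<theta> / t0 < real n" using reals_Archimedean2 by blast
      have n0: "0 < real n" using n \<theta> t0 by (meson divide_pos_pos less_trans)
      define t where "t = \<theta> / real n"
      have t: "0 < t" "t < t0" using n n0 \<theta> t0 by (auto simp: t_def field_simps)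
      have "norm (G (cis (real k * t)) - G (cis 0)) \<le> real k * (e / \<theta> * t)" for k
      proof (induction k)
        case (Suc k)
        have a: "real (Suc k) * t = real k * t + t" by (simp add: algebra_simps)
        have "norm (G (cis (real (Suc k) * t)) - G (cis 0))
            \<le> norm (G (cis (real k * t + t)) - G (cis (real k * t))) + norm (G (cis (real k * t)) - G (cis 0))"
          unfolding a using norm_triangle_ineq[of "G (cis (real k * t + t)) - G (cis (real k * t))" "G (cis (real k * t)) - G (cis 0)"] by simp
        also have "\<dots> \<le> e / \<theta> * t + real k * (e / \<theta> * t)" using le[OF t, of "real k * t"] Suc t by simp
        finally show ?case by (simp add: distrib_right add_divide_distrib)
      qed simp
      from this[of n] show ?thesis using n0 \<theta> by (simp add: t_def)
    qed
    then have "norm (G (cis \<theta>) - G (cis 0)) \<le> 0" by (rule field_le_epsilon)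
    then show ?thesis by simp
  qed
  have holG: "G holomorphic_on ball 0 1" using g by (rule holomorphic_transform) (simp add: Gg)
  have "g z = G 1" if z: "z \<in> ball 0 1" for z
  proof -
    have "norm (G z - G 1) \<le> 0"
    proof (rule maximum_modulus_frontier[where S="cball 0 1" and f="\<lambda>z. G z - G 1"])
      fix w :: complex assume "w \<in> frontier (cball 0 1)"
      then have w: "norm w = 1" by simp
      define \<theta> where "\<theta> = Arg2pi w + 2 * pi"
      have "cis \<theta> = cis (Arg2pi w) * cis (2 * pi)" by (simp only: \<theta>_def cis_mult)
      also have "cis (2 * pi) = 1" by (simp add: complex_eq_iff)
      also have "cis (Arg2pi w) * 1 = w" using Arg2pi_eq[of w] w by (simp add: cis_conv_exp)
      finally have "cis \<theta> = w" .
      moreover have "0 < \<theta>" using Arg2pi[of w] pi_gt_zero unfolding \<theta>_def by linarith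
      ultimately show "norm (G w - G 1) \<le> 0" using const[of \<theta>] by simp
    qed (use cont holG z in \<open>auto intro!: continuous_intros holomorphic_intros\<close>)
    then show ?thesis using Gg[OF z] by simp
  qed
  then have "deriv g z = 0" if "norm z < 1" for z
  proof -
    have "(g has_field_derivative 0) (at z)"
      by (rule has_field_derivative_transform_within_open[OF DERIV_const open_ball[of 0 1]])
         (use that \<open>\<And>z. z \<in> ball 0 1 \<Longrightarrow> g z = G 1\<close> in auto)
    then show ?thesis by (rule DERIV_imp_deriv)
  qed
  then show ?thesis unfolding little_growth_def by (auto intro!: bexI[of _ 0])
qed

text \<open>
  Cauchy's formula for the derivative, after subtracting from G its value at cis \<theta> = z / |z| and rotating
  this point to 1. With \<delta> = 1 - |z| and \<tau> the angular distance to 1, the distance of the point on the circle to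
  |z| is at least (\<delta> + \<tau>) / 5, so the integrand is at most 25 \<epsilon> (\<delta> + \<tau>)^(\<alpha> - 2) for \<tau> < t0, which
  has an antiderivative because \<alpha> < 1; for \<tau> \<ge> t0 it is bounded in terms of B and t0.
  The bounds for \<tau> = t and \<tau> = 2 \<pi> - t are added, so that no case distinction enters the integral.
\<close>

lemma deriv_bound_of_boundary_modulus:
  assumes g: "g holomorphic_on ball 0 1" and cont: "continuous_on (cball 0 1) G"
    and Gg: "\<And>z. z \<in> ball 0 1 \<Longrightarrow> G z = g z" and \<alpha>: "0 < \<alpha>" "\<alpha> < 1" and \<epsilon>: "0 \<le> \<epsilon>" and t0: "0 < t0"
    and mod: "\<And>t \<theta>. 0 < t \<Longrightarrow> t < t0 \<Longrightarrow> norm (G (cis (\<theta> + t)) - G (cis \<theta>)) \<le> \<epsilon> * t powr \<alpha>"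
    and B: "\<And>x. norm (G (cis x)) \<le> B" and z: "norm z < 1"
  shows "norm (deriv g z) \<le> 25 * \<epsilon> / (1 - \<alpha>) * (1 - norm z) powr (\<alpha> - 1) + 100 * B / t0\<^sup>2"
proof -
  obtain \<theta> where zz: "z = of_real (norm z) * cis \<theta>" by (metis rcis_cmod_Arg rcis_def)
  define \<rho> where "\<rho> = norm z"
  define \<delta> where "\<delta> = 1 - \<rho>"
  have \<rho>: "0 \<le> \<rho>" "\<rho> < 1" using z by (auto simp: \<rho>_def)
  have \<delta>: "0 < \<delta>" using \<rho> by (simp add: \<delta>_def)
  have B0: "0 \<le> B" using order_trans[OF norm_ge_zero B[of 0]] .
  define F where "F w = G (cis \<theta> * w) - G (cis \<theta>)" for w
  define K where "K = 2 * B / t0\<^sup>2"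
  have K0: "0 \<le> K" using B0 by (simp add: K_def)
  have holG: "G holomorphic_on ball 0 1" using g by (rule holomorphic_transform) (simp add: Gg)
  have cF: "continuous_on (cball 0 1) F"
    unfolding F_def by (intro continuous_intros continuous_on_compose2[OF cont]) (auto simp: norm_mult)
  have hF: "F holomorphic_on ball 0 1"
    unfolding F_def
    by (intro holomorphic_intros holomorphic_on_compose_gen[OF _ holG, of "\<lambda>w. cis \<theta> * w", unfolded o_def])
       (auto simp: norm_mult intro!: holomorphic_intros)
  have dF: "deriv F (of_real \<rho>) = cis \<theta> * deriv g z"
  proof (rule DERIV_imp_deriv)
    have zc: "cis \<theta> * of_real \<rho> = z" using zz by (simp add: \<rho>_def mult.commute)
    have "(G has_field_derivative deriv g z) (at z)"
      by (rule has_field_derivative_transform_within_open[OF holomorphic_derivI[OF g open_ball] open_ball[of 0 1]])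
         (use z Gg in auto)
    then have "(G has_field_derivative deriv g z) (at (cis \<theta> * of_real \<rho>))" by (simp only: zc)
    moreover have "((\<lambda>w. cis \<theta> * w) has_field_derivative cis \<theta>) (at (of_real \<rho>))"
      by (auto intro!: derivative_eq_intros)
    ultimately have "((\<lambda>w. G (cis \<theta> * w)) has_field_derivative deriv g z * cis \<theta>) (at (of_real \<rho>))"
      by (rule DERIV_chain2)
    from DERIV_diff[OF this DERIV_const[of "G (cis \<theta>)"]]
    show "(F has_field_derivative cis \<theta> * deriv g z) (at (of_real \<rho>))"
      by (simp add: F_def[abs_def] mult.commute)
  qed
  have pw: "norm (F w) / (norm (w - of_real \<rho>))\<^sup>2 \<le> 25 * (\<epsilon> * (\<delta> + \<tau>) powr (\<alpha> - 2) + K)"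
    if \<tau>: "0 \<le> \<tau>" "\<tau> \<le> pi" and w: "w = cis \<tau> \<or> w = cis (- \<tau>)" for \<tau> w
  proof -
    have nw: "norm w = 1" using w by auto
    have "norm (1 - w) = norm (1 - cis \<tau>)"
    proof -
      have "1 - cis (- \<tau>) = cnj (1 - cis \<tau>)" by (simp add: cis_cnj)
      then show ?thesis using w by (metis complex_mod_cnj)
    qed
    then have t2: "\<tau> / 2 \<le> norm (1 - w)" using norm_one_minus_cis_ge[OF \<tau>] by simp
    have d1: "\<delta> \<le> norm (w - of_real \<rho>)"
      using norm_triangle_ineq2[of w "of_real \<rho>"] nw \<rho> by (simp add: \<delta>_def)
    have "norm (1 - w) \<le> norm (1 - of_real \<rho> :: complex) + norm (of_real \<rho> - w)"
      using norm_triangle_ineq[of "1 - of_real \<rho>" "of_real \<rho> - w"] by simp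
    also have "norm (1 - of_real \<rho> :: complex) = \<delta>"
      using \<rho> by (metis \<delta>_def abs_of_pos \<delta> norm_of_real of_real_1 of_real_diff)
    finally have low: "(\<delta> + \<tau>) / 5 \<le> norm (w - of_real \<rho>)" using t2 d1 by (simp add: norm_minus_commute)
    have dt: "0 < \<delta> + \<tau>" using \<delta> \<tau> by simp
    have "norm (F w) / (norm (w - of_real \<rho>))\<^sup>2 \<le> norm (F w) / ((\<delta> + \<tau>) / 5)\<^sup>2"
      using low dt d1 \<delta> by (intro divide_left_mono power_mono mult_pos_pos zero_less_power) auto
    also have "\<dots> = 25 * (norm (F w) / (\<delta> + \<tau>)\<^sup>2)" by (simp add: power_divide)
    also have "norm (F w) / (\<delta> + \<tau>)\<^sup>2 \<le> \<epsilon> * (\<delta> + \<tau>) powr (\<alpha> - 2) + K"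
    proof (cases "\<tau> < t0")
      case True
      have "norm (F w) \<le> \<epsilon> * \<tau> powr \<alpha>"
      proof (cases "\<tau> = 0")
        case True
        then have "w = 1" using w by auto
        then show ?thesis using \<epsilon> by (simp add: F_def)
      next
        case F: False
        show ?thesis
          using w
        proof
          assume "w = cis \<tau>"
          then show ?thesis using mod[of \<tau> \<theta>] F \<tau> True by (simp add: F_def cis_mult)
        next
          assume "w = cis (- \<tau>)"
          then show ?thesis using mod[of \<tau> "\<theta> - \<tau>"] F \<tau> True by (simp add: F_def cis_mult norm_minus_commute)
        qed
      qed
      also have "\<dots> \<le> \<epsilon> * (\<delta> + \<tau>) powr \<alpha>" using \<epsilon> \<tau> \<delta> \<alpha> by (intro mult_left_mono powr_mono2) auto
      finally have "norm (F w) / (\<delta> + \<tau>)\<^sup>2 \<le> \<epsilon> * (\<delta> + \<tau>) powr \<alpha> / (\<delta> + \<tau>)\<^sup>2" by (rule divide_right_mono) simp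
      also have "\<dots> = \<epsilon> * (\<delta> + \<tau>) powr (\<alpha> - 2)" using dt by (simp add: powr_diff powr_numeral)
      finally show ?thesis using K0 by linarith
    next
      case False
      have "F w = G (cis \<theta> * w) - G (cis \<theta>)" by (simp add: F_def)
      moreover obtain y where "cis \<theta> * w = cis y" using w by (auto simp: cis_mult)
      ultimately have "norm (F w) \<le> B + B" using order_trans[OF norm_triangle_ineq4 add_mono[OF B B]] by metis
      moreover have "t0\<^sup>2 \<le> (\<delta> + \<tau>)\<^sup>2" using False t0 \<delta> by (intro power_mono) auto
      ultimately have "norm (F w) / (\<delta> + \<tau>)\<^sup>2 \<le> K"
        unfolding K_def using t0 B0 by (intro frac_le) auto
      moreover have "0 \<le> \<epsilon> * (\<delta> + \<tau>) powr (\<alpha> - 2)" using \<epsilon> by simp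
      ultimately show ?thesis by linarith
    qed
    finally show ?thesis by simp
  qed
  define D where "D t = 25 * ((\<epsilon> * (\<delta> + t) powr (\<alpha> - 2) + K) + (\<epsilon> * (\<delta> + 2 * pi - t) powr (\<alpha> - 2) + K))" for t
  define c where "c = 1 / (\<alpha> - 1)"
  have c: "c * (\<alpha> - 1) = 1" "\<epsilon> / (1 - \<alpha>) = - (\<epsilon> * c)" using \<alpha> by (auto simp: c_def divide_simps algebra_simps)
  define E where "E t = 25 * (\<epsilon> * c * (\<delta> + t) powr (\<alpha> - 1) - \<epsilon> * c * (\<delta> + 2 * pi - t) powr (\<alpha> - 1) + 2 * K * t)" for t
  have DE: "(D has_integral (E (2 * pi) - E 0)) {0..2 * pi}"
  proof (rule fundamental_theorem_of_calculus)
    fix t assume t: "t \<in> {0..2 * pi}"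
    have pos: "0 < \<delta> + t" "0 < \<delta> + 2 * pi - t" using t \<delta> by auto
    define X where "X = (\<delta> + t) powr (\<alpha> - 2)"
    define Y where "Y = (\<delta> + 2 * pi - t) powr (\<alpha> - 2)"
    have e: "\<alpha> - 1 - 1 = \<alpha> - 2" by simp
    have d1: "((\<lambda>t. (\<delta> + t) powr (\<alpha> - 1)) has_real_derivative (\<alpha> - 1) * X) (at t)"
      using pos by (auto intro!: derivative_eq_intros simp: e X_def)
    have d2: "((\<lambda>t. (\<delta> + 2 * pi - t) powr (\<alpha> - 1)) has_real_derivative - ((\<alpha> - 1) * Y)) (at t)"
      using pos by (auto intro!: derivative_eq_intros simp: e Y_def)
    have "(E has_real_derivative 25 * (\<epsilon> * c * ((\<alpha> - 1) * X) - \<epsilon> * c * (- ((\<alpha> - 1) * Y)) + 2 * K)) (at t)"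
      unfolding E_def by (rule derivative_eq_intros d1 d2 refl | simp)+
    also have "25 * (\<epsilon> * c * ((\<alpha> - 1) * X) - \<epsilon> * c * (- ((\<alpha> - 1) * Y)) + 2 * K)
        = 25 * (\<epsilon> * (c * (\<alpha> - 1)) * X + \<epsilon> * (c * (\<alpha> - 1)) * Y + 2 * K)"
      by (simp add: mult.assoc)
    also have "\<dots> = D t" unfolding c by (simp add: D_def X_def Y_def)
    finally show "(E has_vector_derivative D t) (at t within {0..2 * pi})"
      by (simp add: has_real_derivative_iff_has_vector_derivative has_vector_derivative_at_within)
  qed simp
  have EE: "E (2 * pi) - E 0 \<le> 50 * (\<epsilon> / (1 - \<alpha>) * \<delta> powr (\<alpha> - 1)) + 100 * pi * K"
  proof -
    have "E (2 * pi) - E 0 = 50 * (\<epsilon> / (1 - \<alpha>) * (\<delta> powr (\<alpha> - 1) - (\<delta> + 2 * pi) powr (\<alpha> - 1))) + 100 * pi * K"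
      unfolding c by (simp add: E_def algebra_simps)
    also have "\<epsilon> / (1 - \<alpha>) * (\<delta> powr (\<alpha> - 1) - (\<delta> + 2 * pi) powr (\<alpha> - 1)) \<le> \<epsilon> / (1 - \<alpha>) * \<delta> powr (\<alpha> - 1)"
      using \<epsilon> \<alpha> by (intro mult_left_mono) auto
    finally show ?thesis by simp
  qed
  define f where "f t = F (cis t) / (cis t - of_real \<rho>) ^ 2 * \<i> * cis t" for t
  have "((\<lambda>u. F u / (u - of_real \<rho>) ^ (Suc 1)) has_contour_integral ((2 * pi * \<i>) / fact 1 * (deriv ^^ 1) F (of_real \<rho>))) (circlepath 0 1)"
    using \<rho> by (intro Cauchy_has_contour_integral_higher_derivative_circlepath cF hF) auto
  then have fI: "(f has_integral (2 * pi * \<i> * deriv F (of_real \<rho>))) {0..2 * pi}"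
    unfolding circlepath_def f_def
    by (subst (asm) has_contour_integral_part_circlepath_iff) (auto simp: power2_eq_square)
  have "norm (integral {0..2 * pi} f) \<le> integral {0..2 * pi} D"
  proof (rule Henstock_Kurzweil_Integration.integral_norm_bound_integral)
    show "f integrable_on {0..2 * pi}" "D integrable_on {0..2 * pi}" using fI DE by blast+
    fix t assume t: "t \<in> {0..2 * pi}"
    have nf: "norm (f t) = norm (F (cis t)) / (norm (cis t - of_real \<rho>))\<^sup>2"
      by (simp add: f_def norm_mult norm_divide norm_power)
    have nn: "0 \<le> \<epsilon> * (\<delta> + t) powr (\<alpha> - 2)" "0 \<le> \<epsilon> * (\<delta> + 2 * pi - t) powr (\<alpha> - 2)" using \<epsilon> by auto
    show "norm (f t) \<le> D t"
    proof (cases "t \<le> pi")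
      case True
      then show ?thesis using pw[of t "cis t"] t nn K0 unfolding nf D_def by auto
    next
      case False
      have "cis t = cis (- (2 * pi - t))" by (simp add: cis_mult[symmetric] cis_divide[symmetric])
      then show ?thesis using pw[of "2 * pi - t" "cis t"] t False nn K0 unfolding nf D_def
        by (simp add: add_diff_eq)
    qed
  qed
  then have "2 * pi * norm (deriv g z) \<le> 50 * (\<epsilon> / (1 - \<alpha>) * \<delta> powr (\<alpha> - 1)) + 100 * pi * K"
    using EE integral_unique[OF fI] integral_unique[OF DE] by (simp add: norm_mult dF)
  moreover have "x \<le> 25 * y / pi + 50 * K" if "2 * pi * x \<le> 50 * y + 100 * pi * K" for x y
    using that by (simp add: field_simps)
  ultimately have "norm (deriv g z) \<le> (25 * (\<epsilon> / (1 - \<alpha>) * \<delta> powr (\<alpha> - 1))) / pi + 50 * K"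
    by blast
  also have "(25 * (\<epsilon> / (1 - \<alpha>) * \<delta> powr (\<alpha> - 1))) / pi \<le> (25 * (\<epsilon> / (1 - \<alpha>) * \<delta> powr (\<alpha> - 1))) / 1"
    using \<epsilon> \<alpha> pi_ge_two by (intro divide_left_mono) auto
  finally show ?thesis by (simp add: K_def \<delta>_def \<rho>_def)
qed

lemma little_growth_if_little_lipschitz:
  assumes lip: "g \<in> little_lipschitz \<alpha>" and \<alpha>: "0 < \<alpha>" "\<alpha> \<le> 1"
  shows "little_growth \<alpha> g"
proof (cases "\<alpha> = 1")
  case True
  then show ?thesis using little_growth_if_little_lipschitz_1 lip by simp
next
  case False
  then have \<alpha>1: "\<alpha> < 1" using \<alpha> by simp
  obtain G where g: "g holomorphic_on ball 0 1" and cont: "continuous_on (cball 0 1) G"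
    and Gg: "\<And>z. z \<in> ball 0 1 \<Longrightarrow> G z = g z"
    and lim: "((\<lambda>t. SUP \<theta>\<in>{0..2 * pi}. norm (G (cis (\<theta> + t)) - G (cis \<theta>)) / t powr \<alpha>) \<longlongrightarrow> 0) (at_right 0)"
    using lip unfolding little_lipschitz_def by blast
  obtain B where B: "\<And>x. norm (G (cis x)) \<le> B"
    using continuous_on_bounded_circle[OF continuous_on_subset[OF cont sphere_cball]] by blast
  show ?thesis
    unfolding little_growth_def
  proof (intro allI impI)
    fix e :: real assume e: "0 < e"
    define \<epsilon> where "\<epsilon> = e * (1 - \<alpha>) / 50"
    have "25 * (e * d / 50) / d = e / 2" if "d \<noteq> 0" for d :: real using that by simp
    from this[of "1 - \<alpha>"] have \<epsilon>: "0 < \<epsilon>" "25 * \<epsilon> / (1 - \<alpha>) = e / 2"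
      using e \<alpha>1 by (simp_all add: \<epsilon>_def)
    obtain t0 where t0: "0 < t0" "\<And>t \<theta>. 0 < t \<Longrightarrow> t < t0 \<Longrightarrow> norm (G (cis (\<theta> + t)) - G (cis \<theta>)) \<le> \<epsilon> * t powr \<alpha>"
      using little_lipschitz_uniform[OF cont lim \<epsilon>(1)] by blast
    define L where "L = 100 * B / t0\<^sup>2"
    define Q where "Q = 1 + \<bar>2 * L / e\<bar>"
    have Q: "1 \<le> Q" by (simp add: Q_def)
    \<comment> \<open>below the depth \<delta>0 the constant L is absorbed, as (1 - |z|)^(\<alpha> - 1) tends to infinity\<close>
    define \<delta>0 where "\<delta>0 = Q powr (1 / (\<alpha> - 1))"
    have \<delta>0: "0 < \<delta>0" "\<delta>0 \<le> 1"
      using Q \<alpha>1 powr_mono2'[of "1 / (\<alpha> - 1)" 1 Q] by (auto simp: \<delta>0_def)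
    have big: "L \<le> e / 2 * d powr (\<alpha> - 1)" if d: "0 < d" "d \<le> \<delta>0" for d
    proof -
      have "Q = \<delta>0 powr (\<alpha> - 1)" using \<alpha>1 Q by (simp add: \<delta>0_def powr_powr)
      also have "\<dots> \<le> d powr (\<alpha> - 1)" using d \<alpha>1 by (intro powr_mono2') auto
      finally have "e / 2 * Q \<le> e / 2 * d powr (\<alpha> - 1)" using e by (intro mult_left_mono) auto
      moreover have "L \<le> e / 2 * Q"
      proof -
        have "2 * L / e \<le> Q" unfolding Q_def using abs_ge_self[of "2 * L / e"] by linarith
        then show ?thesis using e by (simp add: field_simps)
      qed
      ultimately show ?thesis by linarith
    qed
    show "\<exists>r\<in>{0..<1}. \<forall>z. r \<le> norm z \<and> norm z < 1 \<longrightarrow> norm (deriv g z) \<le> e * (1 - norm z) powr (\<alpha> - 1)"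
    proof (intro bexI[of _ "1 - \<delta>0"] allI impI)
      fix z :: complex assume z: "1 - \<delta>0 \<le> norm z \<and> norm z < 1"
      have "norm (deriv g z) \<le> 25 * \<epsilon> / (1 - \<alpha>) * (1 - norm z) powr (\<alpha> - 1) + 100 * B / t0\<^sup>2"
        by (rule deriv_bound_of_boundary_modulus[OF g cont Gg \<alpha>(1) \<alpha>1 _ t0 B]) (use \<epsilon> z in auto)
      also have "\<dots> \<le> e / 2 * (1 - norm z) powr (\<alpha> - 1) + e / 2 * (1 - norm z) powr (\<alpha> - 1)"
        unfolding \<epsilon>(2) L_def[symmetric] using big[of "1 - norm z"] z by simp
      finally show "norm (deriv g z) \<le> e * (1 - norm z) powr (\<alpha> - 1)" by simp
    qed (use \<delta>0 in auto)
  qed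
qed

theorem theorem9:
  fixes p q :: real and g :: "complex \<Rightarrow> complex"
  assumes "0 < p" and "p < q" and "1 / p - 1 / q \<le> 1"
    and "g holomorphic_on ball 0 1"
  shows "(compact_operator (dirichlet_space p) (dirichlet_norm p) (hardy_space q) (hardy_dist q) (T_op g)
            \<longleftrightarrow> compact_operator (hardy_space p) (hardy_norm p) (hardy_space q) (hardy_dist q) (T_op g))
       \<and> (compact_operator (hardy_space p) (hardy_norm p) (hardy_space q) (hardy_dist q) (T_op g)
            \<longleftrightarrow> g \<in> little_lipschitz (1 / p - 1 / q))"
proof -
  define \<alpha> where "\<alpha> = 1 / p - 1 / q"
  have \<alpha>: "0 < \<alpha>" "\<alpha> \<le> 1" using assms by (auto simp: \<alpha>_def field_simps)
  obtain KH where KH: "radially_controlled p (\<alpha> / 2) (hardy_space p) (hardy_norm p) KH"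
    using radially_controlled_hardy[OF assms(1), of "\<alpha> / 2"] \<alpha> by auto
  obtain KD where KD: "radially_controlled p (\<alpha> / 2) (dirichlet_space p) (dirichlet_norm p) KD"
    using radially_controlled_dirichlet[OF assms(1), of "\<alpha> / 2"] \<alpha> by auto
  obtain C where C: "\<And>a. norm a < 1 \<Longrightarrow> poisson_root p a \<in> dirichlet_space p \<and> dirichlet_norm p (poisson_root p a) \<le> C"
    using poisson_root_dirichlet[OF assms(1)] by blast
  have "little_growth \<alpha> g \<longleftrightarrow> compact_operator (hardy_space p) (hardy_norm p) (hardy_space q) (hardy_dist q) (T_op g)"
    using compact_operator_if_little_growth[OF assms(1,2) \<alpha>_def \<alpha>(2) KH assms(4)]
      little_growth_if_compact_operator[OF assms(1,2) \<alpha>_def assms(4), of "hardy_space p" "hardy_norm p" 1]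
      poisson_root_hardy[OF assms(1)] by blast
  moreover have "little_growth \<alpha> g \<longleftrightarrow> compact_operator (dirichlet_space p) (dirichlet_norm p) (hardy_space q) (hardy_dist q) (T_op g)"
    using compact_operator_if_little_growth[OF assms(1,2) \<alpha>_def \<alpha>(2) KD assms(4)]
      little_growth_if_compact_operator[OF assms(1,2) \<alpha>_def assms(4) C] by blast
  moreover have "little_growth \<alpha> g \<longleftrightarrow> g \<in> little_lipschitz \<alpha>"
    using little_lipschitz_if_little_growth[OF assms(4) \<alpha>] little_growth_if_little_lipschitz[OF _ \<alpha>] by blast
  ultimately show ?thesis by (simp add: \<alpha>_def)
qed

end
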